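(* Let $\gamma_2>0$, $0<9\delta<2l-n$, $\gamma=\min\{\gamma_1,\gamma_2\}$, $2\gamma_1=2l-n-8\delta$. Then for each sufficiently large $k$, $k>k_0(V,\gamma_2,\delta)$, every $t$ in the $(k^{-n+1-7\delta})$-neighborhood in $K$ of $\chi_q(k,\delta)$ and every $A\in\mathbb C$ with $|\sigma||A|^2<k^{-\gamma_2}$, $$\big\|\nabla_t\big(E^\pm(t)-\hat E^\pm(t)\big)\big\|_0<C(V)k^{2l-1-\gamma},\qquad \big|\nabla_t\big(\lambda^\pm(t)-\hat\lambda^\pm(t)\big)\big|<C(V)k^{2l-1-\gamma},$$ where $C(V)$ is a constant depending on $V$.
   Context: Setting. $l,n$ are fixed positive integers with $2l>n$; $\sigma\in\mathbb R$; $Q=[0,2\pi]^n$; $K=[0,1)^n$. $V(x)=\sum_{m\in\mathbb Z^n,\,0<|m|\le R_0}v_me^{i\langle m,x\rangle}$ is a real-valued trigonometric polynomial, not identically zero, and $q\in\mathbb Z^n\setminus\{0\}$ is fixed with $v_q\neq0$. For a $2\pi$-periodic $W$ with Fourier coefficients $w_m$, $\|W\|_*=\sum_{m}|w_m|$. For $j\in\mathbb Z^n$: $P_j(t)=j+t$, $p_j(t)=|P_j(t)|$. $H_0(t)$ is $(-\Delta)^l$ in $L^2(Q)$ with the quasi-periodic conditions $\partial_{x_s}^ru(x_1,\dots,x_s+2\pi,\dots,x_n)=e^{2\pi i t_s}\partial_{x_s}^ru(x)$, $s=1,\dots,n$, $r=0,\dots,2l-1$. Operators are written as matrices in the basis $e^{i\langle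 P_s(t),x\rangle}$, $s\in\mathbb Z^n$: $H_0(t)=\mathrm{diag}(p_s^{2l}(t))$ and multiplication by $W$ is $(w_{s-r})_{s,r}$. For a matrix $T$, $\|T\|_0=\frac12\max_r\sum_p(|T_{pr}|+|T_{rp}|)$. Gradients $\nabla_t$ are taken with $k,\sigma,A,j$ fixed. Resonant set. $S(k)$ is the sphere of radius $k$ centered at $0$, $S_q(k,n-2+\delta)=\{x\in S(k):\big||x|^2-|x-q|^2\big|<4k^{-n+2-\delta}\}$, and $\mathcal K:\mathbb R^n\to K$, $\mathcal KP_m(t)=t$. $\chi_q(k,\delta)$ is a subset of $\mathcal KS_q(k,n-2+\delta)$ such that for each $t\in\chi_q(k,\delta)$: there is $j\in\mathbb Z^n$ with $P_j(t)\in S_q(k,n-2+\delta)$; $|p_{j-q}^2(t)-p_j^2(t)|<4k^{-n+2-\delta}$; and $\min_{i\ne j,j-q}|p_j^2(t)-p_i^2(t)|>2k^{-n+2-6\delta}$. It has asymptotically full measure in $\mathcal KS_q(k,n-2+\delta)$ (relative measure of the complement $O(k^{-\delta/2})$). For $t$ near $\chi_q(k,\delta)$, $j$ is the index attached to a nearby point of $\chi_q(k,\delta)$. For $t$ in the $(2k^{-n+1-7\delta})$-neighborhood of $\chi_q(k,\delta)$ and $z$ on either circle $C_1^\pm=\{z:|z-\hat\lambda^\pm(t)|=d\}$, $d=\frac1{10}|v_q|$, one has $2|p_m^{2l}(t)-z|\ge k^{2l-n-6\delta}$ for $m\neq j,j-q$. Model operator. $\hat\lambda^\pm(t)=a\pm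 b$, $2a=p_j^{2l}+p_{j-q}^{2l}$, $2b=(4|v_q|^2+(p_j^{2l}-p_{j-q}^{2l})^2)^{1/2}$, are the eigenvalues of $\begin{pmatrix}p_j^{2l}(t)&v_q\\ v_{-q}&p_{j-q}^{2l}(t)\end{pmatrix}$. $P_q$ is the diagonal projection onto coordinates $j,j-q$, $\hat H_q(t)=H_0(t)+P_qVP_q$, and $\hat E^\pm(t)$ is the rank-one spectral projection of $\hat H_q(t)$ for $\hat\lambda^\pm(t)$ (supported on coordinates $j,j-q$). Construction. For periodic $W$ with $\|W\|_*<\infty$ put $Y=W-P_qVP_q$ and (whenever the series converge) $\hat E^\pm_W=\hat E^\pm+\sum_{r\ge1}\hat G^\pm_{W,r}$, $\lambda_W^\pm=\hat\lambda^\pm+\sum_{r\ge1}\hat g^\pm_{W,r}$, where $\hat G^\pm_{W,r}=\frac{(-1)^{r+1}}{2\pi i}\oint_{C_1^\pm}((\hat H_q-z)^{-1}Y)^r(\hat H_q-z)^{-1}dz$, $\hat g^\pm_{W,r}=\frac{(-1)^r}{2\pi ir}\mathrm{Tr}\oint_{C_1^\pm}((\hat H_q-z)^{-1}Y)^rdz$. For $A\in\mathbb C$ put $u_W^\pm(x)=A\sum_{s}(\hat E_W^\pm)_{sj}e^{i\langle P_s(t),x\rangle}$, $\hat{\mathcal M}^\pm W=V+\sigma|u_W^\pm|^2$, $W_0^\pm=V$, $W_m^\pm=\hat{\mathcal M}^\pm W_{m-1}^\pm$. $W^\pm$ is the $\|\cdot\|_*$-limit of $W_m^\pm$; $E^\pm(t)=\hat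 E^\pm_{W^\pm}(t)$ and $\lambda^\pm(t)=\lambda^\pm_{W^\pm}(t)$ are the corresponding spectral projection and eigenvalue of $H_0(t)+W^\pm$. *)

theory Defs
  imports "HOL-Complex_Analysis.Complex_Analysis"
begin

text \<open>The dimension $n$ is \<^term>\<open>CARD('n)\<close>.\<close>

type_synonym 'n lattice = "int ^ 'n"
type_synonym 'n matrix = "'n lattice \<Rightarrow> 'n lattice \<Rightarrow> complex"
type_synonym 'n potential = "real ^ 'n \<Rightarrow> complex"

definition lat :: "'n::finite lattice \<Rightarrow> real ^ 'n" where
  "lat m = (\<chi> i. real_of_int (m $ i))"

definition Pvec :: "'n::finite lattice \<Rightarrow> real ^ 'n \<Rightarrow> real ^ 'n" where
  "Pvec j t = lat j + t"

definition pnorm :: "'n::finite lattice \<Rightarrow> real ^ 'n \<Rightarrow> real" where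
  "pnorm j t = norm (Pvec j t)"

definition Kcell :: "(real ^ 'n::finite) set" where
  "Kcell = {t. \<forall>i. 0 \<le> t $ i \<and> t $ i < 1}"

text \<open>The unique point of \<^const>\<open>Kcell\<close> congruent to $x$ modulo the lattice.\<close>

definition Kproj :: "real ^ 'n::finite \<Rightarrow> real ^ 'n" where
  "Kproj x = (\<chi> i. frac (x $ i))"

definition Qcell :: "(real ^ 'n::finite) set" where
  "Qcell = cbox 0 (\<chi> i. 2 * pi)"

definition plane_wave :: "real ^ 'n::finite \<Rightarrow> 'n potential" where
  "plane_wave \<xi> x = cis (\<xi> \<bullet> x)"

definition fourier_coeff :: "'n::finite potential \<Rightarrow> 'n lattice \<Rightarrow> complex" where
  "fourier_coeff W m =
     integral Qcell (\<lambda>x. W x * plane_wave (- lat m) x) / of_real ((2 * pi) ^ CARD('n))"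

definition periodic_integrable :: "'n::finite potential \<Rightarrow> bool" where
  "periodic_integrable W \<longleftrightarrow>
     (\<forall>m x. W (x + (2 * pi) *\<^sub>R lat m) = W x) \<and> W absolutely_integrable_on Qcell"

definition star_norm :: "'n::finite potential \<Rightarrow> ennreal" where
  "star_norm W = (\<Sum>\<^sub>\<infinity>m. ennreal (norm (fourier_coeff W m)))"

definition real_trig_poly :: "real \<Rightarrow> 'n::finite potential \<Rightarrow> bool" where
  "real_trig_poly R\<^sub>0 V \<longleftrightarrow>
     (\<exists>v. \<forall>x. V x = (\<Sum>m | 0 < norm (lat m) \<and> norm (lat m) \<le> R\<^sub>0. v m * plane_wave (lat m) x))
     \<and> (\<forall>x. V x \<in> \<real>)"

definition mident :: "'n::finite matrix" where
  "mident s r = (if s = r then 1 else 0)"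

definition mmul :: "'n::finite matrix \<Rightarrow> 'n matrix \<Rightarrow> 'n matrix" where
  "mmul T S s r = (\<Sum>\<^sub>\<infinity>a. T s a * S a r)"

primrec mpow :: "'n::finite matrix \<Rightarrow> nat \<Rightarrow> 'n matrix" where
  "mpow T 0 = mident"
| "mpow T (Suc r) = mmul T (mpow T r)"

definition mtrace :: "'n::finite matrix \<Rightarrow> complex" where
  "mtrace T = (\<Sum>\<^sub>\<infinity>s. T s s)"

text \<open>Only used for matrices that are block diagonal with finite blocks; for these a two-sided
  inverse is unique among all matrices.\<close>

definition minverse :: "'n::finite matrix \<Rightarrow> 'n matrix" where
  "minverse T = (THE R. mmul T R = mident \<and> mmul R T = mident)"

definition mult_matrix :: "'n::finite potential \<Rightarrow> 'n matrix" where
  "mult_matrix W s r = fourier_coeff W (s - r)"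

text \<open>The entries may be vectors, so that the norm applies to the gradient of a matrix-valued
  function: there the modulus of an entry is the Euclidean length of its gradient.\<close>

definition norm0 :: "('i \<Rightarrow> 'i \<Rightarrow> 'b::real_normed_vector) \<Rightarrow> ennreal" where
  "norm0 T = (SUP r. (\<Sum>\<^sub>\<infinity>p. ennreal (norm (T p r) + norm (T r p)))) / 2"

definition grad :: "(real ^ 'n::finite \<Rightarrow> complex) \<Rightarrow> real ^ 'n \<Rightarrow> complex ^ 'n" where
  "grad f t = (\<chi> i. frechet_derivative f (at t) (axis i 1))"

text \<open>Throughout, the argument \<open>\<epsilon>\<close>, equal to 1 or -1, encodes a superscript plus or minus.\<close>

definition H0 :: "nat \<Rightarrow> real ^ 'n::finite \<Rightarrow> 'n matrix" where
  "H0 l t s r = (if s = r then of_real (pnorm s t ^ (2 * l)) else 0)"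

definition Pq :: "'n::finite lattice \<Rightarrow> 'n lattice \<Rightarrow> 'n matrix" where
  "Pq q j s r = (if s = r \<and> s \<in> {j, j - q} then 1 else 0)"

definition PVP :: "'n::finite potential \<Rightarrow> 'n lattice \<Rightarrow> 'n lattice \<Rightarrow> 'n matrix" where
  "PVP V q j = mmul (Pq q j) (mmul (mult_matrix V) (Pq q j))"

definition Hhat :: "nat \<Rightarrow> 'n::finite potential \<Rightarrow> 'n lattice \<Rightarrow> 'n lattice \<Rightarrow> real ^ 'n \<Rightarrow> 'n matrix" where
  "Hhat l V q j t s r = H0 l t s r + PVP V q j s r"

definition lambda_hat ::
  "nat \<Rightarrow> 'n::finite potential \<Rightarrow> 'n lattice \<Rightarrow> real \<Rightarrow> 'n lattice \<Rightarrow> real ^ 'n \<Rightarrow> real" where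
  "lambda_hat l V q \<epsilon> j t =
     (pnorm j t ^ (2 * l) + pnorm (j - q) t ^ (2 * l)) / 2
     + \<epsilon> * (sqrt (4 * (norm (fourier_coeff V q))\<^sup>2
                  + (pnorm j t ^ (2 * l) - pnorm (j - q) t ^ (2 * l))\<^sup>2) / 2)"

definition E_hat ::
  "nat \<Rightarrow> 'n::finite potential \<Rightarrow> 'n lattice \<Rightarrow> real \<Rightarrow> 'n lattice \<Rightarrow> real ^ 'n \<Rightarrow> 'n matrix" where
  "E_hat l V q \<epsilon> j t = (THE E. \<exists>x.
      (\<forall>s. s \<notin> {j, j - q} \<longrightarrow> x s = 0) \<and>
      (\<Sum>s\<in>{j, j - q}. (norm (x s))\<^sup>2) = 1 \<and>
      (\<forall>s. (\<Sum>\<^sub>\<infinity>r. Hhat l V q j t s r * x r) = of_real (lambda_hat l V q \<epsilon> j t) * x s) \<and>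
      E = (\<lambda>s r. x s * cnj (x r)))"

definition circle_radius :: "'n::finite potential \<Rightarrow> 'n lattice \<Rightarrow> real" where
  "circle_radius V q = norm (fourier_coeff V q) / 10"

definition resolvent ::
  "nat \<Rightarrow> 'n::finite potential \<Rightarrow> 'n lattice \<Rightarrow> 'n lattice \<Rightarrow> real ^ 'n \<Rightarrow> complex \<Rightarrow> 'n matrix" where
  "resolvent l V q j t z = minverse (\<lambda>s r. Hhat l V q j t s r - z * mident s r)"

definition contour ::
  "nat \<Rightarrow> 'n::finite potential \<Rightarrow> 'n lattice \<Rightarrow> real \<Rightarrow> 'n lattice \<Rightarrow> real ^ 'n \<Rightarrow> real \<Rightarrow> complex" where
  "contour l V q \<epsilon> j t = circlepath (of_real (lambda_hat l V q \<epsilon> j t)) (circle_radius V q)"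

definition Ymat ::
  "'n::finite potential \<Rightarrow> 'n lattice \<Rightarrow> 'n lattice \<Rightarrow> 'n potential \<Rightarrow> 'n matrix" where
  "Ymat V q j W s r = mult_matrix W s r - PVP V q j s r"

definition G_term ::
  "nat \<Rightarrow> 'n::finite potential \<Rightarrow> 'n lattice \<Rightarrow> real \<Rightarrow> 'n lattice \<Rightarrow> real ^ 'n \<Rightarrow> 'n potential
    \<Rightarrow> nat \<Rightarrow> 'n matrix" where
  "G_term l V q \<epsilon> j t W r s p =
     (-1) ^ (r + 1) / (2 * of_real pi * \<i>) *
     contour_integral (contour l V q \<epsilon> j t)
       (\<lambda>z. mmul (mpow (mmul (resolvent l V q j t z) (Ymat V q j W)) r) (resolvent l V q j t z) s p)"

definition g_term ::
  "nat \<Rightarrow> 'n::finite potential \<Rightarrow> 'n lattice \<Rightarrow> real \<Rightarrow> 'n lattice \<Rightarrow> real ^ 'n \<Rightarrow> 'n potential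
    \<Rightarrow> nat \<Rightarrow> complex" where
  "g_term l V q \<epsilon> j t W r =
     (-1) ^ r / (2 * of_real pi * \<i> * of_nat r) *
     mtrace (\<lambda>s p. contour_integral (contour l V q \<epsilon> j t)
       (\<lambda>z. mpow (mmul (resolvent l V q j t z) (Ymat V q j W)) r s p))"

definition E_W ::
  "nat \<Rightarrow> 'n::finite potential \<Rightarrow> 'n lattice \<Rightarrow> real \<Rightarrow> 'n lattice \<Rightarrow> real ^ 'n \<Rightarrow> 'n potential
    \<Rightarrow> 'n matrix" where
  "E_W l V q \<epsilon> j t W s p =
     E_hat l V q \<epsilon> j t s p + (\<Sum>r. G_term l V q \<epsilon> j t W (Suc r) s p)"

definition lambda_W ::
  "nat \<Rightarrow> 'n::finite potential \<Rightarrow> 'n lattice \<Rightarrow> real \<Rightarrow> 'n lattice \<Rightarrow> real ^ 'n \<Rightarrow> 'n potential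
    \<Rightarrow> complex" where
  "lambda_W l V q \<epsilon> j t W =
     of_real (lambda_hat l V q \<epsilon> j t) + (\<Sum>r. g_term l V q \<epsilon> j t W (Suc r))"

definition u_W ::
  "nat \<Rightarrow> 'n::finite potential \<Rightarrow> 'n lattice \<Rightarrow> complex \<Rightarrow> real \<Rightarrow> 'n lattice \<Rightarrow> real ^ 'n
    \<Rightarrow> 'n potential \<Rightarrow> 'n potential" where
  "u_W l V q A \<epsilon> j t W x = A * (\<Sum>\<^sub>\<infinity>s. E_W l V q \<epsilon> j t W s j * plane_wave (Pvec s t) x)"

definition M_hat ::
  "nat \<Rightarrow> 'n::finite potential \<Rightarrow> 'n lattice \<Rightarrow> real \<Rightarrow> complex \<Rightarrow> real \<Rightarrow> 'n lattice \<Rightarrow> real ^ 'n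
    \<Rightarrow> 'n potential \<Rightarrow> 'n potential" where
  "M_hat l V q \<sigma> A \<epsilon> j t W x = V x + of_real (\<sigma> * (norm (u_W l V q A \<epsilon> j t W x))\<^sup>2)"

definition W_iter ::
  "nat \<Rightarrow> 'n::finite potential \<Rightarrow> 'n lattice \<Rightarrow> real \<Rightarrow> complex \<Rightarrow> real \<Rightarrow> 'n lattice \<Rightarrow> real ^ 'n
    \<Rightarrow> nat \<Rightarrow> 'n potential" where
  "W_iter l V q \<sigma> A \<epsilon> j t m = (M_hat l V q \<sigma> A \<epsilon> j t ^^ m) V"

text \<open>The limit is determined only up to a null set. Everything below depends on it only through its
  Fourier coefficients, hence not on the choice of the representative. Integrability must be
  required, because \<^const>\<open>integral\<close> is zero on non-integrable functions.\<close>

definition W_lim ::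
  "nat \<Rightarrow> 'n::finite potential \<Rightarrow> 'n lattice \<Rightarrow> real \<Rightarrow> complex \<Rightarrow> real \<Rightarrow> 'n lattice \<Rightarrow> real ^ 'n
    \<Rightarrow> 'n potential" where
  "W_lim l V q \<sigma> A \<epsilon> j t = (SOME W. periodic_integrable W \<and> star_norm W < \<infinity> \<and>
     (\<lambda>m. star_norm (\<lambda>x. W_iter l V q \<sigma> A \<epsilon> j t m x - W x)) \<longlonglongrightarrow> 0)"

definition E_sol ::
  "nat \<Rightarrow> 'n::finite potential \<Rightarrow> 'n lattice \<Rightarrow> real \<Rightarrow> complex \<Rightarrow> real \<Rightarrow> 'n lattice \<Rightarrow> real ^ 'n
    \<Rightarrow> 'n matrix" where
  "E_sol l V q \<sigma> A \<epsilon> j t = E_W l V q \<epsilon> j t (W_lim l V q \<sigma> A \<epsilon> j t)"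

definition lambda_sol ::
  "nat \<Rightarrow> 'n::finite potential \<Rightarrow> 'n lattice \<Rightarrow> real \<Rightarrow> complex \<Rightarrow> real \<Rightarrow> 'n lattice \<Rightarrow> real ^ 'n
    \<Rightarrow> complex" where
  "lambda_sol l V q \<sigma> A \<epsilon> j t = lambda_W l V q \<epsilon> j t (W_lim l V q \<sigma> A \<epsilon> j t)"

definition Sq :: "'n::finite lattice \<Rightarrow> real \<Rightarrow> real \<Rightarrow> (real ^ 'n) set" where
  "Sq q \<delta> k = {x \<in> sphere 0 k.
     \<bar>(norm x)\<^sup>2 - (norm (x - lat q))\<^sup>2\<bar> < 4 * k powr (- real CARD('n) + 2 - \<delta>)}"

text \<open>For given $t$ and $k$ at most one $j$ satisfies this: the second of two such indices would have
  to be $j-q$, and symmetrically.\<close>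

definition attached_index ::
  "'n::finite lattice \<Rightarrow> real \<Rightarrow> real \<Rightarrow> real ^ 'n \<Rightarrow> 'n lattice \<Rightarrow> bool" where
  "attached_index q \<delta> k t j \<longleftrightarrow>
     Pvec j t \<in> Sq q \<delta> k \<and>
     \<bar>(pnorm (j - q) t)\<^sup>2 - (pnorm j t)\<^sup>2\<bar> < 4 * k powr (- real CARD('n) + 2 - \<delta>) \<and>
     (\<forall>i. i \<noteq> j \<and> i \<noteq> j - q \<longrightarrow>
        \<bar>(pnorm j t)\<^sup>2 - (pnorm i t)\<^sup>2\<bar> > 2 * k powr (- real CARD('n) + 2 - 6 * \<delta>))"

definition resonant_set ::
  "nat \<Rightarrow> 'n::finite potential \<Rightarrow> 'n lattice \<Rightarrow> real \<Rightarrow> real \<Rightarrow> (real ^ 'n) set \<Rightarrow> bool" where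
  "resonant_set l V q \<delta> k X \<longleftrightarrow>
     X \<subseteq> Kproj ` Sq q \<delta> k \<and>
     (\<forall>t\<in>X. \<exists>j. attached_index q \<delta> k t j) \<and>
     (\<forall>t\<^sub>0\<in>X. \<forall>j t. attached_index q \<delta> k t\<^sub>0 j \<and>
        dist t t\<^sub>0 < 2 * k powr (- real CARD('n) + 1 - 7 * \<delta>) \<longrightarrow>
        (\<forall>\<epsilon>\<in>{1, -1}. \<forall>z::complex. norm (z - of_real (lambda_hat l V q \<epsilon> j t)) = circle_radius V q \<longrightarrow>
          (\<forall>m. m \<noteq> j \<and> m \<noteq> j - q \<longrightarrow>
            2 * norm (of_real (pnorm m t ^ (2 * l)) - z)
              \<ge> k powr (2 * real l - real CARD('n) - 6 * \<delta>))))"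

text \<open>The $d$-dimensional Hausdorff (outer) measure, without normalizing constant; only ratios of its
  values matter.\<close>

definition hausdorff_content :: "nat \<Rightarrow> real \<Rightarrow> 'a::metric_space set \<Rightarrow> ennreal" where
  "hausdorff_content d e B =
     (INF U\<in>{U :: nat \<Rightarrow> 'a set. B \<subseteq> (\<Union>i. U i) \<and> (\<forall>i. bounded (U i) \<and> diameter (U i) \<le> e)}.
        \<Sum>i. if U i = {} then 0 else ennreal (diameter (U i) ^ d))"

definition hausdorff_measure :: "nat \<Rightarrow> 'a::metric_space set \<Rightarrow> ennreal" where
  "hausdorff_measure d B = (SUP e\<in>{0<..}. hausdorff_content d e B)"

definition asymptotically_full ::
  "'n::finite lattice \<Rightarrow> real \<Rightarrow> (real \<Rightarrow> (real ^ 'n) set) \<Rightarrow> bool" where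
  "asymptotically_full q \<delta> X \<longleftrightarrow>
     (\<exists>c>0. \<forall>\<^sub>F k in at_top.
        hausdorff_measure (CARD('n) - 1) (Kproj ` Sq q \<delta> k - X k)
          \<le> ennreal (c * k powr (- \<delta> / 2)) * hausdorff_measure (CARD('n) - 1) (Kproj ` Sq q \<delta> k))"

end

theory Submission
  imports Defs
begin

text \<open>The space of functions of $(t,\theta)$ that are $C^1$ in $t$, with norm
  $\sup|f| + \rho\sup|\nabla_t f|$ and $\rho = k^{1-2l}$, is a Banach algebra invariant under complex
  conjugation, so the whole construction of $W^\pm$ can be carried out with coefficients in this
  algebra; a bound $\varepsilon$ on a norm then gives the bound $\varepsilon k^{2l-1}$ on a gradient.
  The contour is parametrized by $z = \hat\lambda^\pm(t) + d e^{2\pi i\theta}$, and contour integrals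
  become averages over $\theta$. In the algebra the resolvent of $\hat H_q$ is $O(1)$ on the block
  $\{j, j-q\}$ and $O(\kappa^{-2})$ off it, $\kappa^2 = k^{2l-n-6\delta}$. Conjugating
  $(\hat H_q - z)^{-1}Y$ by the weights 1 on the block and $\kappa$ off it makes its norm
  $O(k^{-\gamma_2} + \kappa^{-1}) = O(k^{-\gamma})$, so the perturbation series and the iteration
  for $W^\pm$ converge, and all corrections have norm $O(k^{-\gamma})$.\<close>

section \<open>Norms of matrices with function entries\<close>

text \<open>The scale \<rho> = k^(1-2l) is dictated by the block: there p_m is at most 2k, so the
  gradient of p_m^(2l) is O(k^(2l-1)) and the rescaled gradient is O(1). Two obstacles remain. Off
  the block these gradients are unbounded in m; they are absorbed because the derivative of 1/f
  carries 1/f^2, and f = p_m^(2l) - z itself grows like p_m^(2l). And maxima of row and column sums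
  do not control the trace in the eigenvalue series. Its integrand is therefore compared with the
  same power of the matrix whose block rows and columns are deleted. The deleted matrix has no
  singularity inside the contour, so its integral vanishes by Cauchy's theorem; the two matrices
  differ in two rows and two columns only, so the difference of their powers has absolutely summable
  entries. Since |u|^2 involves conjugates, the iteration does not preserve holomorphy in t; this is
  why derivatives are carried inside the norm instead of being recovered from sup bounds on a
  complex neighborhood. The fixed point is contracted in the same norm, so the t-dependence of W
  itself is differentiated along with everything else.\<close>

abbreviation esum :: "('i \<Rightarrow> ennreal) \<Rightarrow> ennreal" where
  "esum f \<equiv> (\<integral>\<^sup>+x. f x \<partial>count_space UNIV)"

lemma esum_mono: "(\<And>i. f i \<le> g i) \<Longrightarrow> esum f \<le> esum g"
  by (rule nn_integral_mono) auto

lemma esum_cmult: "esum (\<lambda>i. c * f i) = c * esum f"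
  by (rule nn_integral_cmult) auto

lemma esum_multc: "esum (\<lambda>i. f i * c) = esum f * c"
  by (rule nn_integral_multc) auto

lemma esum_add: "esum (\<lambda>i. f i + g i) = esum f + esum g"
  by (rule nn_integral_add) auto

lemma esum_swap:
  fixes f :: "'i::countable \<Rightarrow> 'j::countable \<Rightarrow> ennreal"
  shows "esum (\<lambda>i. esum (\<lambda>j. f i j)) = esum (\<lambda>j. esum (\<lambda>i. f i j))"
  using nn_integral_fst_count_space[of "\<lambda>(i,j). f i j"] nn_integral_snd_count_space[of "\<lambda>(i,j). f i j"]
  by simp

lemma esum_bij: "bij h \<Longrightarrow> esum (\<lambda>i. f (h i)) = esum f"
  by (rule nn_integral_bij_count_space) (auto simp: bij_def bij_betw_def)

lemma sum_le_esum: "finite F \<Longrightarrow> sum f F \<le> esum f"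
proof -
  assume F: "finite F"
  have "sum f F = (\<integral>\<^sup>+x. f x \<partial>count_space F)"
    using F by (simp add: nn_integral_count_space_finite)
  also have "\<dots> = (\<integral>\<^sup>+x. f x * indicator F x \<partial>count_space UNIV)"
    by (subst nn_integral_restrict_space[symmetric]) (auto simp: restrict_count_space)
  also have "\<dots> \<le> esum f" by (intro esum_mono) (auto simp: indicator_def)
  finally show ?thesis .
qed

lemma le_esum: "f i \<le> esum f"
  using sum_le_esum[of "{i}" f] by simp

lemma esum_finite_support:
  assumes "finite F" "\<And>i. i \<notin> F \<Longrightarrow> f i = 0"
  shows "esum f = sum f F"
proof -
  have "sum f F = (\<integral>\<^sup>+x. f x \<partial>count_space F)"
    using assms by (simp add: nn_integral_count_space_finite)
  also have "\<dots> = (\<integral>\<^sup>+x. f x * indicator F x \<partial>count_space UNIV)"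
    by (subst nn_integral_restrict_space[symmetric]) (auto simp: restrict_count_space)
  also have "\<dots> = esum f" using assms by (intro nn_integral_cong) (auto simp: indicator_def)
  finally show ?thesis by simp
qed

text \<open>Turns a sum over a countable index set into a series over the naturals, with zeros at
  numbers that encode no index. In this way an axiom about series yields statements about sums over
  the lattice.\<close>

lemma esum_to_nat:
  fixes f :: "'i::countable \<Rightarrow> ennreal"
  shows "esum f = (\<Sum>n. if n \<in> range (to_nat :: 'i \<Rightarrow> nat) then f (from_nat n) else 0)"
proof -
  have "(\<Sum>n. if n \<in> range (to_nat :: 'i \<Rightarrow> nat) then f (from_nat n) else 0)
      = (\<integral>\<^sup>+n. f (from_nat n) * indicator (range (to_nat :: 'i \<Rightarrow> nat)) n \<partial>count_space UNIV)"
    by (subst nn_integral_count_space_nat) (auto simp: indicator_def intro!: suminf_cong)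
  also have "\<dots> = (\<integral>\<^sup>+n. f (from_nat n) \<partial>count_space (range (to_nat :: 'i \<Rightarrow> nat)))"
    by (subst nn_integral_restrict_space[symmetric]) (auto simp: restrict_count_space)
  also have "\<dots> = esum (\<lambda>i::'i. f (from_nat (to_nat i)))"
    by (rule nn_integral_bij_count_space[symmetric]) (simp add: bij_betw_def)
  finally show ?thesis by simp
qed

text \<open>The norms of the problem are written with \<open>infsum\<close>; estimates use the
  integral over counting measure, where Tonelli and monotonicity are at hand. This lemma is the
  bridge.\<close>

lemma esum_eq_infsum:
  fixes f :: "'i::countable \<Rightarrow> ennreal"
  shows "(\<Sum>\<^sub>\<infinity>i. f i) = esum f"
proof (rule antisym)
  show "(\<Sum>\<^sub>\<infinity>i. f i) \<le> esum f"
    by (rule infsum_le_finite_sums) (simp_all add: sum_le_esum nonneg_summable_on_complete)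
  let ?g = "\<lambda>n. if n \<in> range (to_nat :: 'i \<Rightarrow> nat) then f (from_nat n) else 0"
  have "(\<Sum>n<N. ?g n) \<le> (\<Sum>\<^sub>\<infinity>i. f i)" for N
  proof -
    have "(\<Sum>n<N. ?g n) = (\<Sum>n\<in>{..<N} \<inter> range (to_nat :: 'i \<Rightarrow> nat). f (from_nat n))"
      by (simp add: sum.inter_restrict)
    also have "\<dots> = (\<Sum>i\<in>to_nat -` {..<N}. f i)"
      by (rule sum.reindex_bij_witness[of _ to_nat from_nat]) auto
    also have "\<dots> \<le> (\<Sum>\<^sub>\<infinity>i. f i)"
      by (subst nonneg_infsum_complete) (auto intro!: SUP_upper finite_vimageI)
    finally show ?thesis .
  qed
  then show "esum f \<le> (\<Sum>\<^sub>\<infinity>i. f i)"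
    unfolding esum_to_nat by (simp add: suminf_eq_SUP SUP_le_iff)
qed

lemma esum_norm_summable:
  fixes f :: "'i \<Rightarrow> complex"
  assumes "esum (\<lambda>i. ennreal (norm (f i))) < top"
  shows "(\<lambda>i. norm (f i)) summable_on UNIV"
proof -
  have "sum (\<lambda>i. norm (f i)) F \<le> enn2real (esum (\<lambda>i. ennreal (norm (f i))))" if "finite F" for F
  proof -
    have "ennreal (sum (\<lambda>i. norm (f i)) F) \<le> esum (\<lambda>i. ennreal (norm (f i)))"
      using sum_le_esum[OF that, of "\<lambda>i. ennreal (norm (f i))"] by (simp add: sum_ennreal)
    then show ?thesis
      using assms enn2real_mono[of "ennreal (sum (\<lambda>i. norm (f i)) F)"]
      by (metis enn2real_ennreal norm_ge_zero sum_nonneg)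
  qed
  then show ?thesis
    by (intro nonneg_bdd_above_summable_on) (auto intro!: bdd_aboveI)
qed

lemma esum_bounded_summable:
  assumes "esum b < top" "\<And>i. ennreal (norm (f i :: complex)) \<le> b i"
  shows "f summable_on UNIV" "(\<lambda>i. norm (f i)) summable_on UNIV"
proof -
  have "esum (\<lambda>i. ennreal (norm (f i))) \<le> esum b" by (rule esum_mono) (rule assms(2))
  then show *: "(\<lambda>i. norm (f i)) summable_on UNIV"
    using assms(1) by (intro esum_norm_summable) auto
  show "f summable_on UNIV" using * by (rule abs_summable_summable)
qed

lemma has_sum_diff:
  fixes f g :: "'i \<Rightarrow> 'b::real_normed_vector"
  assumes "(f has_sum a) A" "(g has_sum b) A"
  shows "((\<lambda>x. f x - g x) has_sum (a - b)) A"
  using has_sum_add[OF assms(1), of "\<lambda>x. - g x" "- b"] assms(2) by (simp add: has_sum_uminus)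

section \<open>Submultiplicative function norms and the matrix norms built on them\<close>

definition mtransp :: "'n::finite matrix \<Rightarrow> 'n matrix" where "mtransp T s r = T r s"

lemma mtransp_mmul: "mtransp (mmul T S) = mmul (mtransp S) (mtransp T)"
  by (simp add: fun_eq_iff mtransp_def mmul_def mult.commute)

text \<open>Functions outside the algebra have norm \<open>top\<close>, so no membership conditions
  are needed: finiteness of \<open>nb\<close> carries regularity. \<open>nb_suminf\<close> is
  completeness in the form in which it is used. There are two instances, C^1 functions of (t,
  \<theta>) and bounded holomorphic functions of z.\<close>

locale function_norm =
  fixes dom :: "'p set" and nb :: "('p \<Rightarrow> complex) \<Rightarrow> ennreal"
  assumes nb_cong: "(\<And>p. p \<in> dom \<Longrightarrow> f p = g p) \<Longrightarrow> nb f = nb g"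
    and nb_const: "nb (\<lambda>_. c) \<le> ennreal (norm c)"
    and nb_pt: "p \<in> dom \<Longrightarrow> ennreal (norm (f p)) \<le> nb f"
    and nb_add: "nb (\<lambda>p. f p + g p) \<le> nb f + nb g"
    and nb_mult: "nb (\<lambda>p. f p * g p) \<le> nb f * nb g"
    and nb_suminf: "(\<Sum>n. nb (h n)) < top \<Longrightarrow> nb (\<lambda>p. \<Sum>n. h n p) \<le> (\<Sum>n. nb (h n))"
begin

lemma nb_0 [simp]: "nb (\<lambda>_. 0) = 0"
  using nb_const[of 0] by simp

lemma nb_cmult: "nb (\<lambda>p. c * f p) \<le> ennreal (norm c) * nb f"
  using nb_mult[of "\<lambda>_. c" f] nb_const[of c] by (meson mult_right_mono order_trans zero_le)

lemma nb_uminus: "nb (\<lambda>p. - f p) \<le> nb f"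
  using nb_cmult[of "-1" f] by simp

lemma nb_diff: "nb (\<lambda>p. f p - g p) \<le> nb f + nb g"
  using nb_add[of f "\<lambda>p. - g p"] nb_uminus[of g] by (simp add: add_left_mono order_trans)

text \<open>If the right-hand side is infinite nothing is claimed; otherwise \<open>nb_pt\<close>
  makes the family absolutely summable at each point of \<open>dom\<close>, the unordered sum equals
  a series over the naturals, and \<open>nb_suminf\<close> applies.\<close>

lemma nb_infsum:
  fixes f :: "'i::countable \<Rightarrow> 'p \<Rightarrow> complex"
  shows "nb (\<lambda>p. \<Sum>\<^sub>\<infinity>i. f i p) \<le> esum (\<lambda>i. nb (f i))"
proof (cases "esum (\<lambda>i. nb (f i)) < top")
  case True
  define g where "g n p = (if n \<in> range (to_nat :: 'i \<Rightarrow> nat) then f (from_nat n) p else 0)" for n p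
  have ng: "nb (g n) = (if n \<in> range (to_nat :: 'i \<Rightarrow> nat) then nb (f (from_nat n)) else 0)" for n
    unfolding g_def by (cases "n \<in> range (to_nat :: 'i \<Rightarrow> nat)") auto
  have es: "esum (\<lambda>i. nb (f i)) = (\<Sum>n. nb (g n))"
    unfolding esum_to_nat ng ..
  have "nb (\<lambda>p. \<Sum>\<^sub>\<infinity>i. f i p) = nb (\<lambda>p. \<Sum>n. g n p)"
  proof (rule nb_cong)
    fix p assume p: "p \<in> dom"
    have "(\<lambda>i. f i p) summable_on UNIV"
      by (rule esum_bounded_summable[OF True]) (rule nb_pt[OF p])
    then have "((\<lambda>i. f i p) has_sum (\<Sum>\<^sub>\<infinity>i. f i p)) UNIV" by (rule has_sum_infsum)
    moreover have "((\<lambda>i. f i p) has_sum x) UNIV \<longleftrightarrow> ((\<lambda>n. f (from_nat n) p) has_sum x) (range (to_nat :: 'i \<Rightarrow> nat))" for x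
      by (subst has_sum_reindex) (auto simp: o_def)
    moreover have "((\<lambda>n. f (from_nat n) p) has_sum x) (range (to_nat :: 'i \<Rightarrow> nat)) \<longleftrightarrow> ((\<lambda>n. g n p) has_sum x) UNIV" for x
      by (rule has_sum_cong_neutral) (auto simp: g_def)
    ultimately have "((\<lambda>n. g n p) has_sum (\<Sum>\<^sub>\<infinity>i. f i p)) UNIV" by simp
    then show "(\<Sum>\<^sub>\<infinity>i. f i p) = (\<Sum>n. g n p)"
      using has_sum_imp_sums sums_unique by blast
  qed
  also have "\<dots> \<le> (\<Sum>n. nb (g n))"
    by (rule nb_suminf) (use True es in simp)
  finally show ?thesis using es by simp
qed (auto simp: not_less top_unique)

definition nbm :: "('p \<Rightarrow> 'n::finite matrix) \<Rightarrow> 'n lattice \<Rightarrow> 'n lattice \<Rightarrow> ennreal" where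
  "nbm T s r = nb (\<lambda>p. T p s r)"

definition rown :: "('p \<Rightarrow> 'n::finite matrix) \<Rightarrow> ennreal" where
  "rown T = (SUP s. esum (\<lambda>r. nbm T s r))"

definition coln :: "('p \<Rightarrow> 'n::finite matrix) \<Rightarrow> ennreal" where
  "coln T = (SUP r. esum (\<lambda>s. nbm T s r))"

text \<open>Rows and columns are both kept because \<open>norm0\<close> averages a row sum and a
  column sum, and because the iteration reads off a single column.\<close>

definition mn :: "('p \<Rightarrow> 'n::finite matrix) \<Rightarrow> ennreal" where
  "mn T = max (rown T) (coln T)"

text \<open>Plays the role of a trace norm: it dominates the sum of the diagonal entries, and it is
  an ideal norm with respect to \<open>mn\<close> (\<open>tn_mmul_left\<close>,
  \<open>tn_mmul_right\<close>).\<close>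

definition tn :: "('p \<Rightarrow> 'n::finite matrix) \<Rightarrow> ennreal" where
  "tn T = esum (\<lambda>s. esum (\<lambda>r. nbm T s r))"

lemma nbm_cong: "(\<And>p s r. p \<in> dom \<Longrightarrow> T p s r = S p s r) \<Longrightarrow> nbm T = nbm S"
  unfolding nbm_def fun_eq_iff by (auto intro!: nb_cong)

lemma mn_cong: "(\<And>p s r. p \<in> dom \<Longrightarrow> T p s r = S p s r) \<Longrightarrow> mn T = mn S"
  unfolding mn_def rown_def coln_def using nbm_cong[of T S] by simp

lemma tn_cong: "(\<And>p s r. p \<in> dom \<Longrightarrow> T p s r = S p s r) \<Longrightarrow> tn T = tn S"
  unfolding tn_def using nbm_cong[of T S] by simp

lemma row_le_rown: "esum (\<lambda>r. nbm T s r) \<le> rown T"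
  unfolding rown_def by (rule SUP_upper) simp

lemma col_le_coln: "esum (\<lambda>s. nbm T s r) \<le> coln T"
  unfolding coln_def by (rule SUP_upper) simp

lemma row_le: "esum (\<lambda>r. nbm T s r) \<le> mn T"
  unfolding mn_def using row_le_rown le_max_iff_disj by blast

lemma col_le: "esum (\<lambda>s. nbm T s r) \<le> mn T"
  unfolding mn_def using col_le_coln le_max_iff_disj by blast

lemma entry_le: "nbm T s r \<le> mn T"
  using row_le le_esum order_trans by metis

lemma mn_leI:
  assumes "\<And>s. esum (\<lambda>r. nbm T s r) \<le> c" "\<And>r. esum (\<lambda>s. nbm T s r) \<le> c"
  shows "mn T \<le> c"
  unfolding mn_def rown_def coln_def using assms by (auto intro!: SUP_least)

lemma nbm_mmul: "nbm (\<lambda>p. mmul (T p) (S p)) s r \<le> esum (\<lambda>a. nbm T s a * nbm S a r)"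
  unfolding nbm_def mmul_def
  by (rule order_trans[OF nb_infsum]) (intro esum_mono nb_mult)

lemma rown_mmul: "rown (\<lambda>p. mmul (T p) (S p)) \<le> rown T * rown S"
  unfolding rown_def[of "\<lambda>p. mmul (T p) (S p)"]
proof (rule SUP_least)
  fix s
  have "esum (\<lambda>r. nbm (\<lambda>p. mmul (T p) (S p)) s r) \<le> esum (\<lambda>r. esum (\<lambda>a. nbm T s a * nbm S a r))"
    by (intro esum_mono nbm_mmul)
  also have "\<dots> = esum (\<lambda>a. nbm T s a * esum (\<lambda>r. nbm S a r))"
    by (subst esum_swap) (simp add: esum_cmult)
  also have "\<dots> \<le> esum (\<lambda>a. nbm T s a * rown S)"
    by (intro esum_mono mult_left_mono row_le_rown) simp
  also have "\<dots> = esum (\<lambda>a. nbm T s a) * rown S" by (rule esum_multc)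
  also have "\<dots> \<le> rown T * rown S" by (intro mult_right_mono row_le_rown) simp
  finally show "esum (\<lambda>r. nbm (\<lambda>p. mmul (T p) (S p)) s r) \<le> rown T * rown S" .
qed

lemma coln_transp: "coln T = rown (\<lambda>p. mtransp (T p))"
  unfolding coln_def rown_def nbm_def mtransp_def ..

lemma coln_mmul: "coln (\<lambda>p. mmul (T p) (S p)) \<le> coln T * coln S"
  unfolding coln_transp mtransp_mmul
  using rown_mmul[of "\<lambda>p. mtransp (S p)" "\<lambda>p. mtransp (T p)"] by (simp add: mult.commute)

lemma mn_mmul: "mn (\<lambda>p. mmul (T p) (S p)) \<le> mn T * mn S"
proof -
  have "rown T * rown S \<le> mn T * mn S" "coln T * coln S \<le> mn T * mn S"
    unfolding mn_def by (intro mult_mono; simp)+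
  then show ?thesis
    unfolding mn_def[of "\<lambda>p. mmul (T p) (S p)"]
    using rown_mmul[of T S] coln_mmul[of T S] by (auto intro: order_trans)
qed

lemma mn_add: "mn (\<lambda>p s r. T p s r + S p s r) \<le> mn T + mn S"
proof (rule mn_leI)
  fix s
  have "esum (\<lambda>r. nbm (\<lambda>p s r. T p s r + S p s r) s r) \<le> esum (\<lambda>r. nbm T s r + nbm S s r)"
    unfolding nbm_def by (intro esum_mono nb_add)
  also have "\<dots> \<le> mn T + mn S" unfolding esum_add by (intro add_mono row_le)
  finally show "esum (\<lambda>r. nbm (\<lambda>p s r. T p s r + S p s r) s r) \<le> mn T + mn S" .
  have "esum (\<lambda>r. nbm (\<lambda>p s r. T p s r + S p s r) r s) \<le> esum (\<lambda>r. nbm T r s + nbm S r s)"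
    unfolding nbm_def by (intro esum_mono nb_add)
  also have "\<dots> \<le> mn T + mn S" unfolding esum_add by (intro add_mono col_le)
  finally show "esum (\<lambda>r. nbm (\<lambda>p s r. T p s r + S p s r) r s) \<le> mn T + mn S" .
qed

lemma tn_add: "tn (\<lambda>p s r. T p s r + S p s r) \<le> tn T + tn S"
  unfolding tn_def esum_add[symmetric] nbm_def by (intro esum_mono nb_add)

lemma mn_mono: "(\<And>s r. nbm T s r \<le> nbm S s r) \<Longrightarrow> mn T \<le> mn S"
  by (rule mn_leI) (rule order_trans[OF esum_mono], assumption, rule row_le col_le)+

lemma mn_weighted_mono: 
  assumes "\<And>s r. nbm T s r \<le> c * nbm S s r"
  shows "mn T \<le> c * mn S"
proof (rule mn_leI)
  fix s
  have "esum (\<lambda>r. nbm T s r) \<le> esum (\<lambda>r. c * nbm S s r)" by (intro esum_mono assms)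
  also have "\<dots> \<le> c * mn S" unfolding esum_cmult by (intro mult_left_mono row_le) simp
  finally show "esum (\<lambda>r. nbm T s r) \<le> c * mn S" .
  have "esum (\<lambda>r. nbm T r s) \<le> esum (\<lambda>r. c * nbm S r s)" by (intro esum_mono assms)
  also have "\<dots> \<le> c * mn S" unfolding esum_cmult by (intro mult_left_mono col_le) simp
  finally show "esum (\<lambda>r. nbm T r s) \<le> c * mn S" .
qed

lemma mn_ident: "mn (\<lambda>_. mident) \<le> 1"
proof (rule mn_leI)
  fix s :: "'a lattice"
  have n: "nbm (\<lambda>_. mident) s r \<le> (if r = s then 1 else 0)" "nbm (\<lambda>_. mident) r s \<le> (if r = s then 1 else 0)" for r
    unfolding nbm_def mident_def using nb_const[of 1] by auto
  have e: "esum (\<lambda>r. if r = s then 1 else 0) = 1"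
    by (subst esum_finite_support[of "{s}"]) auto
  show "esum (\<lambda>r. nbm (\<lambda>_. mident) s r) \<le> 1" "esum (\<lambda>r. nbm (\<lambda>_. mident) r s) \<le> 1"
    using esum_mono[of "\<lambda>r. nbm (\<lambda>_. mident) s r", OF n(1)]
      esum_mono[of "\<lambda>r. nbm (\<lambda>_. mident) r s", OF n(2)] e by (auto simp: o_def)
qed

lemma mn_mpow: "mn (\<lambda>p. mpow (T p) r) \<le> mn T ^ r"
proof (induction r)
  case 0
  show ?case using mn_ident by simp
next
  case (Suc r)
  have "mn (\<lambda>p. mpow (T p) (Suc r)) \<le> mn T * mn (\<lambda>p. mpow (T p) r)"
    using mn_mmul[of T "\<lambda>p. mpow (T p) r"] by simp
  also have "\<dots> \<le> mn T * mn T ^ r" by (intro mult_left_mono Suc) simp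
  finally show ?case by simp
qed

lemma mn_mpow_le: "mn T \<le> c \<Longrightarrow> mn (\<lambda>p. mpow (T p) r) \<le> c ^ r"
  using mn_mpow[of T r] power_mono[of "mn T" c r] by (auto intro: order_trans)

text \<open>\<open>infsum\<close> is 0 on a family that is not summable, so distributivity of
  \<open>mmul\<close> is available only with finite norms. This is the source of the conditions
  \<open>< top\<close> from here on.\<close>

lemma pt_mmul_summable:
  assumes "mn T < top" "mn S < top" "p \<in> dom"
  shows "(\<lambda>a. T p s a * S p a r) summable_on UNIV"
proof (rule esum_bounded_summable(1)[where b = "\<lambda>a. nbm T s a * mn S"])
  show "esum (\<lambda>a. nbm T s a * mn S) < top"
    using row_le[of T s] assms by (simp add: esum_multc ennreal_mult_less_top order_le_less_trans)
  fix a
  have "ennreal (norm (T p s a * S p a r)) = ennreal (norm (T p s a)) * ennreal (norm (S p a r))"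
    by (simp add: norm_mult ennreal_mult)
  also have "\<dots> \<le> nbm T s a * mn S"
    using entry_le[of S a r] nb_pt[OF assms(3), of "\<lambda>p. T p s a"] nb_pt[OF assms(3), of "\<lambda>p. S p a r"]
    unfolding nbm_def by (intro mult_mono) auto
  finally show "ennreal (norm (T p s a * S p a r)) \<le> nbm T s a * mn S" .
qed

lemma mmul_diff_right:
  assumes "mn T < top" "mn S < top" "mn S' < top" "p \<in> dom"
  shows "mmul (T p) (\<lambda>s r. S p s r - S' p s r) s r = mmul (T p) (S p) s r - mmul (T p) (S' p) s r"
  using has_sum_diff[OF has_sum_infsum[OF pt_mmul_summable] has_sum_infsum[OF pt_mmul_summable], OF assms(1,2,4,1,3,4), of s r s r]
  unfolding mmul_def by (intro infsumI) (simp add: algebra_simps)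

lemma mmul_diff_left:
  assumes "mn T < top" "mn T' < top" "mn S < top" "p \<in> dom"
  shows "mmul (\<lambda>s r. T p s r - T' p s r) (S p) s r = mmul (T p) (S p) s r - mmul (T' p) (S p) s r"
  using has_sum_diff[OF has_sum_infsum[OF pt_mmul_summable] has_sum_infsum[OF pt_mmul_summable], OF assms(1,3,4,2,3,4), of s r s r]
  unfolding mmul_def by (intro infsumI) (simp add: algebra_simps)

text \<open>Telescoping T^(n+1) - S^(n+1) = T (T^n - S^n) + (T - S) S^n. It is the induction step
  for both norms.\<close>

lemma mpow_diff_step:
  assumes T: "mn T < top" and S: "mn S < top" and p: "p \<in> dom"
  shows "mpow (T p) (Suc n) s r - mpow (S p) (Suc n) s r =
    mmul (T p) (\<lambda>s r. mpow (T p) n s r - mpow (S p) n s r) s r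
    + mmul (\<lambda>s r. T p s r - S p s r) (mpow (S p) n) s r"
proof -
  have fin: "mn (\<lambda>p. mpow (T p) n) < top" "mn (\<lambda>p. mpow (S p) n) < top"
    using mn_mpow[of T n] mn_mpow[of S n] T S
    by (simp_all add: order_le_less_trans power_less_top_ennreal)
  show ?thesis
    using mmul_diff_right[OF T fin p] mmul_diff_left[OF T S fin(2) p] by simp
qed

text \<open>The factor n c^(n-1) is that of the derivative of x^n; for n = 0 the factor
  \<open>of_nat n\<close> makes the truncated exponent harmless. Summed over n it gives the
  Lipschitz constant of the perturbation series in the potential.\<close>

lemma mn_mpow_diff:
  assumes T: "mn T \<le> c" and S: "mn S \<le> c" and c: "c < top"
    and d: "mn (\<lambda>p s r. T p s r - S p s r) \<le> d"
  shows "mn (\<lambda>p s r. mpow (T p) n s r - mpow (S p) n s r) \<le> of_nat n * c ^ (n - 1) * d"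
proof (induction n)
  case 0
  show ?case by (simp add: mn_def rown_def coln_def nbm_def)
next
  case (Suc n)
  have fin: "mn T < top" "mn S < top" using T S c by auto
  have "mn (\<lambda>p s r. mpow (T p) (Suc n) s r - mpow (S p) (Suc n) s r)
     = mn (\<lambda>p s r. mmul (T p) (\<lambda>s r. mpow (T p) n s r - mpow (S p) n s r) s r
        + mmul (\<lambda>s r. T p s r - S p s r) (mpow (S p) n) s r)"
    by (rule mn_cong) (rule mpow_diff_step[OF fin])
  also have "\<dots> \<le> mn T * mn (\<lambda>p s r. mpow (T p) n s r - mpow (S p) n s r)
      + mn (\<lambda>p s r. T p s r - S p s r) * mn (\<lambda>p. mpow (S p) n)"
    by (rule order_trans[OF mn_add]) (intro add_mono mn_mmul)
  also have "\<dots> \<le> c * (of_nat n * c ^ (n - 1) * d) + d * c ^ n"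
    by (intro add_mono mult_mono Suc T d mn_mpow_le S) auto
  also have "\<dots> = of_nat (Suc n) * c ^ (Suc n - 1) * d"
    by (cases n) (auto simp: algebra_simps)
  finally show ?case .
qed

section \<open>Absolutely summable differences of powers\<close>

lemma tn_mmul_left: "tn (\<lambda>p. mmul (T p) (S p)) \<le> mn T * tn S"
proof -
  have "tn (\<lambda>p. mmul (T p) (S p)) \<le> esum (\<lambda>s. esum (\<lambda>r. esum (\<lambda>a. nbm T s a * nbm S a r)))"
    unfolding tn_def by (intro esum_mono nbm_mmul)
  also have "\<dots> = esum (\<lambda>s. esum (\<lambda>a. nbm T s a * esum (\<lambda>r. nbm S a r)))"
    by (subst esum_swap) (simp add: esum_cmult)
  also have "\<dots> = esum (\<lambda>a. esum (\<lambda>s. nbm T s a) * esum (\<lambda>r. nbm S a r))"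
    by (subst esum_swap) (simp add: esum_multc)
  also have "\<dots> \<le> esum (\<lambda>a. mn T * esum (\<lambda>r. nbm S a r))"
    by (intro esum_mono mult_right_mono col_le) simp
  finally show ?thesis by (simp add: esum_cmult tn_def)
qed

lemma tn_mmul_right: "tn (\<lambda>p. mmul (T p) (S p)) \<le> tn T * mn S"
proof -
  have "tn (\<lambda>p. mmul (T p) (S p)) \<le> esum (\<lambda>s. esum (\<lambda>r. esum (\<lambda>a. nbm T s a * nbm S a r)))"
    unfolding tn_def by (intro esum_mono nbm_mmul)
  also have "\<dots> = esum (\<lambda>s. esum (\<lambda>a. nbm T s a * esum (\<lambda>r. nbm S a r)))"
    by (subst esum_swap) (simp add: esum_cmult)
  also have "\<dots> \<le> esum (\<lambda>s. esum (\<lambda>a. nbm T s a * mn S))"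
    by (intro esum_mono mult_left_mono row_le) simp
  finally show ?thesis by (simp add: esum_multc tn_def)
qed

text \<open>Each term of the telescoping sum contains the factor T - S exactly once; only that
  factor is measured by \<open>tn\<close>, since the powers themselves need not have finite
  \<open>tn\<close>.\<close>

lemma tn_mpow_diff:
  assumes T: "mn T \<le> c" and S: "mn S \<le> c" and c: "c < top"
    and d: "tn (\<lambda>p s r. T p s r - S p s r) \<le> d"
  shows "tn (\<lambda>p s r. mpow (T p) n s r - mpow (S p) n s r) \<le> of_nat n * c ^ (n - 1) * d"
proof (induction n)
  case 0
  show ?case by (simp add: tn_def nbm_def)
next
  case (Suc n)
  have fin: "mn T < top" "mn S < top" using T S c by auto
  have "tn (\<lambda>p s r. mpow (T p) (Suc n) s r - mpow (S p) (Suc n) s r)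
     = tn (\<lambda>p s r. mmul (T p) (\<lambda>s r. mpow (T p) n s r - mpow (S p) n s r) s r
        + mmul (\<lambda>s r. T p s r - S p s r) (mpow (S p) n) s r)"
    by (rule tn_cong) (rule mpow_diff_step[OF fin])
  also have "\<dots> \<le> mn T * tn (\<lambda>p s r. mpow (T p) n s r - mpow (S p) n s r)
      + tn (\<lambda>p s r. T p s r - S p s r) * mn (\<lambda>p. mpow (S p) n)"
    by (rule order_trans[OF tn_add]) (intro add_mono tn_mmul_left tn_mmul_right)
  also have "\<dots> \<le> c * (of_nat n * c ^ (n - 1) * d) + d * c ^ n"
    by (intro add_mono mult_mono Suc T d mn_mpow_le S) auto
  also have "\<dots> = of_nat (Suc n) * c ^ (Suc n - 1) * d"
    by (cases n) (auto simp: algebra_simps)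
  finally show ?case .
qed

text \<open>The index set is kept and the rows and columns of \<open>B\<close> are replaced by
  zeros, so that powers of the two matrices can be subtracted entrywise.\<close>

definition compress :: "'n::finite lattice set \<Rightarrow> 'n matrix \<Rightarrow> 'n matrix" where
  "compress B T s r = (if s \<in> B \<or> r \<in> B then 0 else T s r)"

lemma mn_compress: "mn (\<lambda>p. compress B (T p)) \<le> mn T"
proof (rule mn_mono)
  show "nbm (\<lambda>p. compress B (T p)) s r \<le> nbm T s r" for s r
    unfolding nbm_def compress_def by (cases "s \<in> B \<or> r \<in> B") auto
qed

text \<open>The difference is supported in \<open>card B\<close> rows and \<open>card B\<close>
  columns, each of which has sum at most \<open>mn T\<close>.\<close>

lemma tn_compress_diff:
  assumes "finite B"
  shows "tn (\<lambda>p s r. T p s r - compress B (T p) s r) \<le> of_nat (2 * card B) * mn T"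
proof -
  have *: "nbm (\<lambda>p s r. T p s r - compress B (T p) s r) s r
    \<le> indicator B s * nbm T s r + indicator B r * nbm T s r" for s r
    by (auto simp: nbm_def compress_def indicator_def)
  have "tn (\<lambda>p s r. T p s r - compress B (T p) s r)
     \<le> esum (\<lambda>s. esum (\<lambda>r. indicator B s * nbm T s r + indicator B r * nbm T s r))"
    unfolding tn_def by (intro esum_mono *)
  also have "\<dots> = esum (\<lambda>s. indicator B s * esum (\<lambda>r. nbm T s r))
        + esum (\<lambda>s. esum (\<lambda>r. indicator B r * nbm T s r))"
    by (simp add: esum_add esum_cmult)
  also have "esum (\<lambda>s. esum (\<lambda>r. indicator B r * nbm T s r)) = esum (\<lambda>r. indicator B r * esum (\<lambda>s. nbm T s r))"
    by (subst esum_swap) (simp add: esum_cmult)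
  also have "esum (\<lambda>s. indicator B s * esum (\<lambda>r. nbm T s r))
      + esum (\<lambda>r. indicator B r * esum (\<lambda>s. nbm T s r))
      \<le> esum (\<lambda>s. indicator B s * mn T) + esum (\<lambda>s. indicator B s * mn T)"
    by (intro add_mono esum_mono mult_left_mono row_le col_le) simp_all
  also have "esum (\<lambda>s. indicator B s * mn T) = of_nat (card B) * mn T"
    by (subst esum_multc, subst esum_finite_support[OF assms]) (auto simp: indicator_def)
  finally show ?thesis by (simp add: mult_2 distrib_right)
qed

text \<open>The last factor c comes from the bound on T minus its compression. The factor n is later
  cancelled by the 1/n in the eigenvalue series.\<close>

lemma tn_compress_mpow_diff:
  assumes "finite B" "mn T \<le> c" "c < top"
  shows "tn (\<lambda>p s r. mpow (T p) n s r - mpow (compress B (T p)) n s r) \<le> of_nat (2 * card B) * (of_nat n * c ^ n)"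
proof (cases n)
  case 0
  then show ?thesis by (simp add: tn_def nbm_def)
next
  case (Suc m)
  have "tn (\<lambda>p s r. mpow (T p) n s r - mpow (compress B (T p)) n s r) \<le> of_nat n * c ^ (n - 1) * (of_nat (2 * card B) * c)"
    using assms order_trans[OF mn_compress assms(2)]
    by (intro tn_mpow_diff order_trans[OF tn_compress_diff] mult_left_mono) auto
  then show ?thesis using Suc by (simp add: mult_ac)
qed

end

section \<open>Functions continuously differentiable in the quasimomentum\<close>

definition usup :: "'p set \<Rightarrow> ('p \<Rightarrow> 'b::real_normed_vector) \<Rightarrow> ennreal" where
  "usup D f = (SUP p\<in>D. ennreal (norm (f p)))"

lemma usup_leI: "(\<And>p. p \<in> D \<Longrightarrow> ennreal (norm (f p)) \<le> c) \<Longrightarrow> usup D f \<le> c"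
  unfolding usup_def by (rule SUP_least)

lemma le_usup: "p \<in> D \<Longrightarrow> ennreal (norm (f p)) \<le> usup D f"
  unfolding usup_def by (rule SUP_upper)

lemma usup_cong: "(\<And>p. p \<in> D \<Longrightarrow> f p = g p) \<Longrightarrow> usup D f = usup D g"
  unfolding usup_def by simp

lemma usup_add: "usup D (\<lambda>p. f p + g p) \<le> usup D f + usup D g"
proof (rule usup_leI)
  fix p assume p: "p \<in> D"
  have "ennreal (norm (f p + g p)) \<le> ennreal (norm (f p)) + ennreal (norm (g p))"
    by (simp add: ennreal_plus[symmetric] norm_triangle_ineq del: ennreal_plus)
  also have "\<dots> \<le> usup D f + usup D g" by (intro add_mono le_usup p)
  finally show "ennreal (norm (f p + g p)) \<le> usup D f + usup D g" .
qed

lemma usup_mult: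
  assumes "\<And>p. p \<in> D \<Longrightarrow> norm (h p) \<le> norm (f p) * norm (g p)"
  shows "usup D h \<le> usup D f * usup D g"
proof (rule usup_leI)
  fix p assume p: "p \<in> D"
  have "ennreal (norm (h p)) \<le> ennreal (norm (f p)) * ennreal (norm (g p))"
    using assms[OF p] by (simp add: ennreal_mult[symmetric])
  also have "\<dots> \<le> usup D f * usup D g" by (intro mult_mono le_usup p) auto
  finally show "ennreal (norm (h p)) \<le> usup D f * usup D g" .
qed

lemma usup_real:
  assumes "usup D f < top" "p \<in> D"
  shows "norm (f p) \<le> enn2real (usup D f)"
  using enn2real_mono[OF le_usup[OF assms(2), of f]] assms(1) by simp

text \<open>Weierstrass M-test with the sup norms themselves as majorants; it gives completeness for
  both instances of \<open>function_norm\<close>.\<close>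

lemma uniform_limit_usup_series:
  fixes f :: "nat \<Rightarrow> 'p \<Rightarrow> 'b::banach"
  assumes "(\<Sum>n. usup D (f n)) < top"
  shows "uniform_limit D (\<lambda>n x. \<Sum>i<n. f i x) (\<lambda>x. \<Sum>i. f i x) sequentially"
    and "p \<in> D \<Longrightarrow> summable (\<lambda>i. f i p)"
    and "usup D (\<lambda>p. \<Sum>i. f i p) \<le> (\<Sum>n. usup D (f n))"
proof -
  have fin: "usup D (f n) < top" for n
    using ennreal_suminf_lessD[OF assms, of n] .
  have eq: "ennreal (enn2real (usup D (f n))) = usup D (f n)" for n
    using fin[of n] by simp
  have sm: "summable (\<lambda>n. enn2real (usup D (f n)))"
  proof (rule summable_suminf_not_top)
    show "(\<Sum>n. ennreal (enn2real (usup D (f n)))) \<noteq> top" unfolding eq using assms by (rule less_imp_neq)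
  qed (rule enn2real_nonneg)
  show "uniform_limit D (\<lambda>n x. \<Sum>i<n. f i x) (\<lambda>x. \<Sum>i. f i x) sequentially"
    by (rule Weierstrass_m_test[OF usup_real[OF fin] sm])
  have sn: "summable (\<lambda>i. norm (f i p))" if "p \<in> D" for p
    by (rule summable_comparison_test'[OF sm, of 0]) (simp add: usup_real[OF fin that])
  show "summable (\<lambda>i. f i p)" if "p \<in> D" for p
    by (rule summable_norm_cancel[OF sn[OF that]])
  show "usup D (\<lambda>p. \<Sum>i. f i p) \<le> (\<Sum>n. usup D (f n))"
  proof (rule usup_leI)
    fix p assume p: "p \<in> D"
    have "norm (\<Sum>i. f i p) \<le> (\<Sum>i. norm (f i p))" by (rule summable_norm[OF sn[OF p]])
    also have "\<dots> \<le> (\<Sum>i. enn2real (usup D (f i)))"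
      by (rule suminf_le[OF usup_real[OF fin p] sn[OF p] sm])
    finally have "ennreal (norm (\<Sum>i. f i p)) \<le> ennreal (\<Sum>i. enn2real (usup D (f i)))"
      by (rule ennreal_leI)
    also have "\<dots> = (\<Sum>i. ennreal (enn2real (usup D (f i))))"
      by (rule suminf_ennreal2[symmetric, OF enn2real_nonneg sm])
    finally show "ennreal (norm (\<Sum>i. f i p)) \<le> (\<Sum>n. usup D (f n))" unfolding eq .
  qed
qed

section \<open>The algebra of functions that are C^1 in the quasimomentum\<close>

locale c1_norm =
  fixes U :: "(real ^ 'n::finite) set" and \<rho> :: real
  assumes open_U: "open U" and convex_U: "convex U" and rho_pos: "\<rho> > 0"
begin

definition D where "D = U \<times> {0..1::real}"

text \<open>Differentiation is in t alone, but continuity of the function and of its derivative is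
  joint in (t, \<theta>): integration over \<theta> under the derivative sign needs it.\<close>

definition has_t_derivative ::
  "((real ^ 'n) \<times> real \<Rightarrow> complex) \<Rightarrow> ((real ^ 'n) \<times> real \<Rightarrow> (real ^ 'n) \<Rightarrow>\<^sub>L complex) \<Rightarrow> bool" where
  "has_t_derivative f f' \<longleftrightarrow>
     (\<forall>t\<in>U. \<forall>\<theta>\<in>{0..1}. ((\<lambda>t. f (t, \<theta>)) has_derivative blinfun_apply (f' (t, \<theta>))) (at t)) \<and>
     continuous_on D f \<and> continuous_on D f'"

definition c1val :: "((real ^ 'n) \<times> real \<Rightarrow> complex) \<Rightarrow> ((real ^ 'n) \<times> real \<Rightarrow> (real ^ 'n) \<Rightarrow>\<^sub>L complex) \<Rightarrow> ennreal" where
  "c1val f f' = usup D f + ennreal \<rho> * usup D f'"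

text \<open>The derivative is unique on \<open>D\<close>, so the infimum runs over equal values. Its
  purpose is the empty case: a function that is not C^1 receives the infimum of the empty set, which
  is \<open>top\<close>.\<close>

definition nb :: "((real ^ 'n) \<times> real \<Rightarrow> complex) \<Rightarrow> ennreal" where
  "nb f = (INF f'\<in>Collect (has_t_derivative f). c1val f f')"

lemma t_derivative_unique:
  assumes "has_t_derivative f f'" "has_t_derivative f f''" "p \<in> D"
  shows "f' p = f'' p"
proof -
  obtain t \<theta> where "p = (t, \<theta>)" "t \<in> U" "\<theta> \<in> {0..1}" using assms(3) by (auto simp: D_def)
  with assms(1,2) have "blinfun_apply (f' p) = blinfun_apply (f'' p)"
    unfolding has_t_derivative_def by (metis has_derivative_unique)
  then show ?thesis by (simp add: blinfun_apply_inject)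
qed

lemma nb_le_c1val: "has_t_derivative f f' \<Longrightarrow> nb f \<le> c1val f f'"
  unfolding nb_def by (rule INF_lower) simp

lemma nb_eq_c1val:
  assumes "has_t_derivative f f'"
  shows "nb f = c1val f f'"
proof (rule antisym[OF nb_le_c1val[OF assms]])
  show "c1val f f' \<le> nb f"
    unfolding nb_def
  proof (rule INF_greatest, simp)
    fix f'' assume "has_t_derivative f f''"
    then have "usup D f'' = usup D f'" by (intro usup_cong t_derivative_unique[OF _ assms])
    then show "c1val f f' \<le> c1val f f''" by (simp add: c1val_def)
  qed
qed

lemma nb_finiteE:
  assumes "nb f < top"
  obtains f' where "has_t_derivative f f'" "nb f = c1val f f'"
proof -
  have "Collect (has_t_derivative f) \<noteq> {}"
  proof
    assume "Collect (has_t_derivative f) = {}"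
    then have "nb f = top" unfolding nb_def by (simp only: image_empty Inf_empty)
    with assms show False by simp
  qed
  then show ?thesis using that nb_eq_c1val by blast
qed

lemma nb_leI:
  assumes "has_t_derivative f f'" "\<And>p. p \<in> D \<Longrightarrow> norm (f p) \<le> a" "\<And>p. p \<in> D \<Longrightarrow> \<rho> * norm (f' p) \<le> b"
    and "0 \<le> a" "0 \<le> b"
  shows "nb f \<le> ennreal (a + b)"
proof -
  have "usup D f \<le> ennreal a" by (intro usup_leI ennreal_leI assms)
  moreover have "usup D f' \<le> ennreal (b / \<rho>)"
    using assms(3) rho_pos by (intro usup_leI ennreal_leI) (simp add: field_simps)
  then have "ennreal \<rho> * usup D f' \<le> ennreal \<rho> * ennreal (b / \<rho>)" by (rule mult_left_mono) simp
  then have "ennreal \<rho> * usup D f' \<le> ennreal b"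
    using rho_pos assms(5) by (simp add: ennreal_mult[symmetric])
  ultimately have "c1val f f' \<le> ennreal a + ennreal b" unfolding c1val_def by (rule add_mono)
  then show ?thesis
    using order_trans[OF nb_le_c1val[OF assms(1)]] assms(4,5) by simp
qed

lemma has_t_derivative_cong:
  assumes "\<And>p. p \<in> D \<Longrightarrow> f p = g p" "has_t_derivative f f'"
  shows "has_t_derivative g f'"
  unfolding has_t_derivative_def
proof (intro conjI ballI)
  show "continuous_on D g" "continuous_on D f'"
    using assms(2) continuous_on_eq[of D f g] assms(1) by (auto simp: has_t_derivative_def)
  fix t \<theta> assume t: "t \<in> U" "\<theta> \<in> {0..1::real}"
  show "((\<lambda>t. g (t, \<theta>)) has_derivative blinfun_apply (f' (t, \<theta>))) (at t)"
    by (rule has_derivative_transform_within_open[OF _ open_U t(1), of "\<lambda>t. f (t, \<theta>)"])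
       (use assms t in \<open>auto simp: has_t_derivative_def D_def\<close>)
qed

lemma nb_cong_aux: "(\<And>p. p \<in> D \<Longrightarrow> f p = g p) \<Longrightarrow> nb f \<le> nb g"
proof (cases "nb g < top")
  case True
  assume eq: "\<And>p. p \<in> D \<Longrightarrow> f p = g p"
  from True obtain g' where g': "has_t_derivative g g'" "nb g = c1val g g'" by (rule nb_finiteE)
  have "nb f \<le> c1val f g'"
    by (rule nb_le_c1val) (rule has_t_derivative_cong[OF _ g'(1)], simp add: eq)
  also have "\<dots> = nb g" unfolding g' c1val_def by (simp add: usup_cong[of D f g, OF eq])
  finally show ?thesis .
qed (simp add: not_less top_unique)

lemma nb_triv: "(nb f < top \<Longrightarrow> nb g < top \<Longrightarrow> nb h \<le> nb f + nb g) \<Longrightarrow> nb h \<le> nb f + nb g"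
  by (cases "nb f < top"; cases "nb g < top") (auto simp: not_less top_unique)

lemma has_t_derivative_add:
  assumes "has_t_derivative f f'" "has_t_derivative g g'"
  shows "has_t_derivative (\<lambda>p. f p + g p) (\<lambda>p. f' p + g' p)"
  using assms unfolding has_t_derivative_def
  by (auto simp: blinfun.add_left[abs_def] intro!: has_derivative_add continuous_intros)

definition dmult ::
  "complex \<Rightarrow> complex \<Rightarrow> (real ^ 'n) \<Rightarrow>\<^sub>L complex \<Rightarrow> (real ^ 'n) \<Rightarrow>\<^sub>L complex \<Rightarrow> (real ^ 'n) \<Rightarrow>\<^sub>L complex" where
  "dmult a b a' b' = (blinfun_mult_right a o\<^sub>L b') + (blinfun_mult_right b o\<^sub>L a')"

lemma norm_mult_right_compose: "norm (blinfun_mult_right (a::complex) o\<^sub>L b') \<le> norm a * norm b'"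
proof -
  have "norm (blinfun_mult_right a) \<le> norm a"
    by (rule norm_blinfun_bound) (auto simp: norm_mult)
  then show ?thesis
    using norm_blinfun_compose[of "blinfun_mult_right a" b'] by (meson mult_right_mono norm_ge_zero order_trans)
qed

lemma has_t_derivative_mult:
  assumes "has_t_derivative f f'" "has_t_derivative g g'"
  shows "has_t_derivative (\<lambda>p. f p * g p) (\<lambda>p. dmult (f p) (g p) (f' p) (g' p))"
  using assms unfolding has_t_derivative_def dmult_def
  by (auto simp: blinfun.bilinear_simps[abs_def] mult.commute intro!: derivative_eq_intros continuous_intros)

lemma nb_mult_aux: "nb (\<lambda>p. f p * g p) \<le> nb f * nb g" if "nb f < top" "nb g < top"
proof -
  from that obtain f' g' where f: "has_t_derivative f f'" "nb f = c1val f f'"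
    and g: "has_t_derivative g g'" "nb g = c1val g g'"
    by (meson nb_finiteE)
  have "nb (\<lambda>p. f p * g p) \<le> c1val (\<lambda>p. f p * g p) (\<lambda>p. dmult (f p) (g p) (f' p) (g' p))"
    by (rule nb_le_c1val[OF has_t_derivative_mult[OF f(1) g(1)]])
  also have "\<dots> \<le> usup D f * usup D g + ennreal \<rho> * (usup D f * usup D g' + usup D g * usup D f')"
    unfolding c1val_def dmult_def
    by (intro add_mono mult_left_mono order_trans[OF usup_add] usup_mult norm_mult_right_compose)
       (auto simp: norm_mult)
  also have "\<dots> \<le> c1val f f' * c1val g g'"
    unfolding c1val_def by (simp add: algebra_simps)
  finally show ?thesis using f(2) g(2) by simp
qed

lemma has_t_derivative_const: "has_t_derivative (\<lambda>_. c) (\<lambda>_. 0)"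
  unfolding has_t_derivative_def by (auto simp: zero_blinfun.rep_eq)

text \<open>Uniform convergence of the derivatives permits termwise differentiation on the convex
  set U, for each fixed \<theta>. Openness then turns derivatives within U into derivatives at a
  point.\<close>

lemma has_t_derivative_suminf:
  assumes d: "\<And>n. has_t_derivative (h n) (h' n)"
    and s: "(\<Sum>n. usup D (h n)) < top" "(\<Sum>n. usup D (h' n)) < top"
  shows "has_t_derivative (\<lambda>p. \<Sum>n. h n p) (\<lambda>p. \<Sum>n. h' n p)"
  unfolding has_t_derivative_def
proof (intro conjI ballI)
  show "continuous_on D (\<lambda>p. \<Sum>n. h n p)"
    by (rule uniform_limit_theorem[OF _ uniform_limit_usup_series(1)[OF s(1)]])
       (use d in \<open>auto simp: has_t_derivative_def intro!: always_eventually continuous_on_sum\<close>)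
  show "continuous_on D (\<lambda>p. \<Sum>n. h' n p)"
    by (rule uniform_limit_theorem[OF _ uniform_limit_usup_series(1)[OF s(2)]])
       (use d in \<open>auto simp: has_t_derivative_def intro!: always_eventually continuous_on_sum\<close>)
  fix t \<theta> assume t: "t \<in> U" and th: "\<theta> \<in> {0..1::real}"
  have pD: "(x, \<theta>) \<in> D" if "x \<in> U" for x using that th by (auto simp: D_def)
  have "\<exists>g. \<forall>x\<in>U. (\<lambda>n. h n (x, \<theta>)) sums (g x) \<and>
      (g has_derivative blinfun_apply (\<Sum>n. h' n (x, \<theta>))) (at x within U)"
  proof (rule has_derivative_series[OF convex_U _ _ t])
    show "((\<lambda>x. h n (x, \<theta>)) has_derivative blinfun_apply (h' n (x, \<theta>))) (at x within U)" if "x \<in> U" for n x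
      using d[of n] that th has_derivative_at_withinI unfolding has_t_derivative_def by blast
    show "(\<lambda>n. h n (t, \<theta>)) sums (\<Sum>n. h n (t, \<theta>))"
      by (rule summable_sums[OF uniform_limit_usup_series(2)[OF s(1) pD[OF t]]])
    fix e :: real assume "e > 0"
    from uniform_limitD[OF uniform_limit_usup_series(1)[OF s(2)] this]
    show "\<forall>\<^sub>F n in sequentially. \<forall>x\<in>U. \<forall>v. norm ((\<Sum>i<n. blinfun_apply (h' i (x, \<theta>)) v) - blinfun_apply (\<Sum>n. h' n (x, \<theta>)) v) \<le> e * norm v"
    proof (eventually_elim, intro ballI allI)
      fix n x v assume *: "\<forall>p\<in>D. dist (\<Sum>i<n. h' i p) (\<Sum>i. h' i p) < e" and x: "x \<in> U"
      have "norm ((\<Sum>i<n. h' i (x, \<theta>)) - (\<Sum>i. h' i (x, \<theta>))) \<le> e"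
        using * pD[OF x] by (auto simp: dist_norm intro: less_imp_le)
      then have "norm (blinfun_apply ((\<Sum>i<n. h' i (x, \<theta>)) - (\<Sum>i. h' i (x, \<theta>))) v) \<le> e * norm v"
        by (intro order_trans[OF norm_blinfun] mult_right_mono) auto
      then show "norm ((\<Sum>i<n. blinfun_apply (h' i (x, \<theta>)) v) - blinfun_apply (\<Sum>n. h' n (x, \<theta>)) v) \<le> e * norm v"
        by (simp add: blinfun.bilinear_simps blinfun.sum_left)
    qed
  qed
  then obtain g where g: "\<And>x. x \<in> U \<Longrightarrow> (\<lambda>n. h n (x, \<theta>)) sums (g x)"
    "\<And>x. x \<in> U \<Longrightarrow> (g has_derivative blinfun_apply (\<Sum>n. h' n (x, \<theta>))) (at x within U)" by blast
  have "(g has_derivative blinfun_apply (\<Sum>n. h' n (t, \<theta>))) (at t)"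
    using g(2)[OF t] at_within_open[OF t open_U] by simp
  then show "((\<lambda>t. \<Sum>n. h n (t, \<theta>)) has_derivative blinfun_apply (\<Sum>n. h' n (t, \<theta>))) (at t)"
    by (rule has_derivative_transform_within_open[OF _ open_U t]) (use g(1) sums_unique in blast)
qed

sublocale function_norm D nb
proof
  fix f g :: "(real ^ 'n) \<times> real \<Rightarrow> complex" and c :: complex
    and h :: "nat \<Rightarrow> (real ^ 'n) \<times> real \<Rightarrow> complex"
  show "nb f = nb g" if "\<And>p. p \<in> D \<Longrightarrow> f p = g p"
    by (rule antisym; rule nb_cong_aux) (use that in auto)
  have "nb (\<lambda>_. c) \<le> ennreal (norm c + 0)"
    by (rule nb_leI[OF has_t_derivative_const]) auto
  then show "nb (\<lambda>_. c) \<le> ennreal (norm c)" by simp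
  show "ennreal (norm (f p)) \<le> nb f" if "p \<in> D" for p
  proof (cases "nb f < top")
    case True
    then obtain f' where "nb f = c1val f f'" by (rule nb_finiteE)
    then show ?thesis using le_usup[OF that, of f] unfolding c1val_def
      by (simp add: add_increasing2)
  qed (simp add: not_less top_unique)
  show "nb (\<lambda>p. f p + g p) \<le> nb f + nb g"
  proof (rule nb_triv)
    assume "nb f < top" "nb g < top"
    then obtain f' g' where f: "has_t_derivative f f'" "nb f = c1val f f'"
      and g: "has_t_derivative g g'" "nb g = c1val g g'"
      by (meson nb_finiteE)
    have "nb (\<lambda>p. f p + g p) \<le> c1val (\<lambda>p. f p + g p) (\<lambda>p. f' p + g' p)"
      by (rule nb_le_c1val[OF has_t_derivative_add[OF f(1) g(1)]])
    also have "\<dots> \<le> (usup D f + usup D g) + ennreal \<rho> * (usup D f' + usup D g')"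
      unfolding c1val_def by (intro add_mono mult_left_mono usup_add) auto
    also have "\<dots> = c1val f f' + c1val g g'" by (simp add: c1val_def algebra_simps)
    finally show "nb (\<lambda>p. f p + g p) \<le> nb f + nb g" using f(2) g(2) by simp
  qed
  show "nb (\<lambda>p. \<Sum>n. h n p) \<le> (\<Sum>n. nb (h n))" if s: "(\<Sum>n. nb (h n)) < top"
  proof -
    have "nb (h n) < top" for n using s by (rule ennreal_suminf_lessD)
    then have "\<exists>f'. has_t_derivative (h n) f' \<and> nb (h n) = c1val (h n) f'" for n
      by (meson nb_finiteE)
    then obtain h' where h': "\<And>n. has_t_derivative (h n) (h' n)" "\<And>n. nb (h n) = c1val (h n) (h' n)"
      by metis
    have sum_eq: "(\<Sum>n. nb (h n)) = (\<Sum>n. usup D (h n)) + ennreal \<rho> * (\<Sum>n. usup D (h' n))"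
      unfolding h'(2) c1val_def by (simp add: suminf_add[symmetric])
    have fin: "(\<Sum>n. usup D (h n)) < top" "(\<Sum>n. usup D (h' n)) < top"
      using s rho_pos unfolding sum_eq by (auto simp: ennreal_mult_less_top)
    have "nb (\<lambda>p. \<Sum>n. h n p) \<le> c1val (\<lambda>p. \<Sum>n. h n p) (\<lambda>p. \<Sum>n. h' n p)"
      by (rule nb_le_c1val[OF has_t_derivative_suminf[OF h'(1) fin]])
    also have "\<dots> \<le> (\<Sum>n. nb (h n))"
      unfolding sum_eq c1val_def
      by (intro add_mono mult_left_mono uniform_limit_usup_series(3) fin) auto
    finally show ?thesis .
  qed
  show "nb (\<lambda>p. f p * g p) \<le> nb f * nb g"
  proof (cases "nb f < top \<and> nb g < top")
    case True
    then show ?thesis using nb_mult_aux by blast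
  next
    case False
    \<comment> \<open>In \<open>ennreal\<close> the product of 0 and \<open>top\<close> is 0, so a
      factor of norm 0 cannot be dismissed with the infinite case. Such a factor vanishes on
      \<open>D\<close>, and so does the product.\<close>
    have zero: "nb (\<lambda>p. f p * g p) \<le> 0" if "nb f = 0 \<or> nb g = 0"
    proof -
      have "f p * g p = 0" if p: "p \<in> D" for p
      proof -
        have *: "ennreal (norm (u p)) \<le> nb u" for u
        proof (cases "nb u < top")
          case True
          then obtain u' where "nb u = c1val u u'" by (rule nb_finiteE)
          then show ?thesis using le_usup[OF p, of u] unfolding c1val_def
            by (simp add: add_increasing2)
        qed (simp add: not_less top_unique)
        show ?thesis using \<open>nb f = 0 \<or> nb g = 0\<close>
        proof
          assume "nb f = 0"
          with *[of f] have "ennreal (norm (f p)) \<le> 0" by simp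
          then show ?thesis by simp
        next
          assume "nb g = 0"
          with *[of g] have "ennreal (norm (g p)) \<le> 0" by simp
          then show ?thesis by simp
        qed
      qed
      then have "nb (\<lambda>p. f p * g p) \<le> nb (\<lambda>_. 0)" by (rule nb_cong_aux)
      also have "\<dots> \<le> ennreal (0 + 0)"
        by (rule nb_leI[OF has_t_derivative_const]) auto
      finally show ?thesis by simp
    qed
    show ?thesis
      using False zero by (cases "nb f = 0 \<or> nb g = 0") (auto simp: not_less top_unique ennreal_mult_eq_top_iff)
  qed
qed

text \<open>Conjugation is a real-linear contraction, hence compatible with real derivatives. This
  is what admits |u|^2 into the algebra.\<close>

lemma nb_cnj: "nb (\<lambda>p. cnj (f p)) \<le> nb f"
proof (cases "nb f < top")
  case True
  then obtain f' where f: "has_t_derivative f f'" "nb f = c1val f f'" by (rule nb_finiteE)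
  define C where "C = Blinfun cnj"
  have C: "blinfun_apply C = cnj" unfolding C_def by (rule bounded_linear_Blinfun_apply[OF bounded_linear_cnj])
  have nC: "norm C \<le> 1" by (rule norm_blinfun_bound) (auto simp: C)
  have nCf: "norm (C o\<^sub>L f' p) \<le> norm (f' p)" for p
    using norm_blinfun_compose[of C "f' p"] nC by (meson mult_left_le_one_le norm_ge_zero order_trans)
  have "has_t_derivative (\<lambda>p. cnj (f p)) (\<lambda>p. C o\<^sub>L f' p)"
    using f(1) unfolding has_t_derivative_def
    by (auto simp: C blinfun_compose.rep_eq o_def intro!: has_derivative_cnj continuous_intros)
  then have "nb (\<lambda>p. cnj (f p)) \<le> c1val (\<lambda>p. cnj (f p)) (\<lambda>p. C o\<^sub>L f' p)" by (rule nb_le_c1val)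
  also have "\<dots> \<le> c1val f f'" unfolding c1val_def
    by (intro add_mono mult_left_mono usup_leI order_trans[OF ennreal_leI[OF nCf]])
       (auto intro: le_usup)
  finally show ?thesis using f by simp
qed (simp add: not_less top_unique)

text \<open>Differentiation under the integral sign; the parameter interval has length 1, so sup
  norms do not grow. The average is again regarded as a function on \<open>D\<close>, constant in
  \<theta>.\<close>

lemma nb_integral: "nb (\<lambda>p. integral {0..1} (\<lambda>\<theta>. f (fst p, \<theta>))) \<le> nb f"
proof (cases "nb f < top")
  case True
  then obtain f' where f: "has_t_derivative f f'" "nb f = c1val f f'" by (rule nb_finiteE)
  have cf: "continuous_on (U \<times> cbox 0 1) f" and cf': "continuous_on (U \<times> cbox 0 1) f'"
    using f(1) by (auto simp: has_t_derivative_def D_def)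
  have c1: "continuous_on {0..1} (\<lambda>\<theta>. f (t, \<theta>))" "continuous_on {0..1} (\<lambda>\<theta>. f' (t, \<theta>))" if "t \<in> U" for t
    using that by (auto intro!: continuous_on_compose2[OF cf] continuous_on_compose2[OF cf'] continuous_intros)
  define F where "F p = integral {0..1} (\<lambda>\<theta>. f (fst p, \<theta>))" for p :: "(real ^ 'n) \<times> real"
  define F' where "F' p = integral {0..1} (\<lambda>\<theta>. f' (fst p, \<theta>))" for p :: "(real ^ 'n) \<times> real"
  have hd: "has_t_derivative F F'"
    unfolding has_t_derivative_def
  proof (intro conjI ballI)
    have "continuous_on U (\<lambda>t. integral (cbox 0 1) (\<lambda>\<theta>. f (t, \<theta>)))"
      "continuous_on U (\<lambda>t. integral (cbox 0 1) (\<lambda>\<theta>. f' (t, \<theta>)))"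
      by (rule integral_continuous_on_param; use cf cf' in \<open>simp add: split_beta\<close>)+
    note c = this[unfolded cbox_interval]
    have "continuous_on D fst" "fst ` D \<subseteq> U" by (auto simp: D_def intro!: continuous_intros)
    from continuous_on_compose2[OF c(1) this] continuous_on_compose2[OF c(2) this]
    show "continuous_on D F" "continuous_on D F'" unfolding F_def F'_def by simp_all
    fix t \<theta> assume t: "t \<in> U" "\<theta> \<in> {0..1::real}"
    have "((\<lambda>t. integral (cbox 0 1) (\<lambda>\<theta>. f (t, \<theta>))) has_derivative
         blinfun_apply (integral (cbox 0 1) (\<lambda>\<theta>. f' (t, \<theta>)))) (at t within U)"
    proof (rule leibniz_rule[OF _ _ _ t(1) convex_U])
      show "((\<lambda>t. f (t, \<theta>)) has_derivative blinfun_apply (f' (t, \<theta>))) (at t within U)"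
        if "t \<in> U" "\<theta> \<in> cbox 0 1" for t \<theta>
        by (rule has_derivative_at_withinI) (use f(1) that in \<open>auto simp: has_t_derivative_def\<close>)
      show "(\<lambda>\<theta>. f (t, \<theta>)) integrable_on cbox 0 1" if "t \<in> U" for t
        using c1(1)[OF that] by (simp add: integrable_continuous_real)
    qed (use cf' in \<open>simp add: split_beta\<close>)
    then show "((\<lambda>t. F (t, \<theta>)) has_derivative blinfun_apply (F' (t, \<theta>))) (at t)"
      using at_within_open[OF t(1) open_U] by (simp add: F_def F'_def cbox_interval)
  qed
  have bd: "ennreal (norm (integral {0..1} (\<lambda>\<theta>. g (fst p, \<theta>)))) \<le> usup D g"
    if "p \<in> D" "\<And>t. t \<in> U \<Longrightarrow> continuous_on {0..1} (\<lambda>\<theta>. g (t, \<theta>))"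
    for p and g :: "(real ^ 'n) \<times> real \<Rightarrow> 'b::euclidean_space"
  proof (cases "usup D g < top")
    case True
    have "norm (integral {0..1} (\<lambda>\<theta>. g (fst p, \<theta>))) \<le> enn2real (usup D g) * (1 - 0)"
      using that(1) by (intro integral_bound that(2) usup_real[OF True]) (auto simp: D_def)
    then have "ennreal (norm (integral {0..1} (\<lambda>\<theta>. g (fst p, \<theta>)))) \<le> ennreal (enn2real (usup D g))"
      by (intro ennreal_leI) simp
    then show ?thesis using True by simp
  qed (simp add: not_less top_unique)
  have bd': "ennreal (norm (integral {0..1} (\<lambda>\<theta>. f' (fst p, \<theta>)))) \<le> usup D f'" if "p \<in> D" for p
  proof (cases "usup D f' < top")
    case True
    have "norm (integral {0..1} (\<lambda>\<theta>. f' (fst p, \<theta>))) \<le> enn2real (usup D f') * (1 - 0)"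
      using that by (intro integral_bound c1(2) usup_real[OF True]) (auto simp: D_def)
    then have "ennreal (norm (integral {0..1} (\<lambda>\<theta>. f' (fst p, \<theta>)))) \<le> ennreal (enn2real (usup D f'))"
      by (intro ennreal_leI) simp
    then show ?thesis using True by simp
  qed (simp add: not_less top_unique)
  have "nb F \<le> c1val F F'" by (rule nb_le_c1val[OF hd])
  also have "\<dots> \<le> c1val f f'"
    unfolding c1val_def
  proof (intro add_mono mult_left_mono)
    show "usup D F \<le> usup D f" unfolding F_def by (rule usup_leI) (rule bd, auto intro: c1)
    show "usup D F' \<le> usup D f'" unfolding F'_def by (rule usup_leI) (rule bd')
  qed auto
  finally show ?thesis using f(2) unfolding F_def by simp
qed (simp add: not_less top_unique)

lemma nb_derivative:
  assumes "nb f < top" "t \<in> U" "\<theta> \<in> {0..1}"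
  obtains f' where "((\<lambda>t. f (t, \<theta>)) has_derivative blinfun_apply f') (at t)"
    "ennreal (\<rho> * norm f') \<le> nb f"
proof -
  obtain f' where f: "has_t_derivative f f'" "nb f = c1val f f'" using assms(1) by (rule nb_finiteE)
  have "ennreal (\<rho> * norm (f' (t, \<theta>))) \<le> ennreal \<rho> * usup D f'"
    using rho_pos assms(2,3) by (simp add: ennreal_mult D_def le_usup mult_left_mono)
  also have "\<dots> \<le> nb f" unfolding f(2) c1val_def by (simp add: add_increasing)
  finally show ?thesis using that f(1) assms(2,3) unfolding has_t_derivative_def by blast
qed

lemma nb_continuous:
  assumes "nb f < top"
  shows "continuous_on D f"
  using assms by (rule nb_finiteE) (auto simp: has_t_derivative_def)

end

section \<open>Second instance: bounded holomorphic functions\<close>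

definition hol_nb :: "complex set \<Rightarrow> (complex \<Rightarrow> complex) \<Rightarrow> ennreal" where
  "hol_nb S f = (if f holomorphic_on S then usup S f else top)"

text \<open>Completeness is Weierstrass' theorem on locally uniform limits of holomorphic functions.
  The instance makes the entries of powers of an infinite holomorphic matrix holomorphic without a
  separate treatment of the infinite sums inside them.\<close>

lemma function_norm_hol_nb:
  assumes "open S"
  shows "function_norm S (hol_nb S)"
proof
  fix f g :: "complex \<Rightarrow> complex" and c :: complex and h :: "nat \<Rightarrow> complex \<Rightarrow> complex"
  show "hol_nb S f = hol_nb S g" if "\<And>p. p \<in> S \<Longrightarrow> f p = g p"
    using that holomorphic_cong[OF refl that] usup_cong[of S f g] by (simp add: hol_nb_def)
  show "hol_nb S (\<lambda>_. c) \<le> ennreal (norm c)"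
    by (auto simp: hol_nb_def intro: usup_leI)
  show "ennreal (norm (f p)) \<le> hol_nb S f" if "p \<in> S" for p
    using le_usup[OF that, of f] by (simp add: hol_nb_def)
  show "hol_nb S (\<lambda>p. f p + g p) \<le> hol_nb S f + hol_nb S g"
    by (auto simp: hol_nb_def usup_add holomorphic_on_add)
  show "hol_nb S (\<lambda>p. f p * g p) \<le> hol_nb S f * hol_nb S g"
  proof (cases "f holomorphic_on S \<and> g holomorphic_on S")
    case True
    then show ?thesis by (auto simp: hol_nb_def holomorphic_on_mult norm_mult intro: usup_mult)
  next
    case False
    have "hol_nb S (\<lambda>p. f p * g p) \<le> 0" if "hol_nb S f = 0 \<or> hol_nb S g = 0"
    proof -
      have "f p * g p = 0" if "p \<in> S" for p
        using le_usup[OF that, of f] le_usup[OF that, of g] \<open>hol_nb S f = 0 \<or> hol_nb S g = 0\<close>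
        by (auto simp: hol_nb_def split: if_splits)
      then have "(\<lambda>p. f p * g p) holomorphic_on S \<and> usup S (\<lambda>p. f p * g p) = usup S (\<lambda>_. 0 :: complex)"
        using holomorphic_cong[of S S "\<lambda>p. f p * g p" "\<lambda>_. 0"] usup_cong[of S "\<lambda>p. f p * g p" "\<lambda>_. 0"] by auto
      moreover have "usup S (\<lambda>_. 0 :: complex) \<le> 0" by (rule usup_leI) simp
      ultimately show ?thesis by (simp add: hol_nb_def)
    qed
    then show ?thesis
      using False
      by (cases "hol_nb S f = 0 \<or> hol_nb S g = 0") (auto simp: hol_nb_def ennreal_mult_eq_top_iff)
  qed
  show "hol_nb S (\<lambda>p. \<Sum>n. h n p) \<le> (\<Sum>n. hol_nb S (h n))" if s: "(\<Sum>n. hol_nb S (h n)) < top"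
  proof -
    have "hol_nb S (h n) < top" for n using s by (rule ennreal_suminf_lessD)
    then have hol: "h n holomorphic_on S" for n by (metis hol_nb_def less_irrefl)
    then have eq: "(\<Sum>n. hol_nb S (h n)) = (\<Sum>n. usup S (h n))" by (simp add: hol_nb_def)
    note ul = uniform_limit_usup_series[OF s[unfolded eq]]
    have "(\<lambda>p. \<Sum>n. h n p) holomorphic_on S"
    proof (rule holomorphic_uniform_sequence[OF assms, of "\<lambda>n x. \<Sum>i<n. h i x"])
      show "(\<lambda>x. \<Sum>i<n. h i x) holomorphic_on S" for n
        by (intro holomorphic_on_sum hol)
      fix x assume "x \<in> S"
      then obtain d where d: "d > 0" "cball x d \<subseteq> S"
        using assms open_contains_cball by blast
      then show "\<exists>d>0. cball x d \<subseteq> S \<and>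
          uniform_limit (cball x d) (\<lambda>n x. \<Sum>i<n. h i x) (\<lambda>p. \<Sum>n. h n p) sequentially"
        using uniform_limit_on_subset[OF ul(1) d(2)] by blast
    qed
    then show ?thesis using ul(3) eq by (simp add: hol_nb_def)
  qed
qed

section \<open>Fourier series of absolutely summable coefficients\<close>

text \<open>Fubini for products of functions of one coordinate each; it reduces orthogonality of
  plane waves on the cell to dimension one.\<close>

lemma lborel_integral_prod:
  fixes f :: "'a::euclidean_space \<Rightarrow> real \<Rightarrow> complex"
  assumes f: "\<And>b. b \<in> Basis \<Longrightarrow> integrable lborel (f b)"
  shows "(LINT x|lborel. (\<Prod>b\<in>Basis. f b (x \<bullet> b))) = (\<Prod>b\<in>(Basis::'a set). LINT y|lborel. f b y)"
proof -
  interpret product_sigma_finite "\<lambda>_::'a. lborel :: real measure" by standard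
  have [measurable]: "f b \<in> borel_measurable borel" if "b \<in> Basis" for b
    using f[OF that] by (auto dest: borel_measurable_integrable)
  have "(LINT x|(lborel::'a measure). (\<Prod>b\<in>Basis. f b (x \<bullet> b)))
      = (LINT y|(\<Pi>\<^sub>M b\<in>(Basis::'a set). lborel). (\<Prod>b\<in>Basis. f b ((\<Sum>c\<in>Basis. y c *\<^sub>R c) \<bullet> b)))"
    by (subst lborel_eq, subst integral_distr) auto
  also have "\<dots> = (LINT y|(\<Pi>\<^sub>M b\<in>(Basis::'a set). lborel). (\<Prod>b\<in>Basis. f b (y b)))"
    by (intro Bochner_Integration.integral_cong refl prod.cong) simp
  also have "\<dots> = (\<Prod>b\<in>Basis. LINT y|lborel. f b y)"
    by (rule product_integral_prod) (auto intro: f)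
  finally show ?thesis .
qed

lemma integral_cis_period:
  fixes k :: int
  shows "(LINT y|lborel. indicator {0..2 * pi} y *\<^sub>R cis (of_int k * y)) = (if k = 0 then 2 * pi else 0)"
proof -
  have "(LINT y|lborel. indicator {0..2 * pi} y *\<^sub>R cis (of_int k * y))
      = integral {0..2 * pi} (\<lambda>y. cis (of_int k * y))"
    by (fold set_lebesgue_integral_def, rule set_borel_integral_eq_integral(2), rule borel_integrable_atLeastAtMost')
       (intro continuous_intros)
  also have "\<dots> = (if k = 0 then 2 * pi else 0)"
  proof (cases "k = 0")
    case False
    define F where "F y = exp (\<i> * of_int k * of_real y) / (\<i> * of_int k)" for y :: real
    have "((\<lambda>y. cis (of_int k * y)) has_integral (F (2 * pi) - F 0)) {0..2 * pi}"
    proof (rule fundamental_theorem_of_calculus)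
      fix x :: real
      show "(F has_vector_derivative cis (of_int k * x)) (at x within {0..2 * pi})"
        unfolding F_def
        by (rule has_vector_derivative_real_field)
           (use False in \<open>auto intro!: derivative_eq_intros simp: cis_conv_exp field_simps\<close>)
    qed simp
    moreover have "F (2 * pi) = F 0"
    proof -
      have "exp (\<i> * of_int k * of_real (2 * pi)) = 1"
        using exp_integer_2pi[of "of_int k"] by (simp add: mult_ac)
      then show ?thesis by (simp add: F_def)
    qed
    ultimately show ?thesis using False by (simp add: integral_unique)
  qed (simp add: scaleR_conv_of_real)
  finally show ?thesis .
qed

lemma continuous_plane_wave [continuous_intros]: "continuous_on S (plane_wave \<xi>)"
  unfolding plane_wave_def by (intro continuous_intros)

lemma plane_wave_add: "plane_wave (\<xi> + \<eta>) x = plane_wave \<xi> x * plane_wave \<eta> x"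
  by (simp add: plane_wave_def cis_mult inner_add_left)

lemma norm_plane_wave [simp]: "norm (plane_wave \<xi> x) = 1"
  by (simp add: plane_wave_def)

lemma cnj_plane_wave: "cnj (plane_wave \<xi> x) = plane_wave (- \<xi>) x"
  by (simp add: plane_wave_def cis_cnj)

lemma lat_add: "lat (m + m') = lat m + lat m'" and lat_minus: "lat (- m) = - lat m"
  and lat_diff: "lat (m - m') = lat m - lat m'" and lat_0: "lat 0 = 0"
  by (simp_all add: lat_def vec_eq_iff)

lemma integral_plane_wave:
  fixes m :: "'n::finite lattice"
  shows "integral Qcell (plane_wave (lat m)) = (if m = 0 then of_real ((2 * pi) ^ CARD('n)) else 0)"
proof -
  define f where "f b y = indicator {0..2 * pi} y *\<^sub>R cis ((lat m \<bullet> b) * y)" for b :: "real ^ 'n" and y :: real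
  have fi: "integrable lborel (f b)" for b
    unfolding f_def set_integrable_def[symmetric]
    by (rule borel_integrable_atLeastAtMost') (intro continuous_intros)
  have cispr: "cis (\<Sum>b\<in>A. g b) = (\<Prod>b\<in>A. cis (g b))" if "finite A" for A :: "(real ^ 'n) set" and g
    using that by induction (simp_all add: cis_mult[symmetric])
  have eq: "indicator Qcell x *\<^sub>R plane_wave (lat m) x = (\<Prod>b\<in>Basis. f b (x \<bullet> b))" for x
  proof (cases "x \<in> Qcell")
    case True
    then have "x \<bullet> b \<in> {0..2 * pi}" if "b \<in> Basis" for b
      using that by (auto simp: Qcell_def mem_box Basis_vec_def inner_axis)
    then have "(\<Prod>b\<in>Basis. f b (x \<bullet> b)) = (\<Prod>b\<in>Basis. cis ((lat m \<bullet> b) * (x \<bullet> b)))"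
      by (intro prod.cong) (auto simp: f_def)
    also have "\<dots> = plane_wave (lat m) x"
      unfolding plane_wave_def by (subst euclidean_inner) (simp add: cispr)
    finally show ?thesis using True by simp
  next
    case False
    then obtain i where "x $ i \<notin> {0..2 * pi}" by (auto simp: Qcell_def mem_box_cart)
    then have b: "(axis i 1 :: real ^ 'n) \<in> Basis" "x \<bullet> axis i 1 \<notin> {0..2 * pi}"
      by (simp_all add: axis_in_Basis_iff inner_axis)
    define b where "b = (axis i 1 :: real ^ 'n)"
    note b = b[folded b_def]
    then have "f b (x \<bullet> b) = 0" by (simp add: f_def)
    then have "(\<Prod>b\<in>Basis. f b (x \<bullet> b)) = 0" using b(1) by (intro prod_zero bexI[of _ b]) simp_all
    then show ?thesis using False by simp
  qed
  have latb: "\<exists>k. lat m \<bullet> b = of_int k" if "b \<in> Basis" for b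
    using that by (auto simp: Basis_vec_def lat_def inner_axis)
  have "integral Qcell (plane_wave (lat m)) = (LINT x|lborel. indicator Qcell x *\<^sub>R plane_wave (lat m) x)"
    unfolding Qcell_def set_lebesgue_integral_def[symmetric]
    by (rule set_borel_integral_eq_integral(2)[symmetric])
       (unfold set_integrable_def, rule borel_integrable_compact, auto intro: continuous_plane_wave)
  also have "\<dots> = (\<Prod>b\<in>Basis. LINT y|lborel. f b y)"
    unfolding eq by (rule lborel_integral_prod) (rule fi)
  also have "\<dots> = (\<Prod>b\<in>(Basis :: (real ^ 'n) set). if lat m \<bullet> b = 0 then of_real (2 * pi) else 0)"
  proof (rule prod.cong[OF refl])
    fix b :: "real ^ 'n" assume "b \<in> Basis"
    then obtain k where k: "lat m \<bullet> b = of_int k" using latb by blast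
    show "(LINT y|lborel. f b y) = (if lat m \<bullet> b = 0 then of_real (2 * pi) else 0)"
      unfolding f_def k integral_cis_period by simp
  qed
  also have "\<dots> = (if m = 0 then of_real ((2 * pi) ^ CARD('n)) else 0)"
  proof (cases "m = 0")
    case False
    then have "lat m \<noteq> 0" by (auto simp: lat_def vec_eq_iff)
    then obtain b where "b \<in> Basis" "lat m \<bullet> b \<noteq> 0" using euclidean_all_zero_iff by blast
    then have "(\<Prod>b\<in>(Basis :: (real ^ 'n) set). if lat m \<bullet> b = 0 then complex_of_real (2 * pi) else 0) = 0"
      by (intro prod_zero) auto
    then show ?thesis using False by simp
  qed (simp add: lat_0)
  finally show ?thesis .
qed

section \<open>Trigonometric series with absolutely summable coefficients\<close>

definition tser :: "('n::finite lattice \<Rightarrow> complex) \<Rightarrow> 'n potential" where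
  "tser c x = (\<Sum>\<^sub>\<infinity>m. c m * plane_wave (lat m) x)"

lemma abs_summable_times_bounded:
  fixes c d :: "'i \<Rightarrow> complex"
  assumes "(\<lambda>m. norm (c m)) summable_on S" "\<And>m. norm (d m) \<le> B"
  shows "(\<lambda>m. norm (c m * d m)) summable_on S"
proof (rule summable_on_comparison_test)
  show "(\<lambda>m. norm (c m) * B) summable_on S" by (rule summable_on_cmult_left[OF assms(1)])
qed (auto simp: norm_mult intro!: mult_left_mono assms(2))

text \<open>The error over a finite set is at most the tail of the sum of |c m|, independently of x.
  General factors \<open>d m x\<close> are allowed so that the lemma also covers the series
  multiplied by a fixed plane wave.\<close>

lemma tser_uniform_limit:
  fixes c :: "'a \<Rightarrow> complex"
  assumes c: "(\<lambda>m. norm (c m)) summable_on UNIV" and d: "\<And>m x. norm (d m x :: complex) \<le> 1"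
  shows "uniform_limit UNIV (\<lambda>F x. \<Sum>m\<in>F. c m * d m x) (\<lambda>x. \<Sum>\<^sub>\<infinity>m. c m * d m x) (finite_subsets_at_top UNIV)"
proof (rule uniform_limitI)
  fix e :: real assume "e > 0"
  have *: "\<forall>\<^sub>F F in finite_subsets_at_top (UNIV :: 'a set). finite F"
    by (rule eventually_finite_subsets_at_top_weakI) auto
  have "((\<lambda>F. \<Sum>m\<in>F. norm (c m)) \<longlongrightarrow> (\<Sum>\<^sub>\<infinity>m. norm (c m))) (finite_subsets_at_top UNIV)"
    by (rule infsum_tendsto[OF c])
  then have "\<forall>\<^sub>F F in finite_subsets_at_top UNIV. dist (\<Sum>m\<in>F. norm (c m)) (\<Sum>\<^sub>\<infinity>m. norm (c m)) < e"
    using \<open>e > 0\<close> by (rule tendstoD)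
  then show "\<forall>\<^sub>F F in finite_subsets_at_top UNIV. \<forall>x\<in>UNIV. dist (\<Sum>m\<in>F. c m * d m x) (\<Sum>\<^sub>\<infinity>m. c m * d m x) < e"
    using *
  proof (eventually_elim, intro ballI)
    fix F x assume F: "dist (\<Sum>m\<in>F. norm (c m)) (\<Sum>\<^sub>\<infinity>m. norm (c m)) < e" "finite F"
    have s: "(\<lambda>m. norm (c m * d m x)) summable_on UNIV"
      by (rule abs_summable_times_bounded[OF c d])
    have "(\<Sum>\<^sub>\<infinity>m. c m * d m x) = (\<Sum>m\<in>F. c m * d m x) + (\<Sum>\<^sub>\<infinity>m\<in>UNIV - F. c m * d m x)"
      using infsum_Diff[of "\<lambda>m. c m * d m x" UNIV F] abs_summable_summable[OF s] F(2)
      by (simp add: summable_on_finite infsum_finite)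
    then have "dist (\<Sum>m\<in>F. c m * d m x) (\<Sum>\<^sub>\<infinity>m. c m * d m x) = norm (\<Sum>\<^sub>\<infinity>m\<in>UNIV - F. c m * d m x)"
      by (simp add: dist_norm)
    also have "\<dots> \<le> (\<Sum>\<^sub>\<infinity>m\<in>UNIV - F. norm (c m * d m x))"
      by (rule norm_infsum_bound) (rule summable_on_subset_banach[OF s], simp)
    also have "\<dots> \<le> (\<Sum>\<^sub>\<infinity>m\<in>UNIV - F. norm (c m))"
      by (intro infsum_mono summable_on_subset_banach[OF s] summable_on_subset_banach[OF c])
         (auto simp: norm_mult intro: mult_left_le d)
    also have "\<dots> = (\<Sum>\<^sub>\<infinity>m. norm (c m)) - (\<Sum>m\<in>F. norm (c m))"
      using infsum_Diff[of "\<lambda>m. norm (c m)" UNIV F] c F(2) by (simp add: summable_on_finite infsum_finite)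
    also have "\<dots> < e" using F(1) by (simp add: dist_real_def)
    finally show "dist (\<Sum>m\<in>F. c m * d m x) (\<Sum>\<^sub>\<infinity>m. c m * d m x) < e" .
  qed
qed

lemma tser_continuous:
  assumes "(\<lambda>m. norm (c m)) summable_on UNIV"
  shows "continuous_on UNIV (tser c)"
  unfolding tser_def[abs_def]
  by (rule uniform_limit_theorem[OF _ tser_uniform_limit[OF assms]])
     (auto intro!: always_eventually continuous_intros)

text \<open>Uniform convergence permits integration along the net of finite index sets. By
  orthogonality the integral is constant as soon as the set contains \<open>k\<close>, so the limit
  is that constant.\<close>

lemma fourier_coeff_tser:
  fixes c :: "'n::finite lattice \<Rightarrow> complex"
  assumes c: "(\<lambda>m. norm (c m)) summable_on UNIV"
  shows "fourier_coeff (tser c) k = c k"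
proof -
  have "uniform_limit UNIV (\<lambda>F x. \<Sum>m\<in>F. c m * plane_wave (lat (m - k)) x)
     (\<lambda>x. \<Sum>\<^sub>\<infinity>m. c m * plane_wave (lat (m - k)) x) (finite_subsets_at_top UNIV)"
    by (rule tser_uniform_limit[OF c]) simp
  then have ul: "uniform_limit (cbox 0 (\<chi> i. 2 * pi)) (\<lambda>F x. \<Sum>m\<in>F. c m * plane_wave (lat (m - k)) x)
     (\<lambda>x. \<Sum>\<^sub>\<infinity>m. c m * plane_wave (lat (m - k)) x) (finite_subsets_at_top UNIV)"
    by (rule uniform_limit_on_subset) simp
  obtain I J where IJ: "\<And>F. ((\<lambda>x. \<Sum>m\<in>F. c m * plane_wave (lat (m - k)) x) has_integral I F) (cbox 0 (\<chi> i. 2 * pi))"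
      "((\<lambda>x. \<Sum>\<^sub>\<infinity>m. c m * plane_wave (lat (m - k)) x) has_integral J) (cbox 0 (\<chi> i. 2 * pi))"
      "(I \<longlongrightarrow> J) (finite_subsets_at_top UNIV)"
    by (rule uniform_limit_integral_cbox[OF ul]) (auto intro!: continuous_intros)
  have pwi: "(\<lambda>x. c m * plane_wave (lat m') x) integrable_on cbox 0 (\<chi> i. 2 * pi)" for m m'
    by (intro integrable_continuous continuous_intros)
  have I: "I F = c k * of_real ((2 * pi) ^ CARD('n))" if "finite F" "k \<in> F" for F
  proof -
    have "I F = integral (cbox 0 (\<chi> i. 2 * pi)) (\<lambda>x. \<Sum>m\<in>F. c m * plane_wave (lat (m - k)) x)"
      using IJ(1)[of F] by (simp add: integral_unique)
    also have "\<dots> = (\<Sum>m\<in>F. c m * integral Qcell (plane_wave (lat (m - k))))"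
      by (subst integral_sum[OF that(1) pwi]) (simp add: Qcell_def)
    also have "\<dots> = (\<Sum>m\<in>F. if m = k then c m * of_real ((2 * pi) ^ CARD('n)) else 0)"
      by (intro sum.cong refl) (simp add: integral_plane_wave)
    also have "\<dots> = c k * of_real ((2 * pi) ^ CARD('n))" using that by (simp add: sum.delta)
    finally show ?thesis .
  qed
  have "(I \<longlongrightarrow> c k * of_real ((2 * pi) ^ CARD('n))) (finite_subsets_at_top UNIV)"
  proof (rule tendsto_eventually)
    show "\<forall>\<^sub>F F in finite_subsets_at_top UNIV. I F = c k * of_real ((2 * pi) ^ CARD('n))"
      unfolding eventually_finite_subsets_at_top by (rule exI[of _ "{k}"]) (use I in blast)
  qed
  then have J: "J = c k * of_real ((2 * pi) ^ CARD('n))"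
    using tendsto_unique[OF _ IJ(3)] by simp
  have "tser c x * plane_wave (- lat k) x = (\<Sum>\<^sub>\<infinity>m. c m * plane_wave (lat (m - k)) x)" for x
  proof -
    have "tser c x * plane_wave (- lat k) x = (\<Sum>\<^sub>\<infinity>m. c m * plane_wave (lat m) x * plane_wave (- lat k) x)"
      unfolding tser_def by (rule infsum_cmult_left'[symmetric])
    also have "\<dots> = (\<Sum>\<^sub>\<infinity>m. c m * plane_wave (lat (m - k)) x)"
      using plane_wave_add[of "lat m" "- lat k" x for m] by (intro infsum_cong) (simp add: lat_diff mult.assoc)
    finally show ?thesis .
  qed
  then have "integral Qcell (\<lambda>x. tser c x * plane_wave (- lat k) x) = J"
    using IJ(2) by (simp add: Qcell_def integral_unique)
  then show ?thesis unfolding fourier_coeff_def J by simp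
qed

lemma plane_wave_periodic: "plane_wave (lat m) (x + (2 * pi) *\<^sub>R lat k) = plane_wave (lat m) x"
proof -
  have "\<exists>i::int. lat m \<bullet> lat k = of_int i"
    by (rule exI[of _ "\<Sum>i\<in>UNIV. m $ i * k $ i"]) (simp add: lat_def inner_vec_def)
  then obtain i :: int where "lat m \<bullet> lat k = of_int i" by blast
  then show ?thesis
    using cis_multiple_2pi[of "of_int i"]
    unfolding plane_wave_def by (simp add: inner_add_right cis_mult[symmetric] mult_ac)
qed

lemma periodic_integrable_tser:
  assumes "(\<lambda>m. norm (c m)) summable_on UNIV"
  shows "periodic_integrable (tser c)"
  unfolding periodic_integrable_def
proof
  show "\<forall>m x. tser c (x + (2 * pi) *\<^sub>R lat m) = tser c x" by (simp add: tser_def plane_wave_periodic)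
  show "tser c absolutely_integrable_on Qcell"
    unfolding Qcell_def
    by (rule absolutely_integrable_continuous) (rule continuous_on_subset[OF tser_continuous[OF assms]], simp)
qed

lemma fourier_coeff_diff:
  assumes f: "f absolutely_integrable_on Qcell" and g: "g absolutely_integrable_on Qcell"
  shows "fourier_coeff (\<lambda>x. f x - g x) m = fourier_coeff f m - fourier_coeff g m"
proof -
  have i: "(\<lambda>x. h x * plane_wave (- lat m) x) integrable_on Qcell" if "h absolutely_integrable_on Qcell" for h
  proof -
    have "(\<lambda>x. plane_wave (- lat m) x * h x) absolutely_integrable_on Qcell"
    proof (rule absolutely_integrable_bounded_measurable_product[OF bilinear_times])
      show "plane_wave (- lat m) \<in> borel_measurable (lebesgue_on Qcell)"
        by (intro continuous_imp_measurable_on_sets_lebesgue continuous_intros) (simp add: Qcell_def)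
      show "bounded (plane_wave (- lat m) ` Qcell)" by (auto intro!: boundedI[of _ 1])
    qed (use that in \<open>auto simp: Qcell_def\<close>)
    then show ?thesis by (simp add: set_lebesgue_integral_eq_integral(1) mult.commute)
  qed
  show ?thesis unfolding fourier_coeff_def
    by (simp add: left_diff_distrib integral_diff i f g diff_divide_distrib)
qed

text \<open>The coefficients of |u|^2 form the autocorrelation of those of u. The double family is
  absolutely summable, so the sums may be exchanged, and the shift m to s + m splits the inner sum
  off as \<open>tser e x\<close>.\<close>

lemma tser_abs_square:
  assumes e: "(\<lambda>m. norm (e m)) summable_on UNIV"
  shows "of_real ((norm (tser e x))\<^sup>2) = tser (\<lambda>m. \<Sum>\<^sub>\<infinity>s. e (s + m) * cnj (e s)) x"
    and "(\<lambda>m. norm (\<Sum>\<^sub>\<infinity>s. e (s + m) * cnj (e s))) summable_on UNIV"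
proof -
  have bij: "bij_betw (\<lambda>m. s + m) UNIV UNIV" for s :: "'a lattice"
    by (rule bij_betwI[of _ _ _ "\<lambda>m. m - s"]) auto
  define F where "F s m = e (s + m) * cnj (e s) * plane_wave (lat m) x" for s m
  define G where "G s m = e (s + m) * cnj (e s)" for s m
  have *: "(\<lambda>m. norm (e (s + m))) summable_on UNIV" for s
    using summable_on_reindex_bij_betw[OF bij, of "\<lambda>m. norm (e m)"] e by simp
  have Gs: "(\<lambda>p. norm (case p of (s, m) \<Rightarrow> G s m)) summable_on (UNIV \<times> UNIV)"
    unfolding Infinite_Sum.abs_summable_on_Sigma_iff prod.case
  proof (intro conjI ballI)
    show "(\<lambda>m. norm (G s m)) summable_on UNIV" for s
      unfolding G_def norm_mult by (rule summable_on_cmult_left[OF *])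
    have "(\<Sum>\<^sub>\<infinity>m. norm (G s m)) = (\<Sum>\<^sub>\<infinity>m. norm (e m)) * norm (e s)" for s
      unfolding G_def using infsum_reindex_bij_betw[OF bij[of s], of "\<lambda>m. norm (e m)"]
      by (simp add: norm_mult infsum_cmult_left')
    then show "(\<lambda>s. norm (\<Sum>\<^sub>\<infinity>m. norm (G s m))) summable_on UNIV"
      using e by (simp add: abs_mult infsum_nonneg summable_on_cmult_right)
  qed
  then have Fs: "(\<lambda>p. norm (case p of (s, m) \<Rightarrow> F s m)) summable_on (UNIV \<times> UNIV)"
    by (simp add: F_def G_def norm_mult split_def)
  \<comment> \<open>The same family summed in the other order; its iterated sums control the
    autocorrelation coefficients.\<close>
  have swapped: "(\<lambda>p. norm (case p of (m, s) \<Rightarrow> G s m)) summable_on (UNIV \<times> UNIV)"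
  proof -
    have b: "bij_betw prod.swap (UNIV :: ('a lattice \<times> 'a lattice) set) UNIV"
      by (rule bij_betwI[of _ _ _ prod.swap]) auto
    have "(\<lambda>p. norm (case prod.swap p of (s, m) \<Rightarrow> G s m)) summable_on UNIV"
      unfolding summable_on_reindex_bij_betw[OF b, of "\<lambda>p. norm (case p of (s, m) \<Rightarrow> G s m)"]
      using Gs by simp
    then show ?thesis unfolding split_def prod.swap_def by simp
  qed
  note sw = swapped[unfolded Infinite_Sum.abs_summable_on_Sigma_iff prod.case]
  have "norm (\<Sum>\<^sub>\<infinity>s. norm (G s m)) = (\<Sum>\<^sub>\<infinity>s. norm (G s m))" for m
    by (simp add: infsum_nonneg)
  then have s1: "(\<lambda>m. \<Sum>\<^sub>\<infinity>s. norm (G s m)) summable_on UNIV"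
    using conjunct2[OF sw] by simp
  have Gm: "(\<lambda>s. norm (G s m)) summable_on UNIV" for m
    using sw by blast
  show "(\<lambda>m. norm (\<Sum>\<^sub>\<infinity>s. e (s + m) * cnj (e s))) summable_on UNIV"
  proof (rule summable_on_comparison_test[OF s1])
    show "norm (\<Sum>\<^sub>\<infinity>s. e (s + m) * cnj (e s)) \<le> (\<Sum>\<^sub>\<infinity>s. norm (G s m))" for m
      using norm_infsum_bound[OF Gm[of m]] unfolding G_def .
  qed (rule norm_ge_zero)
  have "tser (\<lambda>m. \<Sum>\<^sub>\<infinity>s. e (s + m) * cnj (e s)) x = (\<Sum>\<^sub>\<infinity>m. \<Sum>\<^sub>\<infinity>s. F s m)"
    unfolding tser_def F_def by (rule infsum_cong) (rule infsum_cmult_left'[symmetric])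
  also have "\<dots> = (\<Sum>\<^sub>\<infinity>s. \<Sum>\<^sub>\<infinity>m. F s m)"
  proof (rule infsum_swap_banach[symmetric])
    show "(\<lambda>(s, m). F s m) summable_on UNIV \<times> UNIV" using Fs by (rule abs_summable_summable)
  qed
  also have "\<dots> = (\<Sum>\<^sub>\<infinity>s. cnj (e s * plane_wave (lat s) x) * tser e x)"
  proof (rule infsum_cong)
    fix s
    have "F s m = cnj (e s * plane_wave (lat s) x) * (e (s + m) * plane_wave (lat (s + m)) x)" for m
      unfolding F_def lat_add plane_wave_add complex_cnj_mult
      using complex_norm_square[of "plane_wave (lat s) x"] by (simp add: mult_ac)
    then have "(\<Sum>\<^sub>\<infinity>m. F s m) = (\<Sum>\<^sub>\<infinity>m. cnj (e s * plane_wave (lat s) x) * (e (s + m) * plane_wave (lat (s + m)) x))"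
      by (rule infsum_cong)
    also have "\<dots> = cnj (e s * plane_wave (lat s) x) * (\<Sum>\<^sub>\<infinity>m. e (s + m) * plane_wave (lat (s + m)) x)"
      by (rule infsum_cmult_right')
    also have "(\<Sum>\<^sub>\<infinity>m. e (s + m) * plane_wave (lat (s + m)) x) = tser e x"
      unfolding tser_def by (rule infsum_reindex_bij_betw[OF bij, of "\<lambda>m. e m * plane_wave (lat m) x"])
    finally show "(\<Sum>\<^sub>\<infinity>m. F s m) = cnj (e s * plane_wave (lat s) x) * tser e x" .
  qed
  also have "\<dots> = cnj (tser e x) * tser e x"
    unfolding tser_def infsum_cnj[symmetric] by (rule infsum_cmult_left')
  also have "\<dots> = of_real ((norm (tser e x))\<^sup>2)"
    unfolding complex_norm_square by (rule mult.commute)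
  finally show "of_real ((norm (tser e x))\<^sup>2) = tser (\<lambda>m. \<Sum>\<^sub>\<infinity>s. e (s + m) * cnj (e s)) x" ..
qed

lemma fourier_coeff_uminus_real:
  assumes "\<And>x. V x \<in> \<real>"
  shows "fourier_coeff V (- m) = cnj (fourier_coeff V m)"
proof -
  have "cnj (V x) = V x" for x using assms by (simp add: Reals_cnj_iff)
  then show ?thesis
    unfolding fourier_coeff_def by (simp add: integral_cnj cnj_plane_wave lat_minus)
qed

lemma real_trig_poly_tser:
  fixes V :: "'n::finite potential"
  assumes V: "real_trig_poly R\<^sub>0 V" and q: "fourier_coeff V q \<noteq> 0"
  shows "V = tser (fourier_coeff V)" "(\<lambda>m. norm (fourier_coeff V m)) summable_on UNIV"
    "fourier_coeff V 0 = 0"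
proof -
  define S where "S = {m :: 'n lattice. 0 < norm (lat m) \<and> norm (lat m) \<le> R\<^sub>0}"
  obtain v where v: "\<And>x. V x = (\<Sum>m\<in>S. v m * plane_wave (lat m) x)"
    using V unfolding real_trig_poly_def S_def by blast
  \<comment> \<open>A sum over an infinite set is 0 by convention, which would make V and hence
    \<open>v_q\<close> vanish. Finiteness is thus obtained without counting lattice points.\<close>
  have fin: "finite S"
  proof (rule ccontr)
    assume "infinite S"
    then have "V = (\<lambda>_. 0)" using v by auto
    then have "fourier_coeff V q = 0" by (simp add: fourier_coeff_def)
    with q show False ..
  qed
  define w where "w m = (if m \<in> S then v m else 0)" for m
  have ws: "(\<lambda>m. norm (w m)) summable_on UNIV"
    by (rule finite_nonzero_values_imp_summable_on, rule finite_subset[OF _ fin]) (auto simp: w_def)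
  have Vw: "V = tser w"
  proof
    fix x
    have "tser w x = (\<Sum>\<^sub>\<infinity>m\<in>S. v m * plane_wave (lat m) x)"
      unfolding tser_def by (rule infsum_cong_neutral) (auto simp: w_def)
    then show "V x = tser w x" using v fin by (simp add: infsum_finite)
  qed
  have fw: "fourier_coeff V = w" unfolding Vw by (rule ext) (rule fourier_coeff_tser[OF ws])
  show "V = tser (fourier_coeff V)" "(\<lambda>m. norm (fourier_coeff V m)) summable_on UNIV"
    "fourier_coeff V 0 = 0"
    unfolding fw using Vw ws by (auto simp: w_def S_def lat_0)
qed

section \<open>Identification of the limit potential\<close>

lemma star_norm_tser_diff:
  assumes "(\<lambda>m. norm (c m)) summable_on UNIV" "periodic_integrable W"
  shows "star_norm (\<lambda>x. tser c x - W x) = esum (\<lambda>m. ennreal (norm (c m - fourier_coeff W m)))"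
proof -
  have "fourier_coeff (\<lambda>x. tser c x - W x) m = c m - fourier_coeff W m" for m
    using fourier_coeff_diff[of "tser c" W m] periodic_integrable_tser[OF assms(1)] assms(2)
    by (simp add: periodic_integrable_def fourier_coeff_tser[OF assms(1)])
  then show ?thesis by (simp add: star_norm_def esum_eq_infsum)
qed

text \<open>The choice in \<^const>\<open>W_lim\<close> is harmless: all admissible limits have the same Fourier coefficients.\<close>

lemma fourier_coeff_W_lim:
  assumes it: "\<And>m. W_iter l V q \<sigma> A \<epsilon> j t m = tser (c m)"
    and cs: "\<And>m. (\<lambda>i. norm (c m i)) summable_on UNIV" and ws: "(\<lambda>i. norm (w i)) summable_on UNIV"
    and lim: "(\<lambda>m. esum (\<lambda>i. ennreal (norm (c m i - w i)))) \<longlonglongrightarrow> 0"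
  shows "fourier_coeff (W_lim l V q \<sigma> A \<epsilon> j t) = w"
proof -
  define W where "W = W_lim l V q \<sigma> A \<epsilon> j t"
  have fin: "star_norm (tser w) < \<infinity>"
  proof -
    have "ennreal (\<Sum>\<^sub>\<infinity>i. norm (w i)) = (\<Sum>\<^sub>\<infinity>i. ennreal (norm (w i)))"
      using infsum_nonneg_is_SUPREMUM_ennreal[OF ws]
      by (simp add: nonneg_infsum_complete sum_ennreal)
    then show ?thesis
      unfolding star_norm_def fourier_coeff_tser[OF ws]
      by (metis ennreal_less_top infinity_ennreal_def)
  qed
  have "periodic_integrable W \<and> star_norm W < \<infinity> \<and>
     (\<lambda>m. star_norm (\<lambda>x. W_iter l V q \<sigma> A \<epsilon> j t m x - W x)) \<longlonglongrightarrow> 0"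
    unfolding W_def W_lim_def
  proof (rule someI[of _ "tser w"], intro conjI)
    show "periodic_integrable (tser w)" by (rule periodic_integrable_tser[OF ws])
    show "star_norm (tser w) < \<infinity>" by (rule fin)
    show "(\<lambda>m. star_norm (\<lambda>x. W_iter l V q \<sigma> A \<epsilon> j t m x - tser w x)) \<longlonglongrightarrow> 0"
      unfolding it star_norm_tser_diff[OF cs periodic_integrable_tser[OF ws]] fourier_coeff_tser[OF ws]
      by (rule lim)
  qed
  then have W: "periodic_integrable W"
    and l0: "(\<lambda>m. esum (\<lambda>i. ennreal (norm (c m i - fourier_coeff W i)))) \<longlonglongrightarrow> 0"
    unfolding it using star_norm_tser_diff[OF cs] by auto
  have "fourier_coeff W i = w i" for i
  proof -
    have "ennreal (norm (fourier_coeff W i - w i))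
       \<le> esum (\<lambda>i. ennreal (norm (c m i - w i))) + esum (\<lambda>i. ennreal (norm (c m i - fourier_coeff W i)))" for m
    proof -
      have "norm (fourier_coeff W i - w i) \<le> norm (c m i - w i) + norm (c m i - fourier_coeff W i)"
        using norm_triangle_ineq4[of "c m i - w i" "c m i - fourier_coeff W i"] by simp
      then have "ennreal (norm (fourier_coeff W i - w i))
          \<le> ennreal (norm (c m i - w i)) + ennreal (norm (c m i - fourier_coeff W i))"
        by (simp add: ennreal_plus[symmetric] del: ennreal_plus)
      also have "\<dots> \<le> esum (\<lambda>i. ennreal (norm (c m i - w i))) + esum (\<lambda>i. ennreal (norm (c m i - fourier_coeff W i)))"
        by (intro add_mono le_esum)
      finally show ?thesis .
    qed
    moreover have "(\<lambda>m. esum (\<lambda>i. ennreal (norm (c m i - w i))) + esum (\<lambda>i. ennreal (norm (c m i - fourier_coeff W i)))) \<longlonglongrightarrow> 0 + 0"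
      by (intro tendsto_add lim l0)
    ultimately have "ennreal (norm (fourier_coeff W i - w i)) \<le> 0 + 0"
      by (intro LIMSEQ_le_const) auto
    then show ?thesis by simp
  qed
  then show ?thesis unfolding W_def by blast
qed

section \<open>The unperturbed block\<close>

definition gap :: "nat \<Rightarrow> 'n::finite lattice \<Rightarrow> 'n lattice \<Rightarrow> real ^ 'n \<Rightarrow> real" where
  "gap l q j t = pnorm j t ^ (2 * l) - pnorm (j - q) t ^ (2 * l)"

text \<open>This is 2b, the distance between the two eigenvalues of the block. It is at least 2|v_q|
  for all t, which is the only separation the block provides.\<close>

definition width :: "nat \<Rightarrow> 'n::finite potential \<Rightarrow> 'n lattice \<Rightarrow> 'n lattice \<Rightarrow> real ^ 'n \<Rightarrow> real" where
  "width l V q j t = sqrt (4 * (norm (fourier_coeff V q))\<^sup>2 + (gap l q j t)\<^sup>2)"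

text \<open>For a 2x2 matrix H with eigenvalues a + b and a - b the spectral projections are (1 +
  \<epsilon> (H - a)/b)/2; these are the entries. Unlike the definition of \<open>E_hat\<close> by
  an eigenvector, the formula shows the dependence on t.\<close>

definition block_proj ::
  "nat \<Rightarrow> 'n::finite potential \<Rightarrow> 'n lattice \<Rightarrow> real \<Rightarrow> 'n lattice \<Rightarrow> real ^ 'n \<Rightarrow> 'n matrix" where
  "block_proj l V q \<epsilon> j t s r =
    (if s = j \<and> r = j then of_real ((1 + \<epsilon> * (gap l q j t / width l V q j t)) / 2)
     else if s = j - q \<and> r = j - q then of_real ((1 - \<epsilon> * (gap l q j t / width l V q j t)) / 2)
     else if s = j \<and> r = j - q then of_real \<epsilon> * fourier_coeff V q * of_real (1 / width l V q j t)
     else if s = j - q \<and> r = j then of_real \<epsilon> * cnj (fourier_coeff V q) * of_real (1 / width l V q j t)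
     else 0)"

text \<open>Spectral decomposition on the block, where -\<epsilon> denotes the other eigenvalue, and
  scalar inverses off it.\<close>

definition block_resolvent ::
  "nat \<Rightarrow> 'n::finite potential \<Rightarrow> 'n lattice \<Rightarrow> real \<Rightarrow> 'n lattice \<Rightarrow> real ^ 'n \<Rightarrow> complex \<Rightarrow> 'n matrix" where
  "block_resolvent l V q \<epsilon> j t z s r =
    (if s \<in> {j, j - q} \<and> r \<in> {j, j - q} then
       block_proj l V q \<epsilon> j t s r / (of_real (lambda_hat l V q \<epsilon> j t) - z)
       + block_proj l V q (- \<epsilon>) j t s r / (of_real (lambda_hat l V q (- \<epsilon>) j t) - z)
     else if s = r then 1 / (of_real (pnorm s t ^ (2 * l)) - z) else 0)"

definition block_diagonal :: "'n::finite lattice set \<Rightarrow> 'n matrix \<Rightarrow> bool" where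
  "block_diagonal B T \<longleftrightarrow> (\<forall>s r. s \<noteq> r \<and> \<not> (s \<in> B \<and> r \<in> B) \<longrightarrow> T s r = 0)"

section \<open>Infinite matrices with one finite block\<close>

lemma infsum_finite_support:
  fixes f :: "'i \<Rightarrow> 'b::{t2_space,comm_monoid_add}"
  assumes "finite F" "\<And>x. x \<notin> F \<Longrightarrow> f x = 0"
  shows "(\<Sum>\<^sub>\<infinity>x. f x) = sum f F"
proof -
  have "(\<Sum>\<^sub>\<infinity>x. f x) = infsum f F" by (rule infsum_cong_neutral) (use assms in auto)
  then show ?thesis using assms by simp
qed

lemma mmul_block_left:
  assumes "block_diagonal B T" "finite B"
  shows "mmul T S s r = (\<Sum>a\<in>insert s (if s \<in> B then B else {}). T s a * S a r)"
  unfolding mmul_def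
  by (rule infsum_finite_support) (use assms in \<open>auto simp: block_diagonal_def split: if_splits\<close>)

text \<open>Products of infinite matrices need not be associative. Here rows of T and R have finite
  support inside one set, so R (T R') = (R T) R' is a finite computation for an arbitrary competitor
  R'.\<close>

lemma minverse_block:
  assumes T: "block_diagonal B T" and R: "block_diagonal B R" and B: "finite B"
    and TR: "mmul T R = mident" and RT: "mmul R T = mident"
  shows "minverse T = R"
  unfolding minverse_def
proof (rule the_equality)
  fix R' assume R': "mmul T R' = mident \<and> mmul R' T = mident"
  show "R' = R"
  proof (intro ext)
    fix s r
    \<comment> \<open>All indices that can be reached from \<open>s\<close> through nonzero entries
      of T and R; it is the same set for each of its members.\<close>
    define F where "F = insert s (if s \<in> B then B else {})"
    have F: "finite F" "s \<in> F"
      using B by (auto simp: F_def split: if_splits)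
    have in_F: "(\<Sum>c\<in>insert a (if a \<in> B then B else {}). X c) = (\<Sum>c\<in>F. X c)" if "a \<in> F" for a and X :: "'a lattice \<Rightarrow> complex"
    proof -
      have "insert a (if a \<in> B then B else {}) = F"
        using that by (auto simp: F_def split: if_splits)
      then show ?thesis by simp
    qed
    have "R s r = (\<Sum>a\<in>F. R s a * mident a r)"
      using F unfolding mident_def
      by (cases "r \<in> F") (use R in \<open>auto simp: if_distrib sum.delta F_def block_diagonal_def cong: if_cong split: if_splits\<close>)
    also have "\<dots> = (\<Sum>a\<in>F. R s a * (\<Sum>c\<in>F. T a c * R' c r))"
      using mmul_block_left[OF T B, of R'] R' in_F by (intro sum.cong refl) simp
    also have "\<dots> = (\<Sum>c\<in>F. (\<Sum>a\<in>F. R s a * T a c) * R' c r)"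
      by (simp add: sum_distrib_left sum_distrib_right mult.assoc) (rule sum.swap)
    also have "\<dots> = (\<Sum>c\<in>F. mident s c * R' c r)"
      using mmul_block_left[OF R B, of T] RT in_F[OF F(2)] by (intro sum.cong refl) simp
    also have "\<dots> = R' s r"
      using F unfolding mident_def by (simp add: if_distrib[of "\<lambda>x. x * _"] sum.delta cong: if_cong)
    finally show "R' s r = R s r" ..
  qed
qed (use TR RT in blast)

text \<open>The eigenvalue equation for the projection as pure algebra: P, P' are the diagonal
  entries, v, w the off-diagonal ones, \<beta> the width. v and w are independent variables, so
  exchanging them yields the equation for multiplication from the other side.\<close>

lemma block_eigen_identities:
  fixes P P' v w \<beta> \<epsilon> :: complex
  assumes \<beta>: "\<beta> \<noteq> 0" and vw: "4 * (v * w) = \<beta>\<^sup>2 - (P - P')\<^sup>2" and \<epsilon>: "\<epsilon>\<^sup>2 = 1"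
  defines "lm \<equiv> (P + P') / 2 + \<epsilon> * (\<beta> / 2)"
  shows "P * ((1 + \<epsilon> * ((P - P') / \<beta>)) / 2) + v * (\<epsilon> * w * (1 / \<beta>)) = lm * ((1 + \<epsilon> * ((P - P') / \<beta>)) / 2)"
    and "P' * ((1 - \<epsilon> * ((P - P') / \<beta>)) / 2) + w * (\<epsilon> * v * (1 / \<beta>)) = lm * ((1 - \<epsilon> * ((P - P') / \<beta>)) / 2)"
    and "P * (\<epsilon> * v * (1 / \<beta>)) + v * ((1 - \<epsilon> * ((P - P') / \<beta>)) / 2) = lm * (\<epsilon> * v * (1 / \<beta>))"
    and "P' * (\<epsilon> * w * (1 / \<beta>)) + w * ((1 + \<epsilon> * ((P - P') / \<beta>)) / 2) = lm * (\<epsilon> * w * (1 / \<beta>))"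
proof -
  obtain g where g: "g = (P - P') / \<beta>" by blast
  have P: "P = P' + g * \<beta>" using \<beta> g by simp
  have vw': "4 * (v * w) = \<beta>\<^sup>2 - (g * \<beta>)\<^sup>2" using vw P by simp
  define b where "b = 1 / \<beta>"
  have b: "\<beta> * b = 1" using \<beta> by (simp add: b_def)
  have vwb: "4 * (v * w * b) = \<beta> - g\<^sup>2 * \<beta>"
  proof -
    have "4 * (v * w * b) = (\<beta>\<^sup>2 - (g * \<beta>)\<^sup>2) * b" unfolding vw'[symmetric] by (simp only: mult.assoc)
    also have "\<dots> = (\<beta> - g\<^sup>2 * \<beta>) * (\<beta> * b)" by (simp add: algebra_simps power2_eq_square)
    finally show ?thesis using b by simp
  qed
  have ee: "\<epsilon> * \<epsilon> = 1" "\<And>x. \<epsilon> * (\<epsilon> * x) = x"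
    using \<epsilon> by (simp_all add: power2_eq_square mult.assoc[symmetric])
  have vwb': "v * (\<epsilon> * w * b) = \<epsilon> * ((\<beta> - g\<^sup>2 * \<beta>) / 4)" "w * (\<epsilon> * v * b) = \<epsilon> * ((\<beta> - g\<^sup>2 * \<beta>) / 4)"
    unfolding vwb[symmetric] by simp_all
  have lm: "P - lm = (g - \<epsilon>) * \<beta> / 2" "P' - lm = - ((g + \<epsilon>) * \<beta> / 2)"
    unfolding lm_def P by (simp_all add: field_simps)
  have "(P - lm) * ((1 + \<epsilon> * g) / 2) + v * (\<epsilon> * w * b) = 0"
    unfolding lm vwb' by (simp add: field_simps power2_eq_square ee)
  then show "P * ((1 + \<epsilon> * ((P - P') / \<beta>)) / 2) + v * (\<epsilon> * w * (1 / \<beta>)) = lm * ((1 + \<epsilon> * ((P - P') / \<beta>)) / 2)"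
    unfolding g[symmetric] b_def[symmetric] by (simp only: left_diff_distrib) (simp add: algebra_simps)
  have "(P' - lm) * ((1 - \<epsilon> * g) / 2) + w * (\<epsilon> * v * b) = 0"
    unfolding lm vwb' by (simp add: field_simps power2_eq_square ee)
  then show "P' * ((1 - \<epsilon> * ((P - P') / \<beta>)) / 2) + w * (\<epsilon> * v * (1 / \<beta>)) = lm * ((1 - \<epsilon> * ((P - P') / \<beta>)) / 2)"
    unfolding g[symmetric] b_def[symmetric] by (simp only: left_diff_distrib) (simp add: algebra_simps)
  have "(P - lm) * (\<epsilon> * v * b) = (g - \<epsilon>) / 2 * (\<epsilon> * v) * (\<beta> * b)" unfolding lm by simp
  also have "\<dots> = - (v * ((1 - \<epsilon> * g) / 2))" unfolding b by (simp add: field_simps ee)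
  finally show "P * (\<epsilon> * v * (1 / \<beta>)) + v * ((1 - \<epsilon> * ((P - P') / \<beta>)) / 2) = lm * (\<epsilon> * v * (1 / \<beta>))"
    unfolding g[symmetric] b_def[symmetric] by (simp only: left_diff_distrib) (simp add: algebra_simps)
  have "(P' - lm) * (\<epsilon> * w * b) = - ((g + \<epsilon>) / 2 * (\<epsilon> * w)) * (\<beta> * b)" unfolding lm by simp
  also have "\<dots> = - (w * ((1 + \<epsilon> * g) / 2))" unfolding b by (simp add: field_simps ee)
  finally show "P' * (\<epsilon> * w * (1 / \<beta>)) + w * ((1 + \<epsilon> * ((P - P') / \<beta>)) / 2) = lm * (\<epsilon> * w * (1 / \<beta>))"
    unfolding g[symmetric] b_def[symmetric] by (simp only: left_diff_distrib) (simp add: algebra_simps)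
qed

section \<open>Projection and resolvent of the block in closed form\<close>

locale resonant_potential =
  fixes l :: nat and V :: "'n::finite potential" and q :: "'n lattice"
  assumes V0: "fourier_coeff V 0 = 0"
    and Vneg: "\<And>m. fourier_coeff V (- m) = cnj (fourier_coeff V m)"
    and q0: "q \<noteq> 0" and Vq: "fourier_coeff V q \<noteq> 0"
begin

abbreviation "vq \<equiv> fourier_coeff V q"

lemma jq: "j \<noteq> j - q" "j - q \<noteq> j" using q0 by auto

lemma width_pos: "width l V q j t > 0"
  unfolding width_def using Vq by (simp add: add_pos_nonneg)

lemma width_square: "(width l V q j t)\<^sup>2 = 4 * (norm vq)\<^sup>2 + (gap l q j t)\<^sup>2"
  unfolding width_def by (rule real_sqrt_pow2) simp

lemma width_ge: "2 * norm vq \<le> width l V q j t"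
  unfolding width_def by (rule real_le_rsqrt) (simp add: power_mult_distrib)

lemma gap_le_width: "\<bar>gap l q j t\<bar> \<le> width l V q j t"
  unfolding width_def by (rule real_le_rsqrt) simp

lemma lambda_hat_eq:
  "lambda_hat l V q \<epsilon> j t = (pnorm j t ^ (2 * l) + pnorm (j - q) t ^ (2 * l)) / 2 + \<epsilon> * (width l V q j t / 2)"
  by (simp add: lambda_hat_def width_def gap_def)

lemma PVP_eq: "PVP V q j s r = (if s \<in> {j, j - q} \<and> r \<in> {j, j - q} then fourier_coeff V (s - r) else 0)"
proof -
  have a: "mmul X (Pq q j) s r = (if r \<in> {j, j - q} then X s r else 0)" for X s r
    unfolding mmul_def Pq_def using infsum_finite_support[of "{r}" "\<lambda>a. X s a * (if a = r \<and> a \<in> {j, j - q} then 1 else 0)"]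
    by simp
  have b: "mmul (Pq q j) X s r = (if s \<in> {j, j - q} then X s r else 0)" for X s r
    unfolding mmul_def Pq_def using infsum_finite_support[of "{s}" "\<lambda>a. (if s = a \<and> s \<in> {j, j - q} then 1 else 0) * X a r"]
    by simp
  show ?thesis unfolding PVP_def a b by (simp add: a mult_matrix_def)
qed

lemma Hhat_eq:
  "Hhat l V q j t s r =
    (if s = r then of_real (pnorm s t ^ (2 * l))
     else if s = j \<and> r = j - q then vq else if s = j - q \<and> r = j then cnj vq else 0)"
  unfolding Hhat_def H0_def PVP_eq using V0 Vneg[of q] jq by auto

lemma complex_identities:
  assumes "\<epsilon> \<in> {1, -1::real}"
  shows "complex_of_real (width l V q j t) \<noteq> 0"
    "4 * (vq * cnj vq) = (of_real (width l V q j t))\<^sup>2 - (of_real (pnorm j t ^ (2 * l)) - of_real (pnorm (j - q) t ^ (2 * l)))\<^sup>2"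
    "(of_real \<epsilon> :: complex)\<^sup>2 = 1"
proof -
  have "4 * (vq * cnj vq) = of_real (4 * (norm vq)\<^sup>2)"
    unfolding complex_norm_square[symmetric] by simp
  also have "\<dots> = of_real ((width l V q j t)\<^sup>2 - (gap l q j t)\<^sup>2)" using width_square by simp
  finally show "4 * (vq * cnj vq) = (of_real (width l V q j t))\<^sup>2 - (of_real (pnorm j t ^ (2 * l)) - of_real (pnorm (j - q) t ^ (2 * l)))\<^sup>2"
    unfolding gap_def by simp
qed (use width_pos[of j t] assms in auto)

definition eig :: "real \<Rightarrow> 'n lattice \<Rightarrow> real ^ 'n \<Rightarrow> complex" where
  "eig \<epsilon> j t = (of_real (pnorm j t ^ (2 * l)) + of_real (pnorm (j - q) t ^ (2 * l))) / 2
      + of_real \<epsilon> * (of_real (width l V q j t) / 2)"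

lemma lambda_hat_eig: "of_real (lambda_hat l V q \<epsilon> j t) = eig \<epsilon> j t"
  by (simp add: lambda_hat_eq eig_def)

lemma block_proj_entries:
  shows "block_proj l V q \<epsilon> j t j j = (1 + of_real \<epsilon> * ((of_real (pnorm j t ^ (2 * l)) - of_real (pnorm (j - q) t ^ (2 * l))) / of_real (width l V q j t))) / 2"
    "block_proj l V q \<epsilon> j t (j - q) (j - q) = (1 - of_real \<epsilon> * ((of_real (pnorm j t ^ (2 * l)) - of_real (pnorm (j - q) t ^ (2 * l))) / of_real (width l V q j t))) / 2"
    "block_proj l V q \<epsilon> j t j (j - q) = of_real \<epsilon> * vq * (1 / of_real (width l V q j t))"
    "block_proj l V q \<epsilon> j t (j - q) j = of_real \<epsilon> * cnj vq * (1 / of_real (width l V q j t))"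
  using jq by (auto simp: block_proj_def gap_def)

lemma block_proj_complement:
  assumes "s \<in> {j, j - q}" "r \<in> {j, j - q}"
  shows "block_proj l V q \<epsilon> j t s r + block_proj l V q (- \<epsilon>) j t s r = mident s r"
proof -
  consider "s = j" "r = j" | "s = j" "r = j - q" | "s = j - q" "r = j" | "s = j - q" "r = j - q"
    using assms by blast
  then show ?thesis
  proof cases
    case 1 show ?thesis unfolding 1 block_proj_entries by (simp add: mident_def add_divide_distrib[symmetric])
  next
    case 2 show ?thesis unfolding 2 block_proj_entries using jq by (simp add: mident_def)
  next
    case 3 show ?thesis unfolding 3 block_proj_entries using jq by (simp add: mident_def)
  next
    case 4 show ?thesis unfolding 4 block_proj_entries by (simp add: mident_def add_divide_distrib[symmetric])
  qed
qed

lemma eig_block_proj: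
  assumes e: "\<epsilon> \<in> {1, -1}" and "s \<in> {j, j - q}" "r \<in> {j, j - q}"
  shows "(\<Sum>a\<in>{j, j - q}. Hhat l V q j t s a * block_proj l V q \<epsilon> j t a r) = eig \<epsilon> j t * block_proj l V q \<epsilon> j t s r"
    and "(\<Sum>a\<in>{j, j - q}. block_proj l V q \<epsilon> j t s a * Hhat l V q j t a r) = eig \<epsilon> j t * block_proj l V q \<epsilon> j t s r"
proof -
  note I = block_eigen_identities[OF complex_identities[OF e], folded eig_def]
  have H: "Hhat l V q j t j j = of_real (pnorm j t ^ (2 * l))" "Hhat l V q j t (j - q) (j - q) = of_real (pnorm (j - q) t ^ (2 * l))"
    "Hhat l V q j t j (j - q) = vq" "Hhat l V q j t (j - q) j = cnj vq"
    using jq by (auto simp: Hhat_eq)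
  have sum2: "(\<Sum>a\<in>{j, j - q}. f a) = f j + f (j - q)" for f :: "'n lattice \<Rightarrow> complex"
    using jq by simp
  have vw: "4 * (cnj vq * vq) = (of_real (width l V q j t))\<^sup>2 - (of_real (pnorm j t ^ (2 * l)) - of_real (pnorm (j - q) t ^ (2 * l)))\<^sup>2"
    using complex_identities(2)[OF e, of j t] by (simp only: mult.commute)
  \<comment> \<open>Multiplication from the right is the transposed equation, in which
    \<open>v_q\<close> and its conjugate change places.\<close>
  note I' = block_eigen_identities[OF complex_identities(1)[OF e] vw complex_identities(3)[OF e], folded eig_def]
  have "s = j \<or> s = j - q" "r = j \<or> r = j - q" using assms by auto
  then consider "s = j" "r = j" | "s = j" "r = j - q" | "s = j - q" "r = j" | "s = j - q" "r = j - q" by blast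
  then show "(\<Sum>a\<in>{j, j - q}. Hhat l V q j t s a * block_proj l V q \<epsilon> j t a r) = eig \<epsilon> j t * block_proj l V q \<epsilon> j t s r"
  proof cases
    case 1 show ?thesis unfolding 1 sum2 H block_proj_entries by (rule I(1))
  next
    case 2 show ?thesis unfolding 2 sum2 H block_proj_entries by (rule I(3))
  next
    case 3 show ?thesis unfolding 3 sum2 H block_proj_entries by (subst add.commute) (rule I(4))
  next
    case 4 show ?thesis unfolding 4 sum2 H block_proj_entries by (subst add.commute) (rule I(2))
  qed
  from \<open>s = j \<or> s = j - q\<close> \<open>r = j \<or> r = j - q\<close>
  consider "s = j" "r = j" | "s = j" "r = j - q" | "s = j - q" "r = j" | "s = j - q" "r = j - q" by blast
  then show "(\<Sum>a\<in>{j, j - q}. block_proj l V q \<epsilon> j t s a * Hhat l V q j t a r) = eig \<epsilon> j t * block_proj l V q \<epsilon> j t s r"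
  proof cases
    case 1 show ?thesis unfolding 1 sum2 H block_proj_entries
      using I'(1) by (simp only: mult.commute mult.left_commute mult.assoc)
  next
    case 2 show ?thesis unfolding 2 sum2 H block_proj_entries
      using I'(4) by (simp only: mult.commute mult.left_commute mult.assoc add.commute)
  next
    case 3 show ?thesis unfolding 3 sum2 H block_proj_entries
      using I'(3) by (simp only: mult.commute mult.left_commute mult.assoc)
  next
    case 4 show ?thesis unfolding 4 sum2 H block_proj_entries
      using I'(2) by (simp only: mult.commute mult.left_commute mult.assoc add.commute)
  qed
qed

text \<open>On the block each projection E satisfies (H - z) E = (\<lambda> - z) E and E (H - z) =
  (\<lambda> - z) E, and the two projections add up to the identity; hence the weighted sum inverts
  H - z on both sides.\<close>

lemma resolvent_eq:
  assumes e: "\<epsilon> \<in> {1, -1}"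
    and z: "z \<noteq> of_real (lambda_hat l V q \<epsilon> j t)" "z \<noteq> of_real (lambda_hat l V q (- \<epsilon>) j t)"
    and zm: "\<And>m. m \<notin> {j, j - q} \<Longrightarrow> z \<noteq> of_real (pnorm m t ^ (2 * l))"
  shows "resolvent l V q j t z = block_resolvent l V q \<epsilon> j t z"
  unfolding resolvent_def
proof (rule minverse_block[of "{j, j - q}"])
  define M where "M s r = Hhat l V q j t s r - z * mident s r" for s r
  define R where "R = block_resolvent l V q \<epsilon> j t z"
  have e': "- \<epsilon> \<in> {1, -1}" using e by auto
  show bM: "block_diagonal {j, j - q} (\<lambda>s r. Hhat l V q j t s r - z * mident s r)"
    by (auto simp: block_diagonal_def Hhat_eq mident_def)
  show bR: "block_diagonal {j, j - q} (block_resolvent l V q \<epsilon> j t z)"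
    by (auto simp: block_diagonal_def block_resolvent_def)
  have zz: "eig \<epsilon> j t - z \<noteq> 0" "eig (- \<epsilon>) j t - z \<noteq> 0"
    using z unfolding lambda_hat_eig by auto
  have R: "R s r = block_proj l V q \<epsilon> j t s r / (eig \<epsilon> j t - z) + block_proj l V q (- \<epsilon>) j t s r / (eig (- \<epsilon>) j t - z)"
    if "s \<in> {j, j - q}" "r \<in> {j, j - q}" for s r
    using that by (simp add: R_def block_resolvent_def lambda_hat_eig)
  have id: "(\<Sum>a\<in>{j, j - q}. mident s a * X a r) = X s r" "(\<Sum>a\<in>{j, j - q}. X r a * mident a s) = X r s"
    if "s \<in> {j, j - q}" for s r and X :: "'n matrix"
    using that jq by (auto simp: mident_def)
  have blk: "(\<Sum>a\<in>{j, j - q}. M s a * R a r) = mident s r" "(\<Sum>a\<in>{j, j - q}. R s a * M a r) = mident s r"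
    if s: "s \<in> {j, j - q}" and r: "r \<in> {j, j - q}" for s r
  proof -
    have ME: "(\<Sum>a\<in>{j, j - q}. M s a * block_proj l V q e j t a r) = (eig e j t - z) * block_proj l V q e j t s r"
      "(\<Sum>a\<in>{j, j - q}. block_proj l V q e j t s a * M a r) = (eig e j t - z) * block_proj l V q e j t s r"
      if "e \<in> {1, -1}" for e
    proof -
      have "(\<Sum>a\<in>{j, j - q}. M s a * block_proj l V q e j t a r)
        = (\<Sum>a\<in>{j, j - q}. Hhat l V q j t s a * block_proj l V q e j t a r)
          - z * (\<Sum>a\<in>{j, j - q}. mident s a * block_proj l V q e j t a r)"
        by (simp only: M_def sum_distrib_left sum_subtractf[symmetric] left_diff_distrib mult.assoc)
      then show "(\<Sum>a\<in>{j, j - q}. M s a * block_proj l V q e j t a r) = (eig e j t - z) * block_proj l V q e j t s r"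
        unfolding eig_block_proj[OF that s r] id(1)[OF s] by (simp add: left_diff_distrib)
      have "(\<Sum>a\<in>{j, j - q}. block_proj l V q e j t s a * M a r)
        = (\<Sum>a\<in>{j, j - q}. block_proj l V q e j t s a * Hhat l V q j t a r)
          - z * (\<Sum>a\<in>{j, j - q}. block_proj l V q e j t s a * mident a r)"
        by (simp only: M_def sum_distrib_left sum_subtractf[symmetric] right_diff_distrib mult.left_commute)
      then show "(\<Sum>a\<in>{j, j - q}. block_proj l V q e j t s a * M a r) = (eig e j t - z) * block_proj l V q e j t s r"
        unfolding eig_block_proj[OF that s r] id(2)[OF r] by (simp add: left_diff_distrib)
    qed
    have "(\<Sum>a\<in>{j, j - q}. M s a * R a r)
      = (\<Sum>a\<in>{j, j - q}. M s a * block_proj l V q \<epsilon> j t a r) / (eig \<epsilon> j t - z)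
      + (\<Sum>a\<in>{j, j - q}. M s a * block_proj l V q (- \<epsilon>) j t a r) / (eig (- \<epsilon>) j t - z)"
      unfolding sum_divide_distrib sum.distrib[symmetric]
      by (rule sum.cong) (simp_all add: R[OF _ r] distrib_left)
    then show "(\<Sum>a\<in>{j, j - q}. M s a * R a r) = mident s r"
      unfolding ME(1)[OF e] ME(1)[OF e'] using zz block_proj_complement[OF s r] by simp
    have "(\<Sum>a\<in>{j, j - q}. R s a * M a r)
      = (\<Sum>a\<in>{j, j - q}. block_proj l V q \<epsilon> j t s a * M a r) / (eig \<epsilon> j t - z)
      + (\<Sum>a\<in>{j, j - q}. block_proj l V q (- \<epsilon>) j t s a * M a r) / (eig (- \<epsilon>) j t - z)"
      unfolding sum_divide_distrib sum.distrib[symmetric]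
      by (rule sum.cong) (simp_all add: R[OF s] distrib_right)
    then show "(\<Sum>a\<in>{j, j - q}. R s a * M a r) = mident s r"
      unfolding ME(2)[OF e] ME(2)[OF e'] using zz block_proj_complement[OF s r] by simp
  qed
  have ins: "insert s (if s \<in> {j, j - q} then {j, j - q} else {}) = (if s \<in> {j, j - q} then {j, j - q} else {s})" for s
    by auto
  have off: "M s s * R s s = 1" if "s \<notin> {j, j - q}" for s
  proof -
    have "M s s = of_real (pnorm s t ^ (2 * l)) - z" by (simp add: M_def Hhat_eq mident_def)
    moreover have "R s s = 1 / (of_real (pnorm s t ^ (2 * l)) - z)" using that by (auto simp: R_def block_resolvent_def)
    ultimately show ?thesis using zm[OF that] by simp
  qed
  have bM': "block_diagonal {j, j - q} M" and bR': "block_diagonal {j, j - q} R"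
    using bM bR by (auto simp: M_def[abs_def] R_def)
  have zero: "M s r = 0 \<and> R s r = 0" if "s \<in> {j, j - q} \<longleftrightarrow> r \<notin> {j, j - q}" for s r
    using that bM' bR' unfolding block_diagonal_def by metis
  have MR: "mmul M R s r = mident s r" "mmul R M s r = mident s r" for s r
  proof -
    have "(\<Sum>a\<in>(if s \<in> {j, j - q} then {j, j - q} else {s}). M s a * R a r) = mident s r \<and>
        (\<Sum>a\<in>(if s \<in> {j, j - q} then {j, j - q} else {s}). R s a * M a r) = mident s r"
    proof (cases "s \<in> {j, j - q}")
      case True
      show ?thesis
      proof (cases "r \<in> {j, j - q}")
        case True
        then show ?thesis using \<open>s \<in> {j, j - q}\<close> blk[OF \<open>s \<in> {j, j - q}\<close> True] by presburger
      next
        case False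
        have "\<And>a. a \<in> {j, j - q} \<Longrightarrow> M a r = 0 \<and> R a r = 0" using zero False by blast
        then have "(\<Sum>a\<in>{j, j - q}. M s a * R a r) = 0" "(\<Sum>a\<in>{j, j - q}. R s a * M a r) = 0"
          by (intro sum.neutral; simp)+
        moreover have "mident s r = 0" using True False by (auto simp: mident_def)
        ultimately show ?thesis using True by presburger
      qed
    next
      case False
      have "M s s * R s r = mident s r \<and> R s s * M s r = mident s r"
      proof (cases "s = r")
        case True
        then show ?thesis using off[OF False] by (simp add: mident_def mult.commute)
      next
        case f: False
        then have "M s r = 0" "R s r = 0" using bM' bR' False unfolding block_diagonal_def by blast+
        then show ?thesis using f by (simp add: mident_def)
      qed
      then show ?thesis using False by simp
    qed
    then show "mmul M R s r = mident s r" "mmul R M s r = mident s r"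
      unfolding mmul_block_left[OF bM' finite.insertI[OF finite.insertI[OF finite.emptyI]]]
        mmul_block_left[OF bR' finite.insertI[OF finite.insertI[OF finite.emptyI]]] ins by blast+
  qed
  then show "mmul (\<lambda>s r. Hhat l V q j t s r - z * mident s r) (block_resolvent l V q \<epsilon> j t z) = mident"
    "mmul (block_resolvent l V q \<epsilon> j t z) (\<lambda>s r. Hhat l V q j t s r - z * mident s r) = mident"
    by (auto simp: M_def[abs_def] R_def fun_eq_iff)
qed simp

text \<open>A unit eigenvector is unique up to a unimodular factor, since its first entry and the
  first row of the equation determine it (\<open>v_q\<close> is nonzero). The rank-one matrix is
  therefore unique, and it only remains to write one eigenvector down.\<close>

lemma E_hat_eq:
  assumes e: "\<epsilon> \<in> {1, -1}"
  shows "E_hat l V q \<epsilon> j t = block_proj l V q \<epsilon> j t"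
  unfolding E_hat_def
proof (rule the_equality)
  define w g c where "w = width l V q j t" and "g = gap l q j t" and "c = sqrt ((1 + \<epsilon> * (g / w)) / 2)"
  have w: "w > 0" unfolding w_def by (rule width_pos)
  have w2: "w\<^sup>2 = 4 * (norm vq)\<^sup>2 + g\<^sup>2" unfolding w_def g_def by (rule width_square)
  have ee: "\<epsilon> * \<epsilon> = 1" using e by auto
  have gw: "\<bar>g\<bar> < w"
  proof -
    have "\<bar>g\<bar>\<^sup>2 < w\<^sup>2" using w2 Vq by simp
    then show ?thesis using w by (simp add: power2_less_imp_less)
  qed
  have gw1: "\<bar>\<epsilon> * (g / w)\<bar> < 1" using gw w e by (auto simp: abs_mult)
  have c: "c > 0" unfolding c_def using gw1 by (intro real_sqrt_gt_zero) (auto simp: abs_if split: if_splits)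
  have c2: "c * c = (1 + \<epsilon> * (g / w)) / 2"
    unfolding c_def using gw1 by (subst real_sqrt_mult_self) (auto simp: abs_if split: if_splits)
  \<comment> \<open>The product of the diagonal entries is |v_q|^2 / w^2, that is, the closed
    formula has determinant 0 on the block; this makes it rank one.\<close>
  have prod: "(1 + \<epsilon> * (g / w)) / 2 * ((1 - \<epsilon> * (g / w)) / 2) = (w\<^sup>2 - g\<^sup>2) / 4 / w\<^sup>2"
    using w ee by (simp add: field_simps power2_eq_square)
  have eigeq: "(\<forall>s. (\<Sum>\<^sub>\<infinity>r. Hhat l V q j t s r * x r) = of_real (lambda_hat l V q \<epsilon> j t) * x s) \<longleftrightarrow>
     of_real (pnorm j t ^ (2 * l)) * x j + vq * x (j - q) = of_real (lambda_hat l V q \<epsilon> j t) * x j \<and>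
     cnj vq * x j + of_real (pnorm (j - q) t ^ (2 * l)) * x (j - q) = of_real (lambda_hat l V q \<epsilon> j t) * x (j - q)"
    if x: "\<forall>s. s \<notin> {j, j - q} \<longrightarrow> x s = 0" for x
  proof -
    have sum: "(\<Sum>\<^sub>\<infinity>r. Hhat l V q j t s r * x r) = Hhat l V q j t s j * x j + Hhat l V q j t s (j - q) * x (j - q)" for s
      by (subst infsum_finite_support[of "{j, j - q}"]) (use x jq in auto)
    have 0: "Hhat l V q j t s j * x j + Hhat l V q j t s (j - q) * x (j - q) = of_real (lambda_hat l V q \<epsilon> j t) * x s"
      if "s \<notin> {j, j - q}" for s
      using that x by (auto simp: Hhat_eq)
    show ?thesis unfolding sum
    proof (intro iffI conjI allI)
      assume *: "\<forall>s. Hhat l V q j t s j * x j + Hhat l V q j t s (j - q) * x (j - q) = of_real (lambda_hat l V q \<epsilon> j t) * x s"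
      show "of_real (pnorm j t ^ (2 * l)) * x j + vq * x (j - q) = of_real (lambda_hat l V q \<epsilon> j t) * x j"
        using *[rule_format, of j] jq by (simp add: Hhat_eq)
      show "cnj vq * x j + of_real (pnorm (j - q) t ^ (2 * l)) * x (j - q) = of_real (lambda_hat l V q \<epsilon> j t) * x (j - q)"
        using *[rule_format, of "j - q"] jq by (simp add: Hhat_eq)
    next
      fix s
      assume "of_real (pnorm j t ^ (2 * l)) * x j + vq * x (j - q) = of_real (lambda_hat l V q \<epsilon> j t) * x j \<and>
        cnj vq * x j + of_real (pnorm (j - q) t ^ (2 * l)) * x (j - q) = of_real (lambda_hat l V q \<epsilon> j t) * x (j - q)"
      then show "Hhat l V q j t s j * x j + Hhat l V q j t s (j - q) * x (j - q) = of_real (lambda_hat l V q \<epsilon> j t) * x s"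
        using 0[of s] jq by (cases "s = j"; cases "s = j - q") (auto simp: Hhat_eq)
    qed
  qed
  have gd: "of_real (pnorm j t ^ (2 * l)) - of_real (pnorm (j - q) t ^ (2 * l)) = (of_real g :: complex)"
    by (simp add: g_def gap_def)
  note BP = block_proj_entries[of \<epsilon> j t, unfolded gd, folded w_def]
  note I = block_eigen_identities[OF complex_identities(1)[OF e, of j t] complex_identities(2)[OF e, of j t] complex_identities(3)[OF e], folded eig_def lambda_hat_eig, unfolded gd, folded w_def]
  \<comment> \<open>The column \<open>j\<close> of the projection divided by the square root
    \<open>c\<close> of its diagonal entry; \<open>c\<close> is positive because the gap is strictly
    smaller than the width.\<close>
  define x where "x s = (if s = j then of_real c else if s = j - q then of_real (\<epsilon> / (w * c)) * cnj vq else 0)" for s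
  have x1: "x j = of_real c" "x (j - q) = of_real (\<epsilon> / (w * c)) * cnj vq" using jq by (auto simp: x_def)
  have cc: "complex_of_real c * of_real c = (1 + of_real \<epsilon> * (of_real g / of_real w)) / 2"
    using arg_cong[OF c2, of complex_of_real] by simp
  have nx: "norm (x (j - q)) ^ 2 = (1 - \<epsilon> * (g / w)) / 2"
  proof -
    have "norm (x (j - q)) ^ 2 = (norm vq)\<^sup>2 / (w\<^sup>2 * (c * c))"
      unfolding x1 using e w c by (auto simp: norm_mult norm_divide power_mult_distrib power_divide power2_eq_square)
    also have "\<dots> = ((w\<^sup>2 - g\<^sup>2) / 4 / w\<^sup>2) / (c * c)" using w2 by simp
    also have "\<dots> = (1 - \<epsilon> * (g / w)) / 2"
      unfolding prod[symmetric] c2[symmetric] using c by simp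
    finally show ?thesis .
  qed
  have outer: "block_proj l V q \<epsilon> j t = (\<lambda>s r. x s * cnj (x r))"
  proof (intro ext)
    fix s r
    have 1: "x j * cnj (x j) = block_proj l V q \<epsilon> j t j j"
      unfolding x1 BP using cc by simp
    have 2: "x (j - q) * cnj (x (j - q)) = block_proj l V q \<epsilon> j t (j - q) (j - q)"
      unfolding BP using arg_cong[OF nx, of complex_of_real] by (simp add: complex_norm_square[symmetric])
    have 3: "x j * cnj (x (j - q)) = block_proj l V q \<epsilon> j t j (j - q)"
      "x (j - q) * cnj (x j) = block_proj l V q \<epsilon> j t (j - q) j"
      unfolding x1 BP using c w by (simp_all add: field_simps)
    show "block_proj l V q \<epsilon> j t s r = x s * cnj (x r)"
    proof (cases "s \<in> {j, j - q} \<and> r \<in> {j, j - q}")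
      case True
      then show ?thesis using 1 2 3 by auto
    next
      case False
      then show ?thesis by (auto simp: block_proj_def x_def)
    qed
  qed
  show "\<exists>x. (\<forall>s. s \<notin> {j, j - q} \<longrightarrow> x s = 0) \<and> (\<Sum>s\<in>{j, j - q}. (norm (x s))\<^sup>2) = 1 \<and>
      (\<forall>s. (\<Sum>\<^sub>\<infinity>r. Hhat l V q j t s r * x r) = of_real (lambda_hat l V q \<epsilon> j t) * x s) \<and>
      block_proj l V q \<epsilon> j t = (\<lambda>s r. x s * cnj (x r))"
  proof (intro exI conjI)
    show supp: "\<forall>s. s \<notin> {j, j - q} \<longrightarrow> x s = 0" by (simp add: x_def)
    have "norm (x j) ^ 2 = (1 + \<epsilon> * (g / w)) / 2"
      unfolding x1 using c2 by (simp add: power2_eq_square)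
    then show "(\<Sum>s\<in>{j, j - q}. (norm (x s))\<^sup>2) = 1" using jq nx by (simp add: field_simps)
    show "block_proj l V q \<epsilon> j t = (\<lambda>s r. x s * cnj (x r))" by (rule outer)
    have cn: "complex_of_real c \<noteq> 0" using c by simp
    show "\<forall>s. (\<Sum>\<^sub>\<infinity>r. Hhat l V q j t s r * x r) = of_real (lambda_hat l V q \<epsilon> j t) * x s"
      unfolding eigeq[OF supp]
    proof
      have o: "x s * of_real c = block_proj l V q \<epsilon> j t s j" for s
        using outer x1 by simp
      have "(of_real (pnorm j t ^ (2 * l)) * x j + vq * x (j - q)) * of_real c = of_real (lambda_hat l V q \<epsilon> j t) * x j * of_real c"
        unfolding distrib_right mult.assoc o BP using I(1) by (simp only: mult.assoc)
      then show "of_real (pnorm j t ^ (2 * l)) * x j + vq * x (j - q) = of_real (lambda_hat l V q \<epsilon> j t) * x j"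
        using cn by simp
      have "(cnj vq * x j + of_real (pnorm (j - q) t ^ (2 * l)) * x (j - q)) * of_real c = of_real (lambda_hat l V q \<epsilon> j t) * x (j - q) * of_real c"
        unfolding distrib_right mult.assoc o BP using I(4) by (simp only: mult.assoc add.commute)
      then show "cnj vq * x j + of_real (pnorm (j - q) t ^ (2 * l)) * x (j - q) = of_real (lambda_hat l V q \<epsilon> j t) * x (j - q)"
        using cn by simp
    qed
  qed
  fix E assume "\<exists>x. (\<forall>s. s \<notin> {j, j - q} \<longrightarrow> x s = 0) \<and> (\<Sum>s\<in>{j, j - q}. (norm (x s))\<^sup>2) = 1 \<and>
      (\<forall>s. (\<Sum>\<^sub>\<infinity>r. Hhat l V q j t s r * x r) = of_real (lambda_hat l V q \<epsilon> j t) * x s) \<and>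
      E = (\<lambda>s r. x s * cnj (x r))"
  then obtain y where y0: "\<forall>s. s \<notin> {j, j - q} \<longrightarrow> y s = 0" and y1: "(norm (y j))\<^sup>2 + (norm (y (j - q)))\<^sup>2 = 1"
    and y2: "of_real (pnorm j t ^ (2 * l)) * y j + vq * y (j - q) = of_real (lambda_hat l V q \<epsilon> j t) * y j"
    and Ey: "E = (\<lambda>s r. y s * cnj (y r))"
    using eigeq jq by (auto)
  txt \<open>By the first row of the eigenvalue equation, \<open>y\<close> is a multiple of \<open>x\<close>; normalization makes
    the factor unimodular.\<close>
  have x2: "of_real (pnorm j t ^ (2 * l)) * x j + vq * x (j - q) = of_real (lambda_hat l V q \<epsilon> j t) * x j"
  proof -
    have o: "x s * of_real c = block_proj l V q \<epsilon> j t s j" for s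
      using outer x1 by simp
    have "(of_real (pnorm j t ^ (2 * l)) * x j + vq * x (j - q)) * of_real c = of_real (lambda_hat l V q \<epsilon> j t) * x j * of_real c"
      unfolding distrib_right mult.assoc o BP using I(1) by (simp only: mult.assoc)
    then show ?thesis using c by simp
  qed
  define k where "k = y j / of_real c"
  have yj: "y j = k * x j" using c by (simp add: k_def x1)
  have "vq * y (j - q) = vq * (k * x (j - q))"
  proof -
    have vy: "vq * y (j - q) = (of_real (lambda_hat l V q \<epsilon> j t) - of_real (pnorm j t ^ (2 * l))) * y j"
      using y2 by (metis add_diff_cancel_left' left_diff_distrib)
    have vx: "vq * x (j - q) = (of_real (lambda_hat l V q \<epsilon> j t) - of_real (pnorm j t ^ (2 * l))) * x j"
      using x2 by (metis add_diff_cancel_left' left_diff_distrib)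
    show ?thesis unfolding vy yj mult.left_commute[of vq k] vx by (rule mult.left_commute)
  qed
  then have yk: "y (j - q) = k * x (j - q)" using Vq by simp
  have "(norm k)\<^sup>2 * ((norm (x j))\<^sup>2 + (norm (x (j - q)))\<^sup>2) = 1"
    using y1 unfolding yj yk norm_mult by (simp add: power_mult_distrib distrib_left)
  moreover have "(norm (x j))\<^sup>2 = (1 + \<epsilon> * (g / w)) / 2"
    unfolding x1 using c2 by (simp add: power2_eq_square)
  then have "(norm (x j))\<^sup>2 + (norm (x (j - q)))\<^sup>2 = 1" using nx by (simp add: field_simps)
  ultimately have "(norm k)\<^sup>2 = 1" by simp
  then have kk: "k * cnj k = 1" by (simp add: complex_norm_square[symmetric] of_real_power[symmetric] del: of_real_power)
  have "y s = k * x s" for s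
    using y0 yj yk by (cases "s = j"; cases "s = j - q") (auto simp: x_def)
  then show "E = block_proj l V q \<epsilon> j t"
    unfolding Ey outer using kk by (simp add: fun_eq_iff mult_ac)
qed

end

section \<open>The perturbation series\<close>

text \<open>Powers commute with conjugation by a diagonal matrix. Constant factors may be pulled out
  of \<open>infsum\<close> without summability, so no finiteness is asked for.\<close>

lemma mpow_conjugate:
  fixes T :: "'n::finite matrix" and om :: "'n lattice \<Rightarrow> complex"
  assumes om: "\<And>s. om s \<noteq> 0" and T: "\<And>s r. T s r = om r / om s * S s r"
  shows "mpow T n s r = om r / om s * mpow S n s r"
proof (induction n arbitrary: s r)
  case 0
  show ?case using om by (simp add: mident_def)
next
  case (Suc n)
  have "T s a * mpow T n a r = om r / om s * (S s a * mpow S n a r)" for a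
    unfolding T[of s a] Suc using om by (simp add: field_simps)
  then have "mpow T (Suc n) s r = (\<Sum>\<^sub>\<infinity>a. om r / om s * (S s a * mpow S n a r))"
    unfolding mpow.simps mmul_def by (rule infsum_cong)
  then show ?case unfolding mpow.simps mmul_def infsum_cmult_right' .
qed

context function_norm
begin

lemma nb_suminf': "nb (\<lambda>p. \<Sum>n. h n p) \<le> (\<Sum>n. nb (h n))"
  by (cases "(\<Sum>n. nb (h n)) < top") (auto simp: nb_suminf not_less top_unique)

lemma mn_suminf: "mn (\<lambda>p s r. \<Sum>n. T n p s r) \<le> (\<Sum>n. mn (T n))"
proof (rule mn_leI)
  fix s
  have "esum (\<lambda>r. nbm (\<lambda>p s r. \<Sum>n. T n p s r) s r) \<le> esum (\<lambda>r. \<Sum>n. nbm (T n) s r)"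
    unfolding nbm_def by (intro esum_mono nb_suminf')
  also have "\<dots> = (\<Sum>n. esum (\<lambda>r. nbm (T n) s r))" by (rule nn_integral_suminf) simp
  also have "\<dots> \<le> (\<Sum>n. mn (T n))" by (intro suminf_le row_le) auto
  finally show "esum (\<lambda>r. nbm (\<lambda>p s r. \<Sum>n. T n p s r) s r) \<le> (\<Sum>n. mn (T n))" .
  have "esum (\<lambda>r. nbm (\<lambda>p s r. \<Sum>n. T n p s r) r s) \<le> esum (\<lambda>r. \<Sum>n. nbm (T n) r s)"
    unfolding nbm_def by (intro esum_mono nb_suminf')
  also have "\<dots> = (\<Sum>n. esum (\<lambda>r. nbm (T n) r s))" by (rule nn_integral_suminf) simp
  also have "\<dots> \<le> (\<Sum>n. mn (T n))" by (intro suminf_le col_le) auto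
  finally show "esum (\<lambda>r. nbm (\<lambda>p s r. \<Sum>n. T n p s r) r s) \<le> (\<Sum>n. mn (T n))" .
qed

lemma esum_shift: "esum (\<lambda>r. g (s - r :: 'n::finite lattice)) = esum g" "esum (\<lambda>r. g (r - s)) = esum g"
  by (rule esum_bij, rule bijI', auto intro: exI[of _ "s - _"] exI[of _ "_ + s"])+

text \<open>Every row or column sum of the majorant is a reflected or translated copy of the sum of
  \<open>g\<close>. Multiplication by W has this form, so its matrix norm is controlled by the
  absolute sum of its Fourier coefficients.\<close>

lemma mn_toeplitz:
  fixes g :: "'n::finite lattice \<Rightarrow> ennreal"
  assumes "\<And>s r. nbm T s r \<le> g (s - r)"
  shows "mn T \<le> esum g"
proof (rule mn_leI)
  fix s
  show "esum (\<lambda>r. nbm T s r) \<le> esum g"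
    using esum_mono[of "nbm T s" "\<lambda>r. g (s - r)", OF assms] unfolding esum_shift .
  show "esum (\<lambda>r. nbm T r s) \<le> esum g"
    using esum_mono[of "\<lambda>r. nbm T r s" "\<lambda>r. g (r - s)", OF assms] unfolding esum_shift .
qed

lemma mn_block:
  assumes B: "finite B" "card B = 2"
    and "\<And>s r. nbm T s r \<le> (if s \<in> B \<and> r \<in> B \<or> s = r then c else 0)"
  shows "mn T \<le> 2 * c"
proof (rule mn_leI)
  fix s
  define F where "F = (if s \<in> B then B else {s})"
  have F: "finite F" "card F \<le> 2" using B by (auto simp: F_def)
  have "esum (\<lambda>r. if r \<in> F then c else 0) = (\<Sum>r\<in>F. c)"
    by (subst esum_finite_support[OF F(1)]) auto
  also have "\<dots> \<le> 2 * c" using F(2) by (auto simp: intro!: mult_right_mono)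
  finally have le: "esum (\<lambda>r. if r \<in> F then c else 0) \<le> 2 * c" .
  have a: "nbm T s r \<le> (if r \<in> F then c else 0)" for r
    using assms(3)[of s r] by (auto simp: F_def split: if_splits)
  have b: "nbm T r s \<le> (if r \<in> F then c else 0)" for r
    using assms(3)[of r s] by (auto simp: F_def split: if_splits)
  show "esum (\<lambda>r. nbm T s r) \<le> 2 * c"
    by (rule order_trans[OF esum_mono le]) (rule a)
  show "esum (\<lambda>r. nbm T r s) \<le> 2 * c"
    by (rule order_trans[OF esum_mono le]) (rule b)
qed

end

section \<open>Contour averages and families of potentials\<close>

context c1_norm
begin

definition avg :: "((real ^ 'n) \<times> real \<Rightarrow> complex) \<Rightarrow> real ^ 'n \<Rightarrow> complex" where
  "avg f t = integral {0..1} (\<lambda>\<theta>. f (t, \<theta>))"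

lemma nb_avg: "nb (\<lambda>p. avg f (fst p)) \<le> nb f"
  unfolding avg_def by (rule nb_integral)

lemma fst_D: "p \<in> D \<Longrightarrow> fst p \<in> U" "t \<in> U \<Longrightarrow> \<theta> \<in> {0..1} \<Longrightarrow> (t, \<theta>) \<in> D"
  by (auto simp: D_def)

lemma avg_integrable:
  assumes "nb f < top" "t \<in> U"
  shows "(\<lambda>\<theta>. f (t, \<theta>)) integrable_on {0..1}"
proof (rule integrable_continuous_real)
  show "continuous_on {0..1} (\<lambda>\<theta>. f (t, \<theta>))"
    by (rule continuous_on_compose2[OF nb_continuous[OF assms(1)]])
       (use assms(2) in \<open>auto simp: D_def intro!: continuous_intros\<close>)
qed

lemma avg_diff:
  assumes "nb f < top" "nb g < top" "t \<in> U"
  shows "avg (\<lambda>p. f p - g p) t = avg f t - avg g t"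
  unfolding avg_def by (intro integral_diff avg_integrable assms)

lemma nb_theta_only:
  assumes "continuous_on {0..1} g" "\<And>\<theta>. \<theta> \<in> {0..1} \<Longrightarrow> norm (g \<theta>) \<le> c" "0 \<le> c"
  shows "nb (\<lambda>p. g (snd p)) \<le> ennreal c"
proof -
  have "has_t_derivative (\<lambda>p. g (snd p)) (\<lambda>_. 0)"
    unfolding has_t_derivative_def
  proof (intro conjI ballI)
    show "continuous_on D (\<lambda>p. g (snd p))"
      by (rule continuous_on_compose2[OF assms(1)]) (auto simp: D_def intro!: continuous_intros)
  qed (auto simp: zero_blinfun.rep_eq)
  then have "nb (\<lambda>p. g (snd p)) \<le> ennreal (c + 0)"
    by (rule nb_leI) (use assms in \<open>auto simp: D_def\<close>)
  then show ?thesis by simp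
qed

text \<open>The norm \<open>star_norm\<close> for a whole family of potentials, given by its Fourier
  coefficients at each t, with the C^1 norm of a coefficient in place of its modulus.\<close>

definition vn :: "(real ^ 'n \<Rightarrow> 'n lattice \<Rightarrow> complex) \<Rightarrow> ennreal" where
  "vn w = esum (\<lambda>m. nb (\<lambda>p. w (fst p) m))"

end

locale perturbation = c1_norm U \<rho> + resonant_potential l V q
  for U :: "(real ^ 'n::finite) set" and \<rho> :: real and l :: nat and V :: "'n potential" and q +
  fixes \<epsilon> :: real and j :: "'n lattice" and \<kappa> cR :: real
  assumes eps: "\<epsilon> \<in> {1, -1}" and kappa: "\<kappa> \<ge> 1" and cR: "cR \<ge> 0"
begin

abbreviation "B \<equiv> {j, j - q}"

definition rad :: real where "rad = circle_radius V q"

definition circ :: "real \<Rightarrow> complex" where "circ \<theta> = of_real rad * exp (2 * of_real pi * \<i> * of_real \<theta>)"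

definition zf :: "(real ^ 'n) \<times> real \<Rightarrow> complex" where
  "zf p = of_real (lambda_hat l V q \<epsilon> j (fst p)) + circ (snd p)"

definition Rf :: "(real ^ 'n) \<times> real \<Rightarrow> 'n matrix" where
  "Rf p = block_resolvent l V q \<epsilon> j (fst p) (zf p)"

end

text \<open>What the series needs from the resolvent, separated from the proof of these bounds.
  \<open>off_spectrum\<close> concerns the disk of twice the radius and not only the circle:
  Cauchy's theorem is applied there.\<close>

locale perturbation_bounds = perturbation U \<rho> l V q \<epsilon> j \<kappa> cR
  for U :: "(real ^ 'n::finite) set" and \<rho> :: real and l :: nat and V :: "'n potential" and q
    and \<epsilon> :: real and j :: "'n lattice" and \<kappa> cR :: real +
  assumes R_block: "\<And>s r. s \<in> B \<Longrightarrow> r \<in> B \<Longrightarrow> nb (\<lambda>p. Rf p s r) \<le> ennreal cR"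
    and R_off: "\<And>s. s \<notin> B \<Longrightarrow> nb (\<lambda>p. Rf p s s) \<le> ennreal (cR / \<kappa>\<^sup>2)"
    and other_eigenvalue: "\<And>p. p \<in> D \<Longrightarrow> zf p \<noteq> of_real (lambda_hat l V q (- \<epsilon>) j (fst p))"
    and off_spectrum: "\<And>t s (z :: complex). t \<in> U \<Longrightarrow> s \<notin> B \<Longrightarrow> norm (z - of_real (lambda_hat l V q \<epsilon> j t)) < 2 * rad \<Longrightarrow>
      rad \<le> norm (of_real (pnorm s t ^ (2 * l)) - z)"
begin

lemma finB: "finite B" "card B = 2" using jq by auto

lemma rad_pos: "rad > 0" using Vq by (simp add: rad_def circle_radius_def)

lemma norm_circ [simp]: "norm (circ \<theta>) = rad"
proof -
  have "norm (exp (2 * of_real pi * \<i> * of_real \<theta>)) = 1" by (simp add: norm_exp_eq_Re)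
  then show ?thesis using rad_pos by (simp add: circ_def norm_mult)
qed

lemma nb_circ: "nb (\<lambda>p. circ (snd p)) \<le> ennreal rad"
proof (rule nb_theta_only)
  show "continuous_on {0..1} circ" unfolding circ_def[abs_def] by (intro continuous_intros)
qed (use rad_pos in simp_all)

lemma resolvent_Rf:
  assumes "p \<in> D"
  shows "resolvent l V q j (fst p) (zf p) = Rf p"
  unfolding Rf_def
proof (rule resolvent_eq[OF eps])
  show "zf p \<noteq> of_real (lambda_hat l V q \<epsilon> j (fst p))"
  proof
    assume "zf p = of_real (lambda_hat l V q \<epsilon> j (fst p))"
    then have "circ (snd p) = 0" by (simp add: zf_def)
    then show False using norm_circ[of "snd p"] rad_pos by simp
  qed
  show "zf p \<noteq> of_real (lambda_hat l V q (- \<epsilon>) j (fst p))" by (rule other_eigenvalue[OF assms])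
  fix m assume m: "m \<notin> B"
  have "norm (zf p - of_real (lambda_hat l V q \<epsilon> j (fst p))) < 2 * rad"
    using rad_pos by (simp add: zf_def)
  from off_spectrum[OF fst_D(1)[OF assms] m this] show "zf p \<noteq> of_real (pnorm m (fst p) ^ (2 * l))"
    using rad_pos by auto
qed

section \<open>Conjugation by weights\<close>

definition om :: "'n lattice \<Rightarrow> complex" where "om s = (if s \<in> B then 1 else of_real \<kappa>)"

definition al :: "'n lattice \<Rightarrow> complex" where "al s = (if s \<in> B then 1 else of_real (1 / \<kappa>))"

definition Yf :: "(real ^ 'n \<Rightarrow> 'n lattice \<Rightarrow> complex) \<Rightarrow> (real ^ 'n) \<times> real \<Rightarrow> 'n matrix" where
  "Yf w p s r = w (fst p) (s - r) - PVP V q j s r"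

text \<open>With \<Omega> = diag(\<open>om\<close>), which commutes with R, the conjugated matrix
  \<Omega> R Y \<Omega>^(-1) factors as (\<Omega>^2 R)(\<Omega>^(-1) Y \<Omega>^(-1)). The first
  factor is O(1) since R has size \<kappa>^(-2) off the block; all smallness is in the
  second.\<close>

definition R_scaled :: "(real ^ 'n) \<times> real \<Rightarrow> 'n matrix" where
  "R_scaled p s r = (om s)\<^sup>2 * Rf p s r"

definition Y_scaled :: "(real ^ 'n \<Rightarrow> 'n lattice \<Rightarrow> complex) \<Rightarrow> (real ^ 'n) \<times> real \<Rightarrow> 'n matrix" where
  "Y_scaled w p s r = al s * al r * Yf w p s r"

text \<open>The resolvent at the right end of a term of the series absorbs one weight: (R Y)^n R =
  \<Omega>^(-1) (\<Omega> R Y \<Omega>^(-1))^n (\<Omega> R).\<close>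

definition R_half :: "(real ^ 'n) \<times> real \<Rightarrow> 'n matrix" where
  "R_half p s r = om s * Rf p s r"

definition RY :: "(real ^ 'n \<Rightarrow> 'n lattice \<Rightarrow> complex) \<Rightarrow> (real ^ 'n) \<times> real \<Rightarrow> 'n matrix" where
  "RY w p = mmul (R_scaled p) (Y_scaled w p)"

lemma om_nz: "om s \<noteq> 0" and om_al: "om s * al s = 1" using kappa by (auto simp: om_def al_def)

lemma Rf_diagonal: "s \<noteq> r \<Longrightarrow> \<not> (s \<in> B \<and> r \<in> B) \<Longrightarrow> Rf p s r = 0"
  by (auto simp: Rf_def block_resolvent_def)

lemma Rf_om: "om s * Rf p s r = om r * Rf p s r"
  using Rf_diagonal[of s r p] by (auto simp: om_def)

text \<open>Conjugating by the weights \<open>om\<close> balances the two off-diagonal blocks, of orders 1 and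
  $\kappa^{-2}$, to the common order $\kappa^{-1}$.\<close>

lemma RY_conjugate: "mmul (Rf p) (Yf w p) s r = om r / om s * RY w p s r"
proof -
  have "R_scaled p s a * Y_scaled w p a r = om s / om r * (Rf p s a * Yf w p a r)" for a
  proof -
    have "R_scaled p s a * Y_scaled w p a r = om s * (om s * Rf p s a) * (al a * al r * Yf w p a r)"
      by (simp add: R_scaled_def Y_scaled_def power2_eq_square mult.assoc)
    also have "\<dots> = om s * (om a * al a) * al r * (Rf p s a * Yf w p a r)"
      unfolding Rf_om by (simp add: mult_ac)
    also have "al r = 1 / om r" using om_al[of r] om_nz[of r] by (simp add: field_simps)
    finally show ?thesis by (simp add: om_al)
  qed
  then have "RY w p s r = (\<Sum>\<^sub>\<infinity>a. om s / om r * (Rf p s a * Yf w p a r))"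
    unfolding RY_def mmul_def by (rule infsum_cong)
  then have "RY w p s r = om s / om r * mmul (Rf p) (Yf w p) s r"
    unfolding mmul_def infsum_cmult_right' .
  then show ?thesis using om_nz by (simp add: field_simps)
qed

lemma mpow_RY: "mpow (mmul (Rf p) (Yf w p)) n s r = om r / om s * mpow (RY w p) n s r"
  by (rule mpow_conjugate[OF om_nz RY_conjugate])

lemma mpow_RY_R:
  "mmul (mpow (mmul (Rf p) (Yf w p)) n) (Rf p) s r = 1 / om s * mmul (mpow (RY w p) n) (R_half p) s r"
proof -
  have "mpow (mmul (Rf p) (Yf w p)) n s a * Rf p a r = 1 / om s * (mpow (RY w p) n s a * R_half p a r)" for a
    unfolding mpow_RY R_half_def by simp
  then have "mmul (mpow (mmul (Rf p) (Yf w p)) n) (Rf p) s r = (\<Sum>\<^sub>\<infinity>a. 1 / om s * (mpow (RY w p) n s a * R_half p a r))"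
    unfolding mmul_def[of "mpow _ _"] by (rule infsum_cong)
  then show ?thesis unfolding mmul_def[of "mpow _ _"] infsum_cmult_right' .
qed

lemma norm_om: "norm (om s) = (if s \<in> B then 1 else \<kappa>)" "norm (al s) \<le> 1" "norm (1 / om s) \<le> 1"
  using kappa by (auto simp: om_def al_def norm_divide)

text \<open>The decay \<kappa>^(-2) off the block pays for up to two weights. The cases k = 2 and k
  = 1 serve \<open>R_scaled\<close> and \<open>R_half\<close>.\<close>

lemma nbm_Rf: "nbm (\<lambda>p s r. om s ^ k * Rf p s r) s r \<le> (if s \<in> B \<and> r \<in> B \<or> s = r then ennreal cR else 0)"
  if "k \<le> 2"
proof -
  have *: "nbm (\<lambda>p s r. om s ^ k * Rf p s r) s r \<le> ennreal (norm (om s) ^ k) * nb (\<lambda>p. Rf p s r)"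
    unfolding nbm_def norm_power[symmetric] by (rule nb_cmult)
  consider "s \<in> B" "r \<in> B" | "s \<notin> B" "s = r" | "s \<noteq> r" "\<not> (s \<in> B \<and> r \<in> B)" by blast
  then show ?thesis
  proof cases
    case 1
    then show ?thesis using * R_block[of s r] by (auto simp: norm_om)
  next
    case 2
    have k: "\<kappa> ^ k \<le> \<kappa>\<^sup>2" using that kappa by (simp add: power_increasing)
    have "nbm (\<lambda>p s r. om s ^ k * Rf p s r) s r \<le> ennreal (\<kappa> ^ k) * ennreal (cR / \<kappa>\<^sup>2)"
    proof -
      have "nb (\<lambda>p. Rf p s r) \<le> ennreal (cR / \<kappa>\<^sup>2)" using R_off[OF 2(1)] 2(2) by simp
      from order_trans[OF * mult_left_mono[OF this zero_le]] show ?thesis using 2(1) by (simp add: norm_om)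
    qed
    also have "\<dots> = ennreal (\<kappa> ^ k * (cR / \<kappa>\<^sup>2))"
      using kappa cR by (intro ennreal_mult[symmetric]) auto
    also have "\<dots> \<le> ennreal cR"
    proof (rule ennreal_leI)
      have "\<kappa> ^ k * (cR / \<kappa>\<^sup>2) \<le> \<kappa>\<^sup>2 * (cR / \<kappa>\<^sup>2)"
        by (rule mult_right_mono[OF k]) (use cR in simp)
      then show "\<kappa> ^ k * (cR / \<kappa>\<^sup>2) \<le> cR" using kappa by simp
    qed
    finally show ?thesis using 2 by simp
  next
    case 3
    then show ?thesis unfolding nbm_def using Rf_diagonal[of s r] by simp
  qed
qed

lemma mn_R_scaled: "mn R_scaled \<le> 2 * ennreal cR"
  by (rule mn_block[OF finB]) (use nbm_Rf[of 2] in \<open>simp add: R_scaled_def[abs_def]\<close>)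

lemma mn_R_half: "mn R_half \<le> 2 * ennreal cR"
  by (rule mn_block[OF finB]) (use nbm_Rf[of 1] in \<open>simp add: R_half_def[abs_def]\<close>)

lemma al_al: "\<not> (s \<in> B \<and> r \<in> B) \<Longrightarrow> norm (al s * al r) \<le> 1 / \<kappa>"
proof -
  assume a: "\<not> (s \<in> B \<and> r \<in> B)"
  have "1 / \<kappa> * (1 / \<kappa>) \<le> 1 / \<kappa>"
    by (rule mult_left_le) (use kappa in auto)
  then show ?thesis using a kappa by (auto simp: al_def norm_mult norm_divide)
qed

text \<open>Inside the block Y is W - V, because the block of V was subtracted; this part is small
  by the smallness of the coupling. Every other entry carries at least one weight
  1/\<kappa>.\<close>

lemma mn_Y_scaled: "mn (Y_scaled w) \<le> vn (\<lambda>t m. w t m - fourier_coeff V m) + ennreal (1 / \<kappa>) * vn w"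
proof -
  define g where "g m = nb (\<lambda>p. w (fst p) m - fourier_coeff V m) + ennreal (1 / \<kappa>) * nb (\<lambda>p. w (fst p) m)" for m
  have "mn (Y_scaled w) \<le> esum g"
  proof (rule mn_toeplitz)
    fix s r
    show "nbm (Y_scaled w) s r \<le> g (s - r)"
    proof (cases "s \<in> B \<and> r \<in> B")
      case True
      then have "nbm (Y_scaled w) s r = nb (\<lambda>p. w (fst p) (s - r) - fourier_coeff V (s - r))"
        unfolding nbm_def Y_scaled_def Yf_def PVP_eq al_def by simp
      then show ?thesis by (simp add: g_def)
    next
      case False
      then have "PVP V q j s r = 0" unfolding PVP_eq by auto
      then have "nbm (Y_scaled w) s r = nb (\<lambda>p. (al s * al r) * w (fst p) (s - r))"
        unfolding nbm_def Y_scaled_def Yf_def by simp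
      also have "\<dots> \<le> ennreal (norm (al s * al r)) * nb (\<lambda>p. w (fst p) (s - r))" by (rule nb_cmult)
      also have "\<dots> \<le> ennreal (1 / \<kappa>) * nb (\<lambda>p. w (fst p) (s - r))"
        by (intro mult_right_mono ennreal_leI al_al[OF False]) simp
      also have "\<dots> \<le> g (s - r)" by (simp add: g_def)
      finally show ?thesis .
    qed
  qed
  then show ?thesis unfolding g_def vn_def esum_add esum_cmult .
qed

lemma mn_Y_scaled_diff: "mn (\<lambda>p s r. Y_scaled w p s r - Y_scaled w' p s r) \<le> vn (\<lambda>t m. w t m - w' t m)"
  unfolding vn_def
proof (rule mn_toeplitz)
  fix s r
  have "nbm (\<lambda>p s r. Y_scaled w p s r - Y_scaled w' p s r) s r = nb (\<lambda>p. (al s * al r) * (w (fst p) (s - r) - w' (fst p) (s - r)))"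
    unfolding nbm_def Y_scaled_def Yf_def by (simp add: algebra_simps)
  also have "\<dots> \<le> ennreal (norm (al s * al r)) * nb (\<lambda>p. w (fst p) (s - r) - w' (fst p) (s - r))" by (rule nb_cmult)
  also have "\<dots> \<le> ennreal 1 * nb (\<lambda>p. w (fst p) (s - r) - w' (fst p) (s - r))"
    by (intro mult_right_mono ennreal_leI) (auto simp: norm_mult intro!: mult_le_one norm_om)
  finally show "nbm (\<lambda>p s r. Y_scaled w p s r - Y_scaled w' p s r) s r \<le> nb (\<lambda>p. w (fst p) (s - r) - w' (fst p) (s - r))" by simp
qed

definition eta :: "(real ^ 'n \<Rightarrow> 'n lattice \<Rightarrow> complex) \<Rightarrow> ennreal" where
  "eta w = 2 * ennreal cR * (vn (\<lambda>t m. w t m - fourier_coeff V m) + ennreal (1 / \<kappa>) * vn w)"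

lemma mn_RY: "mn (RY w) \<le> eta w"
  unfolding eta_def RY_def by (rule order_trans[OF mn_mmul]) (intro mult_mono mn_R_scaled mn_Y_scaled; simp)

lemma Y_scaled_finite: "vn w < top \<Longrightarrow> vn (\<lambda>t m. w t m - fourier_coeff V m) < top \<Longrightarrow> mn (Y_scaled w) < top"
  by (rule le_less_trans[OF mn_Y_scaled]) (simp add: ennreal_mult_less_top)

lemma R_scaled_finite: "mn R_scaled < top"
  by (rule le_less_trans[OF mn_R_scaled]) (simp add: ennreal_mult_less_top)

lemma R_half_finite: "mn R_half < top"
  by (rule le_less_trans[OF mn_R_half]) (simp add: ennreal_mult_less_top)

lemma mn_RY_diff:
  assumes "mn (Y_scaled w) < top" "mn (Y_scaled w') < top"
  shows "mn (\<lambda>p s r. RY w p s r - RY w' p s r) \<le> 2 * ennreal cR * vn (\<lambda>t m. w t m - w' t m)"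
proof -
  have "mn (\<lambda>p s r. RY w p s r - RY w' p s r) = mn (\<lambda>p. mmul (R_scaled p) (\<lambda>s r. Y_scaled w p s r - Y_scaled w' p s r))"
    unfolding RY_def by (rule mn_cong) (simp add: mmul_diff_right[OF R_scaled_finite assms])
  also have "\<dots> \<le> mn R_scaled * mn (\<lambda>p s r. Y_scaled w p s r - Y_scaled w' p s r)" by (rule mn_mmul)
  also have "\<dots> \<le> 2 * ennreal cR * vn (\<lambda>t m. w t m - w' t m)"
    by (intro mult_mono mn_R_scaled mn_Y_scaled_diff) auto
  finally show ?thesis .
qed

section \<open>The projection series\<close>

definition Gf :: "(real ^ 'n \<Rightarrow> 'n lattice \<Rightarrow> complex) \<Rightarrow> nat \<Rightarrow> (real ^ 'n) \<times> real \<Rightarrow> 'n matrix" where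
  "Gf w n p s r = (-1) ^ (n + 1) * (circ (snd p) * (1 / om s * mmul (mpow (RY w p) n) (R_half p) s r))"

definition Epert :: "(real ^ 'n \<Rightarrow> 'n lattice \<Rightarrow> complex) \<Rightarrow> real ^ 'n \<Rightarrow> 'n matrix" where
  "Epert w t s r = (\<Sum>n. avg (\<lambda>p. Gf w (Suc n) p s r) t)"

lemma nb_sign_circ:
  "nb (\<lambda>p. (-1) ^ k * (circ (snd p) * f p)) \<le> ennreal rad * nb f"
proof -
  have "nb (\<lambda>p. (-1) ^ k * (circ (snd p) * f p)) \<le> ennreal (norm ((-1 :: complex) ^ k)) * nb (\<lambda>p. circ (snd p) * f p)"
    by (rule nb_cmult)
  also have "norm ((-1 :: complex) ^ k) = 1" by (simp add: norm_power)
  also have "ennreal 1 * nb (\<lambda>p. circ (snd p) * f p) \<le> ennreal rad * nb f"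
    by simp (rule order_trans[OF nb_mult mult_right_mono[OF nb_circ zero_le]])
  finally show ?thesis .
qed

lemma mn_circ_om:
  "mn (\<lambda>p s r. (-1) ^ k * (circ (snd p) * (1 / om s * M p s r))) \<le> ennreal rad * mn M"
proof (rule mn_weighted_mono)
  fix s r
  have "nbm (\<lambda>p s r. (-1) ^ k * (circ (snd p) * (1 / om s * M p s r))) s r
      \<le> ennreal rad * nb (\<lambda>p. 1 / om s * M p s r)"
    unfolding nbm_def by (rule nb_sign_circ)
  also have "\<dots> \<le> ennreal rad * (ennreal 1 * nb (\<lambda>p. M p s r))"
    by (intro mult_left_mono order_trans[OF nb_cmult] mult_right_mono ennreal_leI norm_om) auto
  finally show "nbm (\<lambda>p s r. (-1) ^ k * (circ (snd p) * (1 / om s * M p s r))) s r \<le> ennreal rad * nbm M s r"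
    by (simp add: nbm_def)
qed

lemma mn_avg: "mn (\<lambda>p s r. avg (\<lambda>p. M p s r) (fst p)) \<le> mn M"
  by (rule mn_mono) (simp add: nbm_def nb_avg)

lemma mn_Gf: "mn (Gf w n) \<le> ennreal rad * (eta w ^ n * (2 * ennreal cR))"
proof -
  have "mn (Gf w n) \<le> ennreal rad * mn (\<lambda>p. mmul (mpow (RY w p) n) (R_half p))"
    unfolding Gf_def[abs_def] by (rule mn_circ_om)
  also have "\<dots> \<le> ennreal rad * (eta w ^ n * (2 * ennreal cR))"
    by (intro mult_left_mono order_trans[OF mn_mmul] mult_mono mn_mpow_le mn_RY mn_R_half) auto
  finally show ?thesis .
qed

lemma mn_Gf_diff:
  assumes eta: "eta w \<le> c" "eta w' \<le> c" "c < top" and Y_scaled: "mn (Y_scaled w) < top" "mn (Y_scaled w') < top"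
  shows "mn (\<lambda>p s r. Gf w n p s r - Gf w' n p s r)
    \<le> ennreal rad * (of_nat n * c ^ (n - 1) * (2 * ennreal cR * vn (\<lambda>t m. w t m - w' t m)) * (2 * ennreal cR))"
proof -
  have T: "mn (RY w) \<le> c" "mn (RY w') \<le> c" using mn_RY eta order_trans by blast+
  have fin: "mn (\<lambda>p. mpow (RY w p) n) < top" "mn (\<lambda>p. mpow (RY w' p) n) < top"
    using mn_mpow_le[OF T(1), of n] mn_mpow_le[OF T(2), of n] eta(3)
    by (simp_all add: order_le_less_trans power_less_top_ennreal)
  have "mn (\<lambda>p s r. Gf w n p s r - Gf w' n p s r)
      = mn (\<lambda>p s r. (-1) ^ (n + 1) * (circ (snd p) * (1 / om s * mmul (\<lambda>s r. mpow (RY w p) n s r - mpow (RY w' p) n s r) (R_half p) s r)))"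
    by (rule mn_cong) (simp add: Gf_def mmul_diff_left[OF fin R_half_finite] algebra_simps)
  also have "\<dots> \<le> ennreal rad * mn (\<lambda>p. mmul (\<lambda>s r. mpow (RY w p) n s r - mpow (RY w' p) n s r) (R_half p))"
    by (rule mn_circ_om)
  also have "\<dots> \<le> ennreal rad * (of_nat n * c ^ (n - 1) * (2 * ennreal cR * vn (\<lambda>t m. w t m - w' t m)) * (2 * ennreal cR))"
    by (intro mult_left_mono order_trans[OF mn_mmul] mult_mono mn_mpow_diff[OF T eta(3)] mn_RY_diff[OF Y_scaled] mn_R_half) auto
  finally show ?thesis .
qed

end

lemma ennreal_geometric:
  assumes "0 \<le> c" "c \<le> 1 / 2"
  shows "(\<Sum>n. ennreal c ^ Suc n) \<le> ennreal (2 * c)"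
proof -
  have s: "(\<lambda>n. c * c ^ n) sums (c * (1 / (1 - c)))"
    using assms by (intro sums_mult geometric_sums) auto
  have "(\<Sum>n. ennreal c ^ Suc n) = (\<Sum>n. ennreal (c * c ^ n))"
    using assms by (simp add: ennreal_power ennreal_mult)
  also have "\<dots> = ennreal (c * (1 / (1 - c)))"
    using s assms by (intro suminf_ennreal_eq) auto
  also have "\<dots> \<le> ennreal (2 * c)"
  proof (rule ennreal_leI)
    have "1 / (1 - c) \<le> 2" using assms by (simp add: field_simps)
    from mult_left_mono[OF this assms(1)] show "c * (1 / (1 - c)) \<le> 2 * c" by (simp only: mult.commute)
  qed
  finally show ?thesis .
qed

text \<open>Termwise comparison with c = 1/2, where the sum is (1 - c)^(-2) = 4.\<close>

lemma ennreal_geometric_deriv: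
  assumes "0 \<le> c" "c \<le> 1 / 2"
  shows "(\<Sum>n. of_nat (Suc n) * ennreal c ^ n) \<le> ennreal 4"
proof -
  have "(\<Sum>n. of_nat (Suc n) * ennreal c ^ n) \<le> (\<Sum>n. ennreal (of_nat (Suc n) * (1 / 2) ^ n))"
  proof (intro suminf_le summableI)
    fix n
    have "of_nat (Suc n) * ennreal c ^ n = ennreal (of_nat (Suc n) * c ^ n)"
      using assms by (simp add: ennreal_power ennreal_mult ennreal_of_nat_eq_real_of_nat del: of_nat_Suc)
    also have "\<dots> \<le> ennreal (of_nat (Suc n) * (1 / 2) ^ n)"
      using assms by (intro ennreal_leI mult_left_mono power_mono) auto
    finally show "of_nat (Suc n) * ennreal c ^ n \<le> ennreal (of_nat (Suc n) * (1 / 2) ^ n)" .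
  qed
  also have "\<dots> = ennreal 4"
  proof (rule suminf_ennreal_eq)
    show "(\<lambda>n. of_nat (Suc n) * (1 / 2 :: real) ^ n) sums 4"
      using geometric_deriv_sums[of "1 / 2 :: real"] by (simp add: power2_eq_square)
  qed simp
  finally show ?thesis .
qed

lemma contour_integral_circlepath_exp:
  "contour_integral (circlepath z r) f
    = 2 * of_real pi * \<i> * integral {0..1} (\<lambda>\<theta>. r * exp (2 * of_real pi * \<i> * of_real \<theta>) * f (circlepath z r \<theta>))"
proof -
  have "contour_integral (circlepath z r) f
      = integral {0..1} (\<lambda>\<theta>. (2 * of_real pi * \<i>) * (r * exp (2 * of_real pi * \<i> * of_real \<theta>) * f (circlepath z r \<theta>)))"
    unfolding contour_integral_integral vector_derivative_circlepath by (simp add: mult_ac)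
  then show ?thesis by (simp only: integral_mult_right)
qed

context perturbation_bounds
begin

context
  fixes w :: "real ^ 'n \<Rightarrow> 'n lattice \<Rightarrow> complex" and c :: real
  assumes c: "0 \<le> c" "c \<le> 1 / 2" and eta: "eta w \<le> ennreal c"
begin

lemma sum_mn_Gf: "(\<Sum>n. mn (Gf w (Suc n))) \<le> ennreal (4 * rad * cR * c)"
proof -
  have "mn (Gf w (Suc n)) \<le> ennreal (2 * rad * cR) * ennreal c ^ Suc n" for n
  proof -
    have "mn (Gf w (Suc n)) \<le> ennreal rad * (eta w ^ Suc n * (2 * ennreal cR))" by (rule mn_Gf)
    also have "\<dots> \<le> ennreal rad * (ennreal c ^ Suc n * (2 * ennreal cR))"
      by (intro mult_left_mono mult_right_mono power_mono eta) auto
    also have "\<dots> = ennreal (2 * rad * cR) * ennreal c ^ Suc n"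
      using rad_pos cR by (simp add: ennreal_mult mult_ac)
    finally show ?thesis .
  qed
  then have "(\<Sum>n. mn (Gf w (Suc n))) \<le> (\<Sum>n. ennreal (2 * rad * cR) * ennreal c ^ Suc n)"
    by (intro suminf_le summableI) auto
  also have "\<dots> = ennreal (2 * rad * cR) * (\<Sum>n. ennreal c ^ Suc n)" by (rule ennreal_suminf_cmult)
  also have "\<dots> \<le> ennreal (2 * rad * cR) * ennreal (2 * c)"
    by (rule mult_left_mono[OF ennreal_geometric[OF c]]) simp
  also have "\<dots> = ennreal (4 * rad * cR * c)"
    using rad_pos cR c by (simp add: ennreal_mult[symmetric] mult_ac)
  finally show ?thesis .
qed

lemma mn_Epert: "mn (\<lambda>p. Epert w (fst p)) \<le> ennreal (4 * rad * cR * c)"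
proof -
  have "mn (\<lambda>p. Epert w (fst p)) \<le> (\<Sum>n. mn (\<lambda>p s r. avg (\<lambda>p. Gf w (Suc n) p s r) (fst p)))"
    unfolding Epert_def[abs_def] by (rule mn_suminf)
  also have "\<dots> \<le> (\<Sum>n. mn (Gf w (Suc n)))" by (intro suminf_le mn_avg) auto
  finally show ?thesis using sum_mn_Gf by (rule order_trans)
qed

lemma nb_Gf_finite: "nb (\<lambda>p. Gf w (Suc n) p s r) < top"
proof -
  have "nbm (Gf w (Suc n)) s r \<le> mn (Gf w (Suc n))" by (rule entry_le)
  also have "\<dots> < top"
    by (rule ennreal_suminf_lessD[where f = "\<lambda>n. mn (Gf w (Suc n))"]) (rule le_less_trans[OF sum_mn_Gf], simp)
  finally show ?thesis by (simp add: nbm_def)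
qed

text \<open>\<open>suminf\<close> may be subtracted termwise only for convergent series; this is
  needed to compare two potentials.\<close>

lemma summable_avg_Gf:
  assumes "t \<in> U"
  shows "summable (\<lambda>n. avg (\<lambda>p. Gf w (Suc n) p s r) t)"
proof (rule uniform_limit_usup_series(2)[where D = U])
  have "usup U (avg (\<lambda>p. Gf w (Suc n) p s r)) \<le> mn (Gf w (Suc n))" for n
  proof (rule usup_leI)
    fix t assume "t \<in> U"
    then have "ennreal (norm (avg (\<lambda>p. Gf w (Suc n) p s r) (fst (t, 0::real)))) \<le> nb (\<lambda>p. avg (\<lambda>p. Gf w (Suc n) p s r) (fst p))"
      by (intro nb_pt[of _ "\<lambda>p. avg (\<lambda>p. Gf w (Suc n) p s r) (fst p)"]) (simp add: D_def)
    also have "\<dots> \<le> nbm (Gf w (Suc n)) s r" unfolding nbm_def by (rule nb_avg)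
    also have "\<dots> \<le> mn (Gf w (Suc n))" by (rule entry_le)
    finally show "ennreal (norm (avg (\<lambda>p. Gf w (Suc n) p s r) t)) \<le> mn (Gf w (Suc n))" by simp
  qed
  then have "(\<Sum>n. usup U (avg (\<lambda>p. Gf w (Suc n) p s r))) \<le> (\<Sum>n. mn (Gf w (Suc n)))"
    by (intro suminf_le) auto
  also have "\<dots> < top" by (rule le_less_trans[OF sum_mn_Gf]) simp
  finally show "(\<Sum>n. usup U (avg (\<lambda>p. Gf w (Suc n) p s r))) < top" .
qed (rule assms)

end

text \<open>The constant is \<open>rad\<close> for the contour, 2 \<open>cR\<close> for the last
  resolvent, 2 \<open>cR\<close> for the Lipschitz bound of \<open>RY\<close>, and 4 for the sum of
  (n+1) c^n.\<close>

lemma mn_Epert_diff: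
  assumes c: "0 \<le> c" "c \<le> 1 / 2" and eta: "eta w \<le> ennreal c" "eta w' \<le> ennreal c"
    and Y_scaled: "mn (Y_scaled w) < top" "mn (Y_scaled w') < top"
  shows "mn (\<lambda>p s r. Epert w (fst p) s r - Epert w' (fst p) s r)
    \<le> ennreal (16 * rad * cR\<^sup>2) * vn (\<lambda>t m. w t m - w' t m)"
proof -
  let ?d = "vn (\<lambda>t m. w t m - w' t m)"
  have "mn (\<lambda>p s r. Epert w (fst p) s r - Epert w' (fst p) s r)
    = mn (\<lambda>p s r. \<Sum>n. avg (\<lambda>p. Gf w (Suc n) p s r - Gf w' (Suc n) p s r) (fst p))"
  proof (rule mn_cong)
    fix p s r assume "p \<in> D"
    then have p: "fst p \<in> U" by (rule fst_D)
    show "Epert w (fst p) s r - Epert w' (fst p) s r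
      = (\<Sum>n. avg (\<lambda>p. Gf w (Suc n) p s r - Gf w' (Suc n) p s r) (fst p))"
      unfolding Epert_def avg_diff[OF nb_Gf_finite[OF c eta(1)] nb_Gf_finite[OF c eta(2)] p]
      by (rule suminf_diff[OF summable_avg_Gf[OF c eta(1) p] summable_avg_Gf[OF c eta(2) p]])
  qed
  also have "\<dots> \<le> (\<Sum>n. mn (\<lambda>p s r. avg (\<lambda>p. Gf w (Suc n) p s r - Gf w' (Suc n) p s r) (fst p)))"
    by (rule mn_suminf)
  also have "\<dots> \<le> (\<Sum>n. ennreal (4 * rad * cR\<^sup>2) * ?d * (of_nat (Suc n) * ennreal c ^ n))"
  proof (intro suminf_le summableI)
    fix n
    have "mn (\<lambda>p s r. avg (\<lambda>p. Gf w (Suc n) p s r - Gf w' (Suc n) p s r) (fst p))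
        \<le> mn (\<lambda>p s r. Gf w (Suc n) p s r - Gf w' (Suc n) p s r)" by (rule mn_avg)
    also have "\<dots> \<le> ennreal rad * (of_nat (Suc n) * ennreal c ^ (Suc n - 1) * (2 * ennreal cR * ?d) * (2 * ennreal cR))"
      by (rule mn_Gf_diff[OF eta _ Y_scaled]) simp
    also have "\<dots> = (ennreal rad * (2 * ennreal cR) * (2 * ennreal cR)) * ?d * (of_nat (Suc n) * ennreal c ^ n)"
      by (simp only: diff_Suc_1 mult_ac)
    also have "ennreal rad * (2 * ennreal cR) * (2 * ennreal cR) = ennreal (4 * rad * cR\<^sup>2)"
      using rad_pos cR by (simp add: ennreal_mult[symmetric] ennreal_numeral[symmetric] power2_eq_square mult_ac del: ennreal_numeral)
    finally show "mn (\<lambda>p s r. avg (\<lambda>p. Gf w (Suc n) p s r - Gf w' (Suc n) p s r) (fst p))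
       \<le> ennreal (4 * rad * cR\<^sup>2) * ?d * (of_nat (Suc n) * ennreal c ^ n)" .
  qed
  also have "\<dots> = ennreal (4 * rad * cR\<^sup>2) * ?d * (\<Sum>n. of_nat (Suc n) * ennreal c ^ n)"
    by (rule ennreal_suminf_cmult)
  also have "\<dots> \<le> ennreal (4 * rad * cR\<^sup>2) * ?d * ennreal 4"
    by (rule mult_left_mono[OF ennreal_geometric_deriv[OF c]]) simp
  also have "\<dots> = (ennreal (4 * rad * cR\<^sup>2) * ennreal 4) * ?d" by (simp only: mult_ac)
  also have "ennreal (4 * rad * cR\<^sup>2) * ennreal 4 = ennreal (16 * rad * cR\<^sup>2)"
    using rad_pos by (subst ennreal_mult[symmetric]) auto
  finally show ?thesis .
qed

section \<open>The given series as contour averages\<close>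

lemma contour_zf: "circlepath (of_real (lambda_hat l V q \<epsilon> j t)) rad \<theta> = zf (t, \<theta>)"
  by (simp add: circlepath_def zf_def circ_def) (simp add: part_circlepath_def linepath_def exp_eq_polar mult_ac)

lemma contour_integral_contour:
  "contour_integral (contour l V q \<epsilon> j t) f = 2 * of_real pi * \<i> * integral {0..1} (\<lambda>\<theta>. circ \<theta> * f (zf (t, \<theta>)))"
  unfolding contour_def rad_def[symmetric] contour_integral_circlepath_exp contour_zf circ_def ..

lemma Ymat_eq:
  assumes "fourier_coeff W = w t"
  shows "Ymat V q j W = Yf w (t, \<theta>)"
  using assms by (simp add: Ymat_def[abs_def] Yf_def[abs_def] mult_matrix_def)

text \<open>On the circle dz/(2 \<pi> i) equals \<open>circ \<theta>\<close> d\<theta>, which is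
  where the factor \<open>circ\<close> in \<open>Gf\<close> comes from. Only the Fourier
  coefficients of W at the given t enter.\<close>

lemma G_term_eq:
  assumes W: "fourier_coeff W = w t" and t: "t \<in> U"
  shows "G_term l V q \<epsilon> j t W n s r = avg (\<lambda>p. Gf w n p s r) t"
proof -
  have cancel: "a / k * (k * b) = a * b" if "k \<noteq> 0" for a b k :: complex using that by simp
  have "integral {0..1} (\<lambda>\<theta>. circ \<theta> * mmul (mpow (mmul (resolvent l V q j t (zf (t, \<theta>))) (Ymat V q j W)) n) (resolvent l V q j t (zf (t, \<theta>))) s r)
      = integral {0..1} (\<lambda>\<theta>. circ \<theta> * (1 / om s * mmul (mpow (RY w (t, \<theta>)) n) (R_half (t, \<theta>)) s r))"
  proof (rule integral_cong)
    fix \<theta> :: real assume "\<theta> \<in> {0..1}"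
    then have "resolvent l V q j t (zf (t, \<theta>)) = Rf (t, \<theta>)"
      using resolvent_Rf[OF fst_D(2)[OF t]] by fastforce
    then show "circ \<theta> * mmul (mpow (mmul (resolvent l V q j t (zf (t, \<theta>))) (Ymat V q j W)) n) (resolvent l V q j t (zf (t, \<theta>))) s r
       = circ \<theta> * (1 / om s * mmul (mpow (RY w (t, \<theta>)) n) (R_half (t, \<theta>)) s r)"
      by (simp only: Ymat_eq[of W w t \<theta>, OF W] mpow_RY_R)
  qed
  then have "G_term l V q \<epsilon> j t W n s r
     = (-1) ^ (n + 1) * integral {0..1} (\<lambda>\<theta>. circ \<theta> * (1 / om s * mmul (mpow (RY w (t, \<theta>)) n) (R_half (t, \<theta>)) s r))"
    unfolding G_term_def contour_integral_contour
    using cancel[of "2 * of_real pi * \<i>"] by (simp only:) simp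
  then show ?thesis unfolding avg_def Gf_def snd_conv integral_mult_right .
qed

lemma E_W_eq:
  assumes W: "fourier_coeff W = w t" and t: "t \<in> U"
  shows "E_W l V q \<epsilon> j t W s r = block_proj l V q \<epsilon> j t s r + Epert w t s r"
  unfolding E_W_def E_hat_eq[OF eps] Epert_def G_term_eq[of W w, OF assms] ..

text \<open>The compressed power is subtracted although its contour integral is 0: the sum over s of
  the original diagonal entries is not controlled by \<open>mn\<close>, while the difference is
  controlled by \<open>tn\<close>.\<close>

definition gpert :: "(real ^ 'n \<Rightarrow> 'n lattice \<Rightarrow> complex) \<Rightarrow> nat \<Rightarrow> real ^ 'n \<Rightarrow> complex" where
  "gpert w n t = (\<Sum>\<^sub>\<infinity>s. (-1) ^ n / of_nat n *
     avg (\<lambda>p. circ (snd p) * (mpow (RY w p) n s s - mpow (compress B (RY w p)) n s s)) t)"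

text \<open>After deletion of the block only the scalar resolvents with index off the block remain.
  By \<open>off_spectrum\<close> they are holomorphic on the disk of radius 2 \<open>rad\<close>,
  hence so are the entries of all powers, and the integral over the circle is 0.\<close>

lemma compressed_trace_vanishes:
  assumes t: "t \<in> U" and Y_scaled: "mn (Y_scaled w) < top"
  shows "avg (\<lambda>p. circ (snd p) * mpow (compress B (RY w p)) n s s) t = 0"
proof -
  define S where "S = ball (complex_of_real (lambda_hat l V q \<epsilon> j t)) (2 * rad)"
  interpret H: function_norm S "hol_nb S" by (rule function_norm_hol_nb) (simp add: S_def)
  define h where "h z s = of_real (\<kappa>\<^sup>2) / (of_real (pnorm s t ^ (2 * l)) - z)" for z :: complex and s :: "'n lattice"
  \<comment> \<open>The compressed matrix as a function of z. The perturbation does not depend on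
    \<theta>, so it is frozen at \<theta> = 0; only the resolvent factor \<open>h\<close>
    varies.\<close>
  define Tz where "Tz z s r = (if s \<in> B \<or> r \<in> B then 0 else h z s * Y_scaled w (t, 0) s r)" for z s r
  have zS: "rad \<le> norm (of_real (pnorm s t ^ (2 * l)) - z)" if "z \<in> S" "s \<notin> B" for z s
    using off_spectrum[OF t that(2), of z] that(1) by (simp add: S_def dist_norm norm_minus_commute)
  have comp: "compress B (RY w (t, \<theta>)) = Tz (zf (t, \<theta>))" for \<theta>
  proof (intro ext)
    fix s r
    show "compress B (RY w (t, \<theta>)) s r = Tz (zf (t, \<theta>)) s r"
    proof (cases "s \<in> B \<or> r \<in> B")
      case False
      have "RY w (t, \<theta>) s r = (\<Sum>a\<in>{s}. R_scaled (t, \<theta>) s a * Y_scaled w (t, \<theta>) a r)"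
        unfolding RY_def mmul_def
        by (rule infsum_finite_support) (use False Rf_diagonal[of s _ "(t, \<theta>)"] in \<open>auto simp: R_scaled_def\<close>)
      also have "\<dots> = h (zf (t, \<theta>)) s * Y_scaled w (t, 0) s r"
        using False by (auto simp: R_scaled_def om_def Rf_def block_resolvent_def h_def Y_scaled_def Yf_def)
      finally show ?thesis using False by (simp add: Tz_def compress_def)
    qed (auto simp: Tz_def compress_def)
  qed
  have nbmz: "H.nbm Tz s r \<le> ennreal (\<kappa>\<^sup>2 / rad) * nbm (Y_scaled w) s r" for s r
  proof (cases "s \<in> B \<or> r \<in> B")
    case True
    then show ?thesis unfolding H.nbm_def Tz_def by simp
  next
    case False
    have "hol_nb S (\<lambda>z. h z s) \<le> ennreal (\<kappa>\<^sup>2 / rad)"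
    proof -
      have "(\<lambda>z. h z s) holomorphic_on S"
        unfolding h_def using zS[of _ s] False rad_pos by (intro holomorphic_intros) force+
      moreover have "norm (h z s) \<le> \<kappa>\<^sup>2 / rad" if "z \<in> S" for z
        using zS[OF that, of s] False rad_pos unfolding h_def
        by (auto simp: norm_divide norm_power intro!: divide_left_mono mult_pos_pos)
      ultimately show ?thesis unfolding hol_nb_def by (auto intro!: usup_leI ennreal_leI)
    qed
    moreover have "hol_nb S (\<lambda>z. Y_scaled w (t, 0) s r) \<le> nbm (Y_scaled w) s r"
      using H.nb_const[of "Y_scaled w (t, 0) s r"] nb_pt[OF fst_D(2)[OF t], of 0 "\<lambda>p. Y_scaled w p s r"]
      unfolding nbm_def by (auto intro: order_trans)
    ultimately have "hol_nb S (\<lambda>z. h z s) * hol_nb S (\<lambda>z. Y_scaled w (t, 0) s r) \<le> ennreal (\<kappa>\<^sup>2 / rad) * nbm (Y_scaled w) s r"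
      by (intro mult_mono) auto
    then show ?thesis
      using False H.nb_mult[of "\<lambda>z. h z s" "\<lambda>z. Y_scaled w (t, 0) s r"] unfolding H.nbm_def Tz_def by simp
  qed
  \<comment> \<open>A bound of order \<kappa>^2 is very crude, but only finiteness matters here: it
    is what yields holomorphy.\<close>
  have "H.mn Tz \<le> ennreal (\<kappa>\<^sup>2 / rad) * mn (Y_scaled w)"
  proof (rule H.mn_leI)
    fix s
    have "esum (\<lambda>r. H.nbm Tz s r) \<le> ennreal (\<kappa>\<^sup>2 / rad) * esum (\<lambda>r. nbm (Y_scaled w) s r)"
      unfolding esum_cmult[symmetric] by (intro esum_mono nbmz)
    also have "\<dots> \<le> ennreal (\<kappa>\<^sup>2 / rad) * mn (Y_scaled w)" by (intro mult_left_mono row_le) simp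
    finally show "esum (\<lambda>r. H.nbm Tz s r) \<le> ennreal (\<kappa>\<^sup>2 / rad) * mn (Y_scaled w)" .
    have "esum (\<lambda>r. H.nbm Tz r s) \<le> ennreal (\<kappa>\<^sup>2 / rad) * esum (\<lambda>r. nbm (Y_scaled w) r s)"
      unfolding esum_cmult[symmetric] by (intro esum_mono nbmz)
    also have "\<dots> \<le> ennreal (\<kappa>\<^sup>2 / rad) * mn (Y_scaled w)" by (intro mult_left_mono col_le) simp
    finally show "esum (\<lambda>r. H.nbm Tz r s) \<le> ennreal (\<kappa>\<^sup>2 / rad) * mn (Y_scaled w)" .
  qed
  also have "\<dots> < top" using Y_scaled by (simp add: ennreal_mult_less_top)
  finally have "H.mn (\<lambda>z. mpow (Tz z) n) < top"
    using H.mn_mpow[of Tz n] by (simp add: order_le_less_trans power_less_top_ennreal)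
  then have "hol_nb S (\<lambda>z. mpow (Tz z) n s s) < top"
    using H.entry_le[of "\<lambda>z. mpow (Tz z) n" s s] by (simp add: H.nbm_def order_le_less_trans)
  then have hol: "(\<lambda>z. mpow (Tz z) n s s) holomorphic_on S"
    by (auto simp: hol_nb_def split: if_splits)
  have "((\<lambda>z. mpow (Tz z) n s s) has_contour_integral 0) (contour l V q \<epsilon> j t)"
  proof (rule Cauchy_theorem_convex_simple[OF hol])
    show "convex S" by (simp add: S_def)
    show "path_image (contour l V q \<epsilon> j t) \<subseteq> S"
      using rad_pos by (auto simp: contour_def rad_def[symmetric] S_def dist_norm norm_minus_commute)
  qed (simp_all add: contour_def)
  then have "contour_integral (contour l V q \<epsilon> j t) (\<lambda>z. mpow (Tz z) n s s) = 0"
    by (rule contour_integral_unique)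
  then show ?thesis
    unfolding contour_integral_contour avg_def comp by (simp add: snd_conv)
qed

lemma nb_circ_mult_finite: "nb f < top \<Longrightarrow> nb (\<lambda>p. circ (snd p) * f p) < top"
  using order_trans[OF nb_mult mult_right_mono[OF nb_circ zero_le]]
  by (rule le_less_trans) (simp add: ennreal_mult_less_top)

lemma mpow_entry_finite: "mn T < top \<Longrightarrow> nb (\<lambda>p. mpow (T p) n s r) < top"
  using entry_le[of "\<lambda>p. mpow (T p) n" s r] mn_mpow[of T n]
  by (simp add: nbm_def order_le_less_trans power_less_top_ennreal)

lemma g_term_eq:
  assumes W: "fourier_coeff W = w t" and t: "t \<in> U" and Y_scaled: "mn (Y_scaled w) < top" and n: "n > 0"
  shows "g_term l V q \<epsilon> j t W n = gpert w n t"
proof -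
  have T: "mn (RY w) < top"
    unfolding RY_def by (rule le_less_trans[OF mn_mmul]) (simp add: ennreal_mult_less_top R_scaled_finite Y_scaled)
  then have Tc: "mn (\<lambda>p. compress B (RY w p)) < top" using mn_compress le_less_trans by blast
  have "contour_integral (contour l V q \<epsilon> j t) (\<lambda>z. mpow (mmul (resolvent l V q j t z) (Ymat V q j W)) n s s)
     = 2 * of_real pi * \<i> * avg (\<lambda>p. circ (snd p) * (mpow (RY w p) n s s - mpow (compress B (RY w p)) n s s)) t" for s
  proof -
    have "integral {0..1} (\<lambda>\<theta>. circ \<theta> * mpow (mmul (resolvent l V q j t (zf (t, \<theta>))) (Ymat V q j W)) n s s)
      = integral {0..1} (\<lambda>\<theta>. circ \<theta> * mpow (RY w (t, \<theta>)) n s s)"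
    proof (rule integral_cong)
      fix \<theta> :: real assume "\<theta> \<in> {0..1}"
      then have "resolvent l V q j t (zf (t, \<theta>)) = Rf (t, \<theta>)"
        using resolvent_Rf[OF fst_D(2)[OF t]] by fastforce
      \<comment> \<open>On the diagonal the conjugating weights cancel, so the trace of the
        conjugated power is the original one.\<close>
      then show "circ \<theta> * mpow (mmul (resolvent l V q j t (zf (t, \<theta>))) (Ymat V q j W)) n s s = circ \<theta> * mpow (RY w (t, \<theta>)) n s s"
        using divide_self[OF om_nz[of s]] by (simp only: Ymat_eq[of W w t \<theta>, OF W] mpow_RY mult_1)
    qed
    also have "\<dots> = avg (\<lambda>p. circ (snd p) * mpow (RY w p) n s s) t" by (simp add: avg_def)
    also have "\<dots> = avg (\<lambda>p. circ (snd p) * mpow (RY w p) n s s) t - avg (\<lambda>p. circ (snd p) * mpow (compress B (RY w p)) n s s) t"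
      unfolding compressed_trace_vanishes[OF t Y_scaled] by simp
    also have "\<dots> = avg (\<lambda>p. circ (snd p) * mpow (RY w p) n s s - circ (snd p) * mpow (compress B (RY w p)) n s s) t"
      by (intro avg_diff[symmetric] nb_circ_mult_finite mpow_entry_finite T Tc t)
    finally show ?thesis unfolding contour_integral_contour by (simp add: right_diff_distrib)
  qed
  then have "g_term l V q \<epsilon> j t W n = (-1) ^ n / (2 * of_real pi * \<i> * of_nat n) *
    (\<Sum>\<^sub>\<infinity>s. 2 * of_real pi * \<i> * avg (\<lambda>p. circ (snd p) * (mpow (RY w p) n s s - mpow (compress B (RY w p)) n s s)) t)"
    unfolding g_term_def mtrace_def by simp
  also have "\<dots> = (-1) ^ n / (2 * of_real pi * \<i> * of_nat n) * (2 * of_real pi * \<i> *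
    (\<Sum>\<^sub>\<infinity>s. avg (\<lambda>p. circ (snd p) * (mpow (RY w p) n s s - mpow (compress B (RY w p)) n s s)) t))"
    by (simp only: infsum_cmult_right')
  also have "\<dots> = (-1) ^ n / of_nat n *
    (\<Sum>\<^sub>\<infinity>s. avg (\<lambda>p. circ (snd p) * (mpow (RY w p) n s s - mpow (compress B (RY w p)) n s s)) t)"
    using n by simp
  finally show ?thesis unfolding gpert_def infsum_cmult_right' .
qed

text \<open>The 1/n in front of the trace cancels the n from the difference of powers; the factor 4
  counts the two rows and two columns of the block.\<close>

lemma nb_gpert:
  assumes eta: "eta w \<le> ennreal c" and n: "n > 0"
  shows "nb (\<lambda>p. gpert w n (fst p)) \<le> ennreal (4 * rad) * ennreal c ^ n"
proof -
  define Dn where "Dn p s r = mpow (RY w p) n s r - mpow (compress B (RY w p)) n s r" for p s r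
  have T: "mn (RY w) \<le> ennreal c" using mn_RY eta order_trans by blast
  have tnD: "tn Dn \<le> 4 * (of_nat n * ennreal c ^ n)"
    unfolding Dn_def[abs_def] using tn_compress_mpow_diff[OF finB(1) T, of n] finB(2) by simp
  have "nb (\<lambda>p. gpert w n (fst p)) \<le> esum (\<lambda>s. nb (\<lambda>p. (-1) ^ n / of_nat n * avg (\<lambda>p. circ (snd p) * Dn p s s) (fst p)))"
    unfolding gpert_def Dn_def by (rule nb_infsum)
  also have "\<dots> \<le> esum (\<lambda>s. ennreal (1 / of_nat n) * (ennreal rad * nbm Dn s s))"
  proof (rule esum_mono)
    fix s
    have "nb (\<lambda>p. (-1) ^ n / of_nat n * avg (\<lambda>p. circ (snd p) * Dn p s s) (fst p))
      \<le> ennreal (norm ((-1) ^ n / of_nat n :: complex)) * nb (\<lambda>p. avg (\<lambda>p. circ (snd p) * Dn p s s) (fst p))"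
      by (rule nb_cmult)
    also have "norm ((-1) ^ n / of_nat n :: complex) = 1 / of_nat n" by (simp add: norm_divide norm_power)
    also have "ennreal (1 / of_nat n) * nb (\<lambda>p. avg (\<lambda>p. circ (snd p) * Dn p s s) (fst p))
       \<le> ennreal (1 / of_nat n) * (ennreal rad * nbm Dn s s)"
      unfolding nbm_def
      by (intro mult_left_mono order_trans[OF nb_avg] order_trans[OF nb_mult] mult_right_mono nb_circ) auto
    finally show "nb (\<lambda>p. (-1) ^ n / of_nat n * avg (\<lambda>p. circ (snd p) * Dn p s s) (fst p))
       \<le> ennreal (1 / of_nat n) * (ennreal rad * nbm Dn s s)" .
  qed
  also have "\<dots> = ennreal (1 / of_nat n) * (ennreal rad * esum (\<lambda>s. nbm Dn s s))"
    by (simp only: esum_cmult)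
  also have "esum (\<lambda>s. nbm Dn s s) \<le> tn Dn" unfolding tn_def by (intro esum_mono le_esum)
  also note tnD
  also have "ennreal (1 / of_nat n) * (ennreal rad * (4 * (of_nat n * ennreal c ^ n)))
      = (ennreal (1 / of_nat n) * of_nat n) * (ennreal rad * 4) * ennreal c ^ n" by (simp only: mult_ac)
  also have "ennreal (1 / of_nat n) * of_nat n = 1"
    using n by (simp add: ennreal_of_nat_eq_real_of_nat ennreal_mult[symmetric])
  also have "ennreal rad * 4 = ennreal (4 * rad)"
    using rad_pos by (simp add: ennreal_mult mult.commute)
  finally show ?thesis by (simp add: mult_left_mono)
qed

definition Lpert :: "(real ^ 'n \<Rightarrow> 'n lattice \<Rightarrow> complex) \<Rightarrow> real ^ 'n \<Rightarrow> complex" where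
  "Lpert w t = (\<Sum>n. gpert w (Suc n) t)"

lemma lambda_W_eq:
  assumes "fourier_coeff W = w t" "t \<in> U" "mn (Y_scaled w) < top"
  shows "lambda_W l V q \<epsilon> j t W = of_real (lambda_hat l V q \<epsilon> j t) + Lpert w t"
  unfolding lambda_W_def Lpert_def g_term_eq[of W w, OF assms zero_less_Suc] ..

lemma nb_Lpert:
  assumes c: "0 \<le> c" "c \<le> 1 / 2" and eta: "eta w \<le> ennreal c"
  shows "nb (\<lambda>p. Lpert w (fst p)) \<le> ennreal (8 * rad * c)"
proof -
  have "nb (\<lambda>p. Lpert w (fst p)) \<le> (\<Sum>n. nb (\<lambda>p. gpert w (Suc n) (fst p)))"
    unfolding Lpert_def by (rule nb_suminf')
  also have "\<dots> \<le> (\<Sum>n. ennreal (4 * rad) * ennreal c ^ Suc n)"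
    by (intro suminf_le nb_gpert eta) auto
  also have "\<dots> = ennreal (4 * rad) * (\<Sum>n. ennreal c ^ Suc n)" by (rule ennreal_suminf_cmult)
  also have "\<dots> \<le> ennreal (4 * rad) * ennreal (2 * c)"
    by (rule mult_left_mono[OF ennreal_geometric[OF c]]) simp
  also have "\<dots> = ennreal (8 * rad * c)"
    using rad_pos c by (simp add: ennreal_mult[symmetric])
  finally show ?thesis .
qed

end

section \<open>The fixed point\<close>

context function_norm
begin

lemma nb_suminf_summable:
  assumes "(\<Sum>n. nb (h n)) < top" "p \<in> dom"
  shows "summable (\<lambda>n. h n p)"
proof (rule summable_norm_cancel, rule summable_suminf_not_top)
  have "(\<Sum>n. ennreal (norm (h n p))) \<le> (\<Sum>n. nb (h n))"
    by (intro suminf_le nb_pt assms) auto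
  then show "(\<Sum>n. ennreal (norm (h n p))) \<noteq> top" using assms(1) by (auto simp: top_unique)
qed simp

end

section \<open>Convolution of coefficient families and passage to gradients\<close>

context c1_norm
begin

lemma vn_cong: "(\<And>t m. t \<in> U \<Longrightarrow> w t m = w' t m) \<Longrightarrow> vn w = vn w'"
  unfolding vn_def by (intro nn_integral_cong nb_cong) (auto simp: D_def)

lemma vn_add: "vn (\<lambda>t m. w t m + w' t m) \<le> vn w + vn w'"
  unfolding vn_def esum_add[symmetric] by (intro esum_mono nb_add)

lemma vn_diff: "vn (\<lambda>t m. w t m - w' t m) \<le> vn w + vn w'"
  unfolding vn_def esum_add[symmetric] by (intro esum_mono nb_diff)

lemma vn_cmult: "vn (\<lambda>t m. k * w t m) \<le> ennreal (norm k) * vn w"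
  unfolding vn_def esum_cmult[symmetric] by (intro esum_mono nb_cmult)

lemma vn_suminf: "vn (\<lambda>t m. \<Sum>n. h n t m) \<le> (\<Sum>n. vn (h n))"
proof -
  have "vn (\<lambda>t m. \<Sum>n. h n t m) \<le> esum (\<lambda>m. \<Sum>n. nb (\<lambda>p. h n (fst p) m))"
    unfolding vn_def by (intro esum_mono nb_suminf')
  also have "\<dots> = (\<Sum>n. vn (h n))" unfolding vn_def by (rule nn_integral_suminf) simp
  finally show ?thesis .
qed

lemma nb_le_vn: "nb (\<lambda>p. w (fst p) m) \<le> vn w"
  unfolding vn_def by (rule le_esum)

lemma vn_pt: "t \<in> U \<Longrightarrow> ennreal (norm (w t m)) \<le> nb (\<lambda>p. w (fst p) m)"
  using nb_pt[of "(t, 0)" "\<lambda>p. w (fst p) m"] by (simp add: D_def)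

lemma esum_le_vn: "t \<in> U \<Longrightarrow> esum (\<lambda>m. ennreal (norm (w t m))) \<le> vn w"
  unfolding vn_def by (intro esum_mono vn_pt)

lemma vn_summable: "vn w < top \<Longrightarrow> t \<in> U \<Longrightarrow> (\<lambda>m. norm (w t m)) summable_on UNIV"
  by (rule esum_norm_summable) (rule le_less_trans[OF esum_le_vn])

text \<open>Fourier coefficients of the product of the first function with the conjugate of the
  second; on the diagonal this is the autocorrelation of \<open>tser_abs_square\<close>.\<close>

definition conv ::
  "(real ^ 'n \<Rightarrow> 'n lattice \<Rightarrow> complex) \<Rightarrow> (real ^ 'n \<Rightarrow> 'n lattice \<Rightarrow> complex) \<Rightarrow> real ^ 'n \<Rightarrow> 'n lattice \<Rightarrow> complex" where
  "conv f g t m = (\<Sum>\<^sub>\<infinity>s. f t (s + m) * cnj (g t s))"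

text \<open>Young's inequality for absolutely summable sequences, with coefficients in a
  submultiplicative norm that conjugation does not increase.\<close>

lemma vn_conv: "vn (conv f g) \<le> vn f * vn g"
proof -
  have "vn (conv f g) \<le> esum (\<lambda>m. esum (\<lambda>s. nb (\<lambda>p. f (fst p) (s + m)) * nb (\<lambda>p. g (fst p) s)))"
    unfolding vn_def conv_def
    by (intro esum_mono order_trans[OF nb_infsum] order_trans[OF nb_mult] mult_left_mono nb_cnj) auto
  also have "\<dots> = esum (\<lambda>s. esum (\<lambda>m. nb (\<lambda>p. f (fst p) (s + m))) * nb (\<lambda>p. g (fst p) s))"
    by (subst esum_swap) (simp add: esum_multc)
  also have "(\<lambda>s. esum (\<lambda>m. nb (\<lambda>p. f (fst p) (s + m)))) = (\<lambda>s. vn f)"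
    unfolding vn_def by (rule ext, rule esum_bij) (auto intro!: bijI' exI[of _ "_ - _"])
  also have "esum (\<lambda>s. vn f * nb (\<lambda>p. g (fst p) s)) = vn f * vn g" by (simp add: vn_def esum_cmult)
  finally show ?thesis .
qed

lemma conv_summable:
  assumes "vn f < top" "vn g < top" "t \<in> U"
  shows "(\<lambda>s. f t (s + m) * cnj (g t s)) summable_on UNIV"
proof (rule abs_summable_summable)
  have "norm (f t (s + m)) \<le> enn2real (vn f)" for s
  proof -
    have "ennreal (norm (f t (s + m))) \<le> vn f"
      by (rule order_trans[OF vn_pt[OF assms(3), of f "s + m"] nb_le_vn[of f "s + m"]])
    from enn2real_mono[OF this assms(1)] show ?thesis by simp
  qed
  then have "(\<lambda>s. norm (cnj (g t s) * f t (s + m))) summable_on UNIV"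
    by (intro abs_summable_times_bounded) (simp_all add: vn_summable assms)
  then show "(\<lambda>s. norm (f t (s + m) * cnj (g t s))) summable_on UNIV" by (simp add: mult.commute)
qed

lemma conv_diff:
  assumes "vn f < top" "vn f' < top" "vn g < top" "vn g' < top" "t \<in> U"
  shows "conv f g t m - conv f' g' t m
    = conv (\<lambda>t m. f t m - f' t m) g t m + conv f' (\<lambda>t m. g t m - g' t m) t m"
proof -
  have 1: "conv (\<lambda>t m. f t m - f' t m) g t m = conv f g t m - conv f' g t m"
    unfolding conv_def left_diff_distrib
    by (rule infsumI) (intro has_sum_diff has_sum_infsum conv_summable assms)
  have 2: "conv f' (\<lambda>t m. g t m - g' t m) t m = conv f' g t m - conv f' g' t m"
    unfolding conv_def complex_cnj_diff right_diff_distrib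
    by (rule infsumI) (intro has_sum_diff has_sum_infsum conv_summable assms)
  show ?thesis unfolding 1 2 by simp
qed

text \<open>Each partial derivative is bounded by the operator norm. Summing them instead of using
  the Euclidean length costs the dimension, which enters the final constant.\<close>

lemma norm_blinfun_grad:
  fixes f :: "real ^ 'n \<Rightarrow> complex"
  assumes "(f has_derivative blinfun_apply f') (at t)"
  shows "norm (grad f t) \<le> real CARD('n) * norm f'"
proof -
  have fd: "frechet_derivative f (at t) = blinfun_apply f'"
    using frechet_derivative_at[OF assms] by simp
  have "norm (grad f t) \<le> (\<Sum>i\<in>UNIV. norm (grad f t $ i))"
    unfolding norm_vec_def by (rule L2_set_le_sum) simp
  also have "\<dots> \<le> (\<Sum>i\<in>(UNIV :: 'n set). norm f')"
  proof (rule sum_mono)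
    fix i :: 'n
    have "norm (blinfun_apply f' (axis i 1)) \<le> norm f' * norm (axis i 1 :: real ^ 'n)" by (rule norm_blinfun)
    then show "norm (grad f t $ i) \<le> norm f'" by (simp add: grad_def fd norm_axis_1)
  qed
  finally show ?thesis by simp
qed

text \<open>The quantities of the problem are defined for all t but are identified with the
  constructed ones on U only; openness of U is enough to transfer the derivative.\<close>

lemma grad_bound:
  assumes eq: "\<And>t. t \<in> U \<Longrightarrow> f t = g t" and fin: "nb (\<lambda>p. g (fst p)) < top" and t: "t \<in> U"
  shows "f differentiable (at t)"
    and "ennreal (norm (grad f t)) \<le> ennreal (real CARD('n) / \<rho>) * nb (\<lambda>p. g (fst p))"
proof -
  obtain f' where "((\<lambda>t. g (fst (t, 0::real))) has_derivative blinfun_apply f') (at t)"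
    and n: "ennreal (\<rho> * norm f') \<le> nb (\<lambda>p. g (fst p))"
    by (rule nb_derivative[OF fin t, of 0]) auto
  then have "(g has_derivative blinfun_apply f') (at t)" by simp
  then have d: "(f has_derivative blinfun_apply f') (at t)"
    by (rule has_derivative_transform_within_open[OF _ open_U t]) (simp add: eq)
  show "f differentiable (at t)" unfolding differentiable_def using d by blast
  have g: "norm (grad f t) \<le> real CARD('n) * norm f'" by (rule norm_blinfun_grad[OF d])
  have "ennreal (norm (grad f t)) \<le> ennreal (real CARD('n) / \<rho> * (\<rho> * norm f'))"
    using g rho_pos by (intro ennreal_leI) simp
  also have "\<dots> = ennreal (real CARD('n) / \<rho>) * ennreal (\<rho> * norm f')"
    using rho_pos by (intro ennreal_mult) auto
  also have "\<dots> \<le> ennreal (real CARD('n) / \<rho>) * nb (\<lambda>p. g (fst p))" by (intro mult_left_mono n) simp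
  finally show "ennreal (norm (grad f t)) \<le> ennreal (real CARD('n) / \<rho>) * nb (\<lambda>p. g (fst p))" .
qed

end

lemma tser_add_cmult:
  assumes "(\<lambda>m. norm (c m)) summable_on UNIV" "(\<lambda>m. norm (d m)) summable_on UNIV"
  shows "tser (\<lambda>m. c m + k * d m) x = tser c x + k * tser d x"
proof -
  have s: "(\<lambda>m. c m * plane_wave (lat m) x) summable_on UNIV" if "(\<lambda>m. norm (c m)) summable_on UNIV" for c
    by (rule abs_summable_summable) (rule abs_summable_times_bounded[OF that, of _ 1], simp)
  have "((\<lambda>m. c m * plane_wave (lat m) x + k * (d m * plane_wave (lat m) x)) has_sum (tser c x + k * tser d x)) UNIV"
    unfolding tser_def by (intro has_sum_add has_sum_cmult_right has_sum_infsum s assms)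
  then show ?thesis unfolding tser_def[of "\<lambda>m. c m + k * d m"]
    by (intro infsumI) (simp add: algebra_simps)
qed

text \<open>The four smallness conditions have separate purposes: \<open>small1\<close> keeps
  potentials within distance 1 of V, \<open>small2\<close> makes the ratio of the perturbation
  series at most 1/2, \<open>small3\<close> bounds the correction of the projection by 1, and
  \<open>small4\<close> makes the iteration a contraction with factor 1/2.\<close>

locale fixed_point = perturbation_bounds U \<rho> l V q \<epsilon> j \<kappa> cR
  for U :: "(real ^ 'n::finite) set" and \<rho> :: real and l :: nat and V :: "'n potential" and q
    and \<epsilon> :: real and j :: "'n lattice" and \<kappa> cR :: real +
  fixes cE v0 T \<sigma> :: real and A :: complex
  assumes cE: "0 \<le> cE" and v0: "0 \<le> v0"
    and nb_block_proj: "\<And>s r. nb (\<lambda>p. block_proj l V q \<epsilon> j (fst p) s r) \<le> ennreal cE"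
    and V_tser: "V = tser (fourier_coeff V)"
    and V_norm: "esum (\<lambda>m. ennreal (norm (fourier_coeff V m))) \<le> ennreal v0"
    and coupling: "\<bar>\<sigma>\<bar> * (norm A)\<^sup>2 \<le> T"
    and small1: "2 * T * (2 * cE + 1)\<^sup>2 \<le> 1"
    and small2: "2 * cR * (2 * T * (2 * cE + 1)\<^sup>2 + (v0 + 1) / \<kappa>) \<le> 1 / 2"
    and small3: "4 * rad * cR * (2 * cR * (2 * T * (2 * cE + 1)\<^sup>2 + (v0 + 1) / \<kappa>)) \<le> 1"
    and small4: "T * (32 * (2 * cE + 1) * rad * cR\<^sup>2) \<le> 1 / 2"
begin

section \<open>Invariant ball and contraction\<close>

definition e0 :: real where "e0 = 2 * cE + 1"

definition cc :: real where "cc = 2 * cR * (2 * T * e0\<^sup>2 + (v0 + 1) / \<kappa>)"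

definition tau :: real where "tau = \<sigma> * (norm A)\<^sup>2"

lemma tau_T: "\<bar>tau\<bar> \<le> T" using coupling by (simp add: tau_def abs_mult)

lemma T_nonneg: "0 \<le> T" using tau_T by simp

lemma cc_bounds: "0 \<le> cc" "cc \<le> 1 / 2" "4 * rad * cR * cc \<le> 1"
  using small2 small3 T_nonneg cR v0 kappa unfolding cc_def e0_def by auto

text \<open>A step of the iteration lands within T e0^2 of V. The radius is twice that, the sum of
  the steps T e0^2 2^(-n), so that the limit stays in the ball as well.\<close>

definition good :: "(real ^ 'n \<Rightarrow> 'n lattice \<Rightarrow> complex) \<Rightarrow> bool" where
  "good w \<longleftrightarrow> vn (\<lambda>t m. w t m - fourier_coeff V m) \<le> ennreal (2 * T * e0\<^sup>2)"

lemma vn_V: "vn (\<lambda>_. fourier_coeff V) \<le> ennreal v0"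
  using V_norm by (rule order_trans[rotated]) (simp add: vn_def esum_mono nb_const)

lemma good_vn: "good w \<Longrightarrow> vn w \<le> ennreal (v0 + 1)"
proof -
  assume "good w"
  have "vn w = vn (\<lambda>t m. fourier_coeff V m + (w t m - fourier_coeff V m))" by simp
  also have "\<dots> \<le> ennreal v0 + ennreal (2 * T * e0\<^sup>2)"
    using \<open>good w\<close> unfolding good_def by (intro order_trans[OF vn_add] add_mono vn_V)
  also have "\<dots> \<le> ennreal v0 + ennreal 1" using small1 by (intro add_left_mono ennreal_leI) (simp add: e0_def)
  also have "\<dots> = ennreal (v0 + 1)" using v0 by simp
  finally show ?thesis .
qed

lemma good_eta: "good w \<Longrightarrow> eta w \<le> ennreal cc"
proof -
  assume g: "good w"
  have "eta w \<le> 2 * ennreal cR * (ennreal (2 * T * e0\<^sup>2) + ennreal (1 / \<kappa>) * ennreal (v0 + 1))"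
    using g good_vn[OF g] unfolding eta_def good_def by (intro mult_left_mono add_mono) auto
  also have "\<dots> = ennreal cc"
    using T_nonneg kappa v0 cR unfolding cc_def
    by (simp add: ennreal_mult[symmetric] ennreal_plus[symmetric] ennreal_numeral[symmetric] del: ennreal_plus ennreal_numeral)
  finally show ?thesis .
qed

lemma good_finite: "good w \<Longrightarrow> vn w < top" "good w \<Longrightarrow> mn (Y_scaled w) < top"
proof -
  assume g: "good w"
  show f: "vn w < top" by (rule le_less_trans[OF good_vn[OF g]]) simp
  have "vn (\<lambda>t m. w t m - fourier_coeff V m) < top"
    using g unfolding good_def by (rule le_less_trans) simp
  with f show "mn (Y_scaled w) < top" by (rule Y_scaled_finite)
qed

text \<open>Column \<open>j\<close> of the perturbed projection: the Fourier coefficients of u up to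
  the constant A and the factor e^(i<t,x>). Its norm is at most \<open>e0\<close>, namely 2
  \<open>cE\<close> from the two block entries and 1 from the correction.\<close>

definition evec :: "(real ^ 'n \<Rightarrow> 'n lattice \<Rightarrow> complex) \<Rightarrow> real ^ 'n \<Rightarrow> 'n lattice \<Rightarrow> complex" where
  "evec w t s = block_proj l V q \<epsilon> j t s j + Epert w t s j"

lemma vn_evec: "good w \<Longrightarrow> vn (evec w) \<le> ennreal e0"
proof -
  assume g: "good w"
  have "vn (\<lambda>t s. block_proj l V q \<epsilon> j t s j) = (\<Sum>s\<in>B. nb (\<lambda>p. block_proj l V q \<epsilon> j (fst p) s j))"
    unfolding vn_def by (rule esum_finite_support) (auto simp: block_proj_def)
  also have "\<dots> \<le> (\<Sum>s\<in>B. ennreal cE)" by (intro sum_mono nb_block_proj)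
  also have "\<dots> = ennreal (2 * cE)" using finB(2) cE by (simp add: ennreal_mult)
  finally have 1: "vn (\<lambda>t s. block_proj l V q \<epsilon> j t s j) \<le> ennreal (2 * cE)" .
  have "vn (\<lambda>t s. Epert w t s j) \<le> mn (\<lambda>p. Epert w (fst p))"
    using col_le[of "\<lambda>p. Epert w (fst p)" j] by (simp add: vn_def nbm_def)
  also have "\<dots> \<le> ennreal (4 * rad * cR * cc)" by (rule mn_Epert[OF cc_bounds(1,2) good_eta[OF g]])
  also have "\<dots> \<le> ennreal 1" by (rule ennreal_leI) (rule cc_bounds)
  finally have 2: "vn (\<lambda>t s. Epert w t s j) \<le> ennreal 1" .
  have "vn (evec w) \<le> ennreal (2 * cE) + ennreal 1"
    unfolding evec_def[abs_def] by (rule order_trans[OF vn_add]) (intro add_mono 1 2)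
  also have "\<dots> = ennreal e0" using cE by (simp add: e0_def)
  finally show ?thesis .
qed

lemma vn_evec_diff:
  assumes "good w" "good w'"
  shows "vn (\<lambda>t s. evec w t s - evec w' t s) \<le> ennreal (16 * rad * cR\<^sup>2) * vn (\<lambda>t m. w t m - w' t m)"
proof -
  have "vn (\<lambda>t s. evec w t s - evec w' t s) = esum (\<lambda>s. nbm (\<lambda>p s r. Epert w (fst p) s r - Epert w' (fst p) s r) s j)"
    by (simp add: vn_def evec_def nbm_def)
  also have "\<dots> \<le> mn (\<lambda>p s r. Epert w (fst p) s r - Epert w' (fst p) s r)" by (rule col_le)
  also have "\<dots> \<le> ennreal (16 * rad * cR\<^sup>2) * vn (\<lambda>t m. w t m - w' t m)"
    by (intro mn_Epert_diff[OF cc_bounds(1,2)] good_eta good_finite assms)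
  finally show ?thesis .
qed

text \<open>The map \<open>M_hat\<close> on Fourier coefficients, applied to all t simultaneously;
  this makes the t-derivatives of the potential part of the iteration.\<close>

definition Phi :: "(real ^ 'n \<Rightarrow> 'n lattice \<Rightarrow> complex) \<Rightarrow> real ^ 'n \<Rightarrow> 'n lattice \<Rightarrow> complex" where
  "Phi w t m = fourier_coeff V m + of_real tau * conv (evec w) (evec w) t m"

lemma e0_pos: "e0 > 0" using cE by (simp add: e0_def)

lemma Phi_V: "good w \<Longrightarrow> vn (\<lambda>t m. Phi w t m - fourier_coeff V m) \<le> ennreal (T * e0\<^sup>2)"
proof -
  assume g: "good w"
  have "vn (\<lambda>t m. Phi w t m - fourier_coeff V m) = vn (\<lambda>t m. of_real tau * conv (evec w) (evec w) t m)"
    by (simp add: Phi_def)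
  also have "\<dots> \<le> ennreal (norm (complex_of_real tau)) * vn (conv (evec w) (evec w))" by (rule vn_cmult)
  also have "\<dots> \<le> ennreal T * (ennreal e0 * ennreal e0)"
    using tau_T by (intro mult_mono ennreal_leI order_trans[OF vn_conv] vn_evec g) auto
  also have "\<dots> = ennreal (T * e0\<^sup>2)"
    using T_nonneg e0_pos by (simp add: ennreal_mult[symmetric] power2_eq_square)
  finally show ?thesis .
qed

lemma good_Phi: "good w \<Longrightarrow> good (Phi w)"
  unfolding good_def[of "Phi w"] using T_nonneg
  by (intro order_trans[OF Phi_V] ennreal_leI) auto

lemma good_V: "good (\<lambda>_. fourier_coeff V)"
  by (simp add: good_def vn_def)

text \<open>The autocorrelation is quadratic in \<open>evec\<close>, so its difference splits into
  two products, each with a factor of norm at most \<open>e0\<close> and a difference with Lipschitz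
  constant 16 rad cR^2. Together this is the 32 of \<open>small4\<close>.\<close>

lemma Phi_contraction:
  assumes g: "good w" "good w'"
  shows "vn (\<lambda>t m. Phi w t m - Phi w' t m) \<le> ennreal (1 / 2) * vn (\<lambda>t m. w t m - w' t m)"
proof -
  let ?d = "vn (\<lambda>t m. w t m - w' t m)" and ?k = "ennreal (16 * rad * cR\<^sup>2)"
  have fin: "vn (evec w) < top" "vn (evec w') < top"
    by (rule le_less_trans[OF vn_evec[OF g(1)]], simp, rule le_less_trans[OF vn_evec[OF g(2)]], simp)
  have "vn (\<lambda>t m. Phi w t m - Phi w' t m)
     = vn (\<lambda>t m. of_real tau * (conv (\<lambda>t m. evec w t m - evec w' t m) (evec w) t m
        + conv (evec w') (\<lambda>t m. evec w t m - evec w' t m) t m))"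
  proof (rule vn_cong)
    fix t m assume "t \<in> U"
    from conv_diff[OF fin fin this]
    show "Phi w t m - Phi w' t m = of_real tau * (conv (\<lambda>t m. evec w t m - evec w' t m) (evec w) t m
        + conv (evec w') (\<lambda>t m. evec w t m - evec w' t m) t m)"
      unfolding Phi_def by (simp add: right_diff_distrib[symmetric])
  qed
  also have "\<dots> \<le> ennreal (norm (complex_of_real tau)) * vn (\<lambda>t m. conv (\<lambda>t m. evec w t m - evec w' t m) (evec w) t m
        + conv (evec w') (\<lambda>t m. evec w t m - evec w' t m) t m)" by (rule vn_cmult)
  also have "\<dots> \<le> ennreal T * ((?k * ?d) * ennreal e0 + ennreal e0 * (?k * ?d))"
    using tau_T
    by (intro mult_mono[OF ennreal_leI] order_trans[OF vn_add] add_mono order_trans[OF vn_conv] mult_mono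
        vn_evec vn_evec_diff g) auto
  also have "\<dots> = (ennreal T * (?k * ennreal e0 + ?k * ennreal e0)) * ?d"
    by (simp only: distrib_left distrib_right mult_ac)
  also have "ennreal T * (?k * ennreal e0 + ?k * ennreal e0) = ennreal (T * (32 * e0 * rad * cR\<^sup>2))"
    using T_nonneg e0_pos rad_pos
    by (simp add: ennreal_mult[symmetric] ennreal_plus[symmetric] mult_ac del: ennreal_plus)
  also have "\<dots> \<le> ennreal (1 / 2)" using small4 by (intro ennreal_leI) (simp add: e0_def)
  finally show ?thesis by (simp add: mult_right_mono)
qed

section \<open>Limit of the iteration\<close>

definition iter :: "nat \<Rightarrow> real ^ 'n \<Rightarrow> 'n lattice \<Rightarrow> complex" where
  "iter n = (Phi ^^ n) (\<lambda>_. fourier_coeff V)"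

lemma iter_simps: "iter 0 = (\<lambda>_. fourier_coeff V)" "iter (Suc n) = Phi (iter n)"
  by (simp_all add: iter_def)

lemma good_iter: "good (iter n)"
  by (induction n) (simp_all add: iter_simps good_V good_Phi)

lemma iter_step: "vn (\<lambda>t m. iter (Suc n) t m - iter n t m) \<le> ennreal ((1 / 2) ^ n * (T * e0\<^sup>2))"
proof (induction n)
  case 0
  show ?case using Phi_V[OF good_V] by (simp add: iter_simps)
next
  case (Suc n)
  have "vn (\<lambda>t m. iter (Suc (Suc n)) t m - iter (Suc n) t m)
    \<le> ennreal (1 / 2) * vn (\<lambda>t m. iter (Suc n) t m - iter n t m)"
    unfolding iter_simps(2)[of "Suc n"] using Phi_contraction[OF good_iter[of "Suc n"] good_iter[of n]]
    by (simp add: iter_simps(2))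
  also have "\<dots> \<le> ennreal (1 / 2) * ennreal ((1 / 2) ^ n * (T * e0\<^sup>2))" by (intro mult_left_mono Suc) simp
  also have "\<dots> = ennreal ((1 / 2) ^ Suc n * (T * e0\<^sup>2))"
    using T_nonneg by (subst ennreal_mult[symmetric]) auto
  finally show ?case .
qed

text \<open>Written as a telescoping series so that completeness of the norm applies and the limit
  is C^1 in t.\<close>

definition w_lim :: "real ^ 'n \<Rightarrow> 'n lattice \<Rightarrow> complex" where
  "w_lim t m = fourier_coeff V m + (\<Sum>n. iter (Suc n) t m - iter n t m)"

lemma tail_bound: "(\<Sum>i. vn (\<lambda>t m. iter (Suc (i + n)) t m - iter (i + n) t m)) \<le> ennreal ((1 / 2) ^ n * (2 * T * e0\<^sup>2))"
proof -
  have "(\<Sum>i. vn (\<lambda>t m. iter (Suc (i + n)) t m - iter (i + n) t m)) \<le> (\<Sum>i. ennreal ((1 / 2) ^ (i + n) * (T * e0\<^sup>2)))"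
    by (intro suminf_le iter_step) auto
  also have "\<dots> = ennreal ((1 / 2) ^ n * (2 * T * e0\<^sup>2))"
  proof (rule suminf_ennreal_eq)
    show "(\<lambda>i. (1 / 2) ^ (i + n) * (T * e0\<^sup>2)) sums ((1 / 2) ^ n * (2 * T * e0\<^sup>2))"
      using sums_mult[OF geometric_sums[of "1 / 2 :: real"], of "(1 / 2) ^ n * (T * e0\<^sup>2)"]
      by (simp add: power_add mult_ac)
  qed (use T_nonneg in auto)
  finally show ?thesis .
qed

lemma steps_summable: "t \<in> U \<Longrightarrow> summable (\<lambda>n. iter (Suc n) t m - iter n t m)"
proof -
  assume t: "t \<in> U"
  have "(\<Sum>n. nb (\<lambda>p. iter (Suc n) (fst p) m - iter n (fst p) m)) \<le> (\<Sum>i. vn (\<lambda>t m. iter (Suc (i + 0)) t m - iter (i + 0) t m))"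
    using nb_le_vn[of "\<lambda>t m. iter (Suc n) t m - iter n t m" m for n] by (intro suminf_le) auto
  also have "\<dots> < top" by (rule le_less_trans[OF tail_bound]) simp
  finally show ?thesis using nb_suminf_summable[of "\<lambda>n p. iter (Suc n) (fst p) m - iter n (fst p) m" "(t, 0)"] t
    by (simp add: D_def)
qed

lemma vn_w_lim_iter: "vn (\<lambda>t m. w_lim t m - iter n t m) \<le> ennreal ((1 / 2) ^ n * (2 * T * e0\<^sup>2))"
proof -
  have "vn (\<lambda>t m. w_lim t m - iter n t m) = vn (\<lambda>t m. \<Sum>i. iter (Suc (i + n)) t m - iter (i + n) t m)"
  proof (rule vn_cong)
    fix t m assume t: "t \<in> U"
    have tel: "(\<Sum>i<n. iter (Suc i) t m - iter i t m) = iter n t m - fourier_coeff V m"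
      by (subst sum_lessThan_telescope) (simp add: iter_simps)
    show "w_lim t m - iter n t m = (\<Sum>i. iter (Suc (i + n)) t m - iter (i + n) t m)"
      unfolding w_lim_def using suminf_split_initial_segment[OF steps_summable[OF t, of m], of n] tel by simp
  qed
  also have "\<dots> \<le> (\<Sum>i. vn (\<lambda>t m. iter (Suc (i + n)) t m - iter (i + n) t m))" by (rule vn_suminf)
  also note tail_bound
  finally show ?thesis .
qed

lemma good_w_lim: "good w_lim"
  using vn_w_lim_iter[of 0] by (simp add: good_def iter_simps)

text \<open>At a fixed t the iteration of functions is the coefficient iteration evaluated at t,
  since every step uses the potential only through its Fourier coefficients at this t.\<close>

lemma W_iter_eq:
  assumes t: "t \<in> U"
  shows "W_iter l V q \<sigma> A \<epsilon> j t n = tser (iter n t)"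
proof (induction n)
  case 0
  show ?case using V_tser by (simp add: W_iter_def iter_simps)
next
  case (Suc n)
  define e where "e = evec (iter n) t"
  have c_sum: "(\<lambda>m. norm (iter n t m)) summable_on UNIV"
    by (rule vn_summable[OF good_finite(1)[OF good_iter] t])
  have e_sum: "(\<lambda>m. norm (e m)) summable_on UNIV"
    unfolding e_def by (rule vn_summable[OF le_less_trans[OF vn_evec[OF good_iter]] t]) simp
  have V_sum: "(\<lambda>m. norm (fourier_coeff V m)) summable_on UNIV"
    using vn_summable[OF good_finite(1)[OF good_V] t] .
  have E: "E_W l V q \<epsilon> j t (tser (iter n t)) s j = e s" for s
    unfolding e_def evec_def by (rule E_W_eq[OF _ t]) (rule ext, rule fourier_coeff_tser[OF c_sum])
  \<comment> \<open>The quasi-periodic factor e^(i<t,x>) has modulus 1 and drops out of |u|; what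
    remains is a periodic trigonometric series.\<close>
  have u: "norm (u_W l V q A \<epsilon> j t (tser (iter n t)) x) = norm A * norm (tser e x)" for x
  proof -
    have "(\<Sum>\<^sub>\<infinity>s. e s * plane_wave (Pvec s t) x) = (\<Sum>\<^sub>\<infinity>s. e s * plane_wave (lat s) x * plane_wave t x)"
      by (simp add: Pvec_def plane_wave_add mult.assoc)
    also have "\<dots> = tser e x * plane_wave t x" unfolding tser_def by (rule infsum_cmult_left')
    finally show ?thesis unfolding u_W_def E by (simp add: norm_mult)
  qed
  have "W_iter l V q \<sigma> A \<epsilon> j t (Suc n) x = tser (iter (Suc n) t) x" for x
  proof -
    have "W_iter l V q \<sigma> A \<epsilon> j t (Suc n) x = M_hat l V q \<sigma> A \<epsilon> j t (tser (iter n t)) x"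
      using Suc by (simp add: W_iter_def)
    also have "\<dots> = V x + of_real tau * of_real ((norm (tser e x))\<^sup>2)"
      unfolding M_hat_def u by (simp add: tau_def power_mult_distrib mult_ac)
    also have "\<dots> = tser (fourier_coeff V) x + of_real tau * tser (\<lambda>m. \<Sum>\<^sub>\<infinity>s. e (s + m) * cnj (e s)) x"
      using V_tser by (simp only: tser_abs_square(1)[OF e_sum])
    also have "\<dots> = tser (\<lambda>m. fourier_coeff V m + of_real tau * (\<Sum>\<^sub>\<infinity>s. e (s + m) * cnj (e s))) x"
      by (rule tser_add_cmult[OF V_sum tser_abs_square(2)[OF e_sum], symmetric])
    also have "(\<lambda>m. fourier_coeff V m + of_real tau * (\<Sum>\<^sub>\<infinity>s. e (s + m) * cnj (e s))) = iter (Suc n) t"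
      by (simp add: fun_eq_iff iter_simps Phi_def conv_def e_def)
    finally show ?thesis .
  qed
  then show ?case by blast
qed

lemma W_lim_coeff:
  assumes t: "t \<in> U"
  shows "fourier_coeff (W_lim l V q \<sigma> A \<epsilon> j t) = w_lim t"
proof (rule fourier_coeff_W_lim[OF W_iter_eq[OF t]])
  show "(\<lambda>i. norm (iter m t i)) summable_on UNIV" for m
    by (rule vn_summable[OF good_finite(1)[OF good_iter] t])
  show "(\<lambda>i. norm (w_lim t i)) summable_on UNIV"
    by (rule vn_summable[OF good_finite(1)[OF good_w_lim] t])
  have le: "esum (\<lambda>i. ennreal (norm (iter n t i - w_lim t i))) \<le> ennreal ((1 / 2) ^ n * (2 * T * e0\<^sup>2))" for n
    using order_trans[OF esum_le_vn[OF t, of "\<lambda>t m. w_lim t m - iter n t m"] vn_w_lim_iter[of n]]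
    unfolding norm_minus_commute[of "iter n t _"] .
  have "(\<lambda>n. (1 / 2) ^ n * (2 * T * e0\<^sup>2)) \<longlonglongrightarrow> 0 * (2 * T * e0\<^sup>2)"
    by (intro tendsto_mult_right LIMSEQ_realpow_zero) auto
  then have "(\<lambda>n. ennreal ((1 / 2) ^ n * (2 * T * e0\<^sup>2))) \<longlonglongrightarrow> 0"
    by (subst ennreal_0[symmetric], intro tendsto_ennrealI) simp
  then show "(\<lambda>n. esum (\<lambda>i. ennreal (norm (iter n t i - w_lim t i)))) \<longlonglongrightarrow> 0"
    by (rule tendsto_sandwich[OF _ _ tendsto_const, rotated 2]) (auto simp: le)
qed

text \<open>On U the differences are exactly \<open>Epert\<close> and \<open>Lpert\<close> at the
  limit potential, whose C^1 norms are known; dividing by \<rho> turns them into gradient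
  bounds.\<close>

theorem gradient_bounds:
  assumes t: "t \<in> U"
  defines "dE \<equiv> \<lambda>s r t. E_sol l V q \<sigma> A \<epsilon> j t s r - E_hat l V q \<epsilon> j t s r"
    and "dlam \<equiv> \<lambda>t. lambda_sol l V q \<sigma> A \<epsilon> j t - of_real (lambda_hat l V q \<epsilon> j t)"
  shows "dE s r differentiable (at t)"
    and "norm0 (\<lambda>s r. grad (dE s r) t) \<le> ennreal (real CARD('n) / \<rho> * (4 * rad * cR * cc))"
    and "dlam differentiable (at t)"
    and "norm (grad dlam t) \<le> real CARD('n) / \<rho> * (8 * rad * cc)"
proof -
  let ?E = "\<lambda>p. Epert w_lim (fst p)" and ?N = "ennreal (real CARD('n) / \<rho>)"
  have E: "dE s r t = Epert w_lim t s r" if "t \<in> U" for s r t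
    unfolding dE_def E_sol_def E_hat_eq[OF eps] E_W_eq[of _ w_lim, OF W_lim_coeff[OF that] that] by simp
  have L: "dlam t = Lpert w_lim t" if "t \<in> U" for t
    unfolding dlam_def lambda_sol_def lambda_W_eq[of _ w_lim, OF W_lim_coeff[OF that] that good_finite(2)[OF good_w_lim]] by simp
  have mE: "mn ?E \<le> ennreal (4 * rad * cR * cc)"
    by (rule mn_Epert[OF cc_bounds(1,2) good_eta[OF good_w_lim]])
  have nL: "nb (\<lambda>p. Lpert w_lim (fst p)) \<le> ennreal (8 * rad * cc)"
    by (rule nb_Lpert[OF cc_bounds(1,2) good_eta[OF good_w_lim]])
  have finE: "nb (\<lambda>p. Epert w_lim (fst p) s r) < top" for s r
    using entry_le[of ?E s r] mE by (simp add: nbm_def) (meson ennreal_less_top le_less_trans order_trans)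
  have finL: "nb (\<lambda>p. Lpert w_lim (fst p)) < top" by (rule le_less_trans[OF nL]) simp
  show "dE s r differentiable (at t)" by (rule grad_bound(1)[OF E finE t])
  show "dlam differentiable (at t)" by (rule grad_bound(1)[OF L finL t])
  have "ennreal (norm (grad dlam t)) \<le> ?N * ennreal (8 * rad * cc)"
    by (rule order_trans[OF grad_bound(2)[OF L finL t] mult_left_mono[OF nL]]) simp_all
  also have "\<dots> = ennreal (real CARD('n) / \<rho> * (8 * rad * cc))"
    using rho_pos rad_pos cc_bounds(1) by (intro ennreal_mult[symmetric]) auto
  finally show "norm (grad dlam t) \<le> real CARD('n) / \<rho> * (8 * rad * cc)"
    using rho_pos rad_pos cc_bounds(1) by (subst (asm) ennreal_le_iff) auto
  have gE: "ennreal (norm (grad (dE s r) t)) \<le> ?N * nbm ?E s r" for s r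
    unfolding nbm_def by (rule grad_bound(2)[OF E finE t])
  have "(\<Sum>\<^sub>\<infinity>p. ennreal (norm (grad (dE p r) t) + norm (grad (dE r p) t))) \<le> ennreal (2 * (real CARD('n) / \<rho> * (4 * rad * cR * cc)))" for r
  proof -
    have "(\<Sum>\<^sub>\<infinity>p. ennreal (norm (grad (dE p r) t) + norm (grad (dE r p) t)))
        = esum (\<lambda>p. ennreal (norm (grad (dE p r) t)) + ennreal (norm (grad (dE r p) t)))"
      by (simp add: esum_eq_infsum)
    also have "\<dots> \<le> esum (\<lambda>p. ?N * nbm ?E p r) + esum (\<lambda>p. ?N * nbm ?E r p)"
      unfolding esum_add by (intro add_mono esum_mono gE)
    \<comment> \<open>Once the column and once the row of index \<open>r\<close>; the resulting
      factor 2 is removed by the 1/2 in \<open>norm0\<close>.\<close>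
    also have "\<dots> \<le> ?N * ennreal (4 * rad * cR * cc) + ?N * ennreal (4 * rad * cR * cc)"
      unfolding esum_cmult by (intro add_mono mult_left_mono order_trans[OF row_le mE] order_trans[OF col_le mE]) auto
    also have "\<dots> = ennreal (2 * (real CARD('n) / \<rho> * (4 * rad * cR * cc)))"
      using rho_pos rad_pos cR cc_bounds(1)
      by (simp add: ennreal_mult[symmetric] ennreal_plus[symmetric] del: ennreal_plus)
    finally show ?thesis .
  qed
  then have "norm0 (\<lambda>s r. grad (dE s r) t) \<le> ennreal (2 * (real CARD('n) / \<rho> * (4 * rad * cR * cc))) / 2"
    unfolding norm0_def by (intro divide_right_mono_ennreal SUP_least)
  also have "\<dots> = ennreal (real CARD('n) / \<rho> * (4 * rad * cR * cc))"
    using rho_pos rad_pos cR cc_bounds(1)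
    by (subst ennreal_numeral[symmetric], subst divide_ennreal) auto
  finally show "norm0 (\<lambda>s r. grad (dE s r) t) \<le> ennreal (real CARD('n) / \<rho> * (4 * rad * cR * cc))" .
qed

end

section \<open>Estimates for large radius\<close>

definition cgrad :: "real ^ 'n::finite \<Rightarrow> (real ^ 'n) \<Rightarrow>\<^sub>L complex" where
  "cgrad x = Blinfun of_real o\<^sub>L blinfun_inner_right x"

lemma blinfun_of_real: "blinfun_apply (Blinfun of_real) = (of_real :: real \<Rightarrow> complex)"
  by (rule bounded_linear_Blinfun_apply[OF bounded_linear_of_real])

lemma cgrad_apply: "blinfun_apply (cgrad x) = (\<lambda>h. of_real (x \<bullet> h))"
  by (rule ext) (simp add: cgrad_def blinfun_of_real)

lemma norm_cgrad: "norm (cgrad x) \<le> norm x"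
  by (rule norm_blinfun_bound) (auto simp: cgrad_apply Cauchy_Schwarz_ineq2)

lemma continuous_on_cgrad: "continuous_on S f \<Longrightarrow> continuous_on S (\<lambda>x. cgrad (f x))"
  unfolding cgrad_def by (intro continuous_intros)

definition has_gradient :: "(real ^ 'n::finite) set \<Rightarrow> (real ^ 'n \<Rightarrow> real) \<Rightarrow> (real ^ 'n \<Rightarrow> real ^ 'n) \<Rightarrow> bool" where
  "has_gradient U g G \<longleftrightarrow> (\<forall>t\<in>U. (g has_derivative (\<lambda>h. G t \<bullet> h)) (at t)) \<and> continuous_on U G"

lemma has_gradient_continuous: "has_gradient U g G \<Longrightarrow> continuous_on U g"
  unfolding has_gradient_def
  by (meson continuous_at_imp_continuous_on has_derivative_continuous)

context c1_norm
begin

lemma has_t_derivative_real: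
  assumes "has_gradient U g G"
  shows "has_t_derivative (\<lambda>p. of_real (g (fst p))) (\<lambda>p. cgrad (G (fst p)))"
  unfolding has_t_derivative_def
proof (intro conjI ballI)
  have f: "continuous_on D fst" "fst ` D \<subseteq> U" by (auto simp: D_def intro!: continuous_intros)
  show "continuous_on D (\<lambda>p. complex_of_real (g (fst p)))"
    by (intro continuous_on_of_real continuous_on_compose2[OF has_gradient_continuous[OF assms] f])
  have "continuous_on U G" using assms by (simp add: has_gradient_def)
  then show "continuous_on D (\<lambda>p. cgrad (G (fst p)))"
    by (intro continuous_on_cgrad continuous_on_compose2[OF _ f])
  fix t \<theta> assume "t \<in> U"
  then have "(g has_derivative (\<lambda>h. G t \<bullet> h)) (at t)" using assms by (simp add: has_gradient_def)
  from has_derivative_of_real[OF this]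
  show "((\<lambda>t. complex_of_real (g (fst (t, \<theta>)))) has_derivative blinfun_apply (cgrad (G (fst (t, \<theta>))))) (at t)"
    by (simp add: cgrad_apply)
qed

lemma nb_real_leI:
  assumes "has_gradient U g G" "\<And>t. t \<in> U \<Longrightarrow> \<bar>g t\<bar> \<le> a" "\<And>t. t \<in> U \<Longrightarrow> \<rho> * norm (G t) \<le> b" "0 \<le> a" "0 \<le> b"
  shows "nb (\<lambda>p. of_real (g (fst p))) \<le> ennreal (a + b)"
proof (rule nb_leI[OF has_t_derivative_real[OF assms(1)]])
  fix p assume "p \<in> D"
  then have p: "fst p \<in> U" by (auto simp: D_def)
  show "norm (complex_of_real (g (fst p))) \<le> a" using assms(2)[OF p] by simp
  have "\<rho> * norm (cgrad (G (fst p))) \<le> \<rho> * norm (G (fst p))"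
    using rho_pos by (intro mult_left_mono norm_cgrad) auto
  then show "\<rho> * norm (cgrad (G (fst p))) \<le> b" using assms(3)[OF p] by simp
qed (use assms in auto)

lemma has_t_derivative_inverse:
  assumes f: "has_t_derivative f f'" and nz: "\<And>p. p \<in> D \<Longrightarrow> f p \<noteq> 0"
  shows "has_t_derivative (\<lambda>p. 1 / f p) (\<lambda>p. blinfun_mult_right (- 1 / (f p)\<^sup>2) o\<^sub>L f' p)"
  unfolding has_t_derivative_def
proof (intro conjI ballI)
  have c: "continuous_on D f" "continuous_on D f'" using f by (auto simp: has_t_derivative_def)
  show "continuous_on D (\<lambda>p. 1 / f p)"
    by (intro continuous_intros c) (use nz in auto)
  show "continuous_on D (\<lambda>p. blinfun_mult_right (- 1 / (f p)\<^sup>2) o\<^sub>L f' p)"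
    by (intro continuous_intros c) (use nz in auto)
  fix t \<theta> assume t: "t \<in> U" "\<theta> \<in> {0..1::real}"
  have d: "((\<lambda>t. f (t, \<theta>)) has_derivative blinfun_apply (f' (t, \<theta>))) (at t)"
    using f t by (auto simp: has_t_derivative_def)
  have n: "f (t, \<theta>) \<noteq> 0" using nz t by (auto simp: D_def)
  have "((\<lambda>t. inverse (f (t, \<theta>))) has_derivative
      (\<lambda>h. - (inverse (f (t, \<theta>)) * blinfun_apply (f' (t, \<theta>)) h * inverse (f (t, \<theta>))))) (at t)"
    by (rule Deriv.has_derivative_inverse[OF n d])
  moreover have "(\<lambda>h. - (inverse (f (t, \<theta>)) * blinfun_apply (f' (t, \<theta>)) h * inverse (f (t, \<theta>))))
     = blinfun_apply (blinfun_mult_right (- 1 / (f (t, \<theta>))\<^sup>2) o\<^sub>L f' (t, \<theta>))"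
    by (rule ext) (simp add: power2_eq_square divide_inverse)
  ultimately show "((\<lambda>t. 1 / f (t, \<theta>)) has_derivative
      blinfun_apply (blinfun_mult_right (- 1 / (f (t, \<theta>))\<^sup>2) o\<^sub>L f' (t, \<theta>))) (at t)"
    by (simp add: inverse_eq_divide)
qed

text \<open>The derivative may grow linearly with |f|: in |f'| / |f|^2 the part M gives M / r^2 and
  the part N |f| gives N / r. The case N > 0 serves the indices off the block, where the gradients
  are unbounded.\<close>

lemma nb_inverse_leI:
  assumes f: "has_t_derivative f f'" and lower: "\<And>p. p \<in> D \<Longrightarrow> r \<le> norm (f p)" and r: "0 < r"
    and M: "\<And>p. p \<in> D \<Longrightarrow> \<rho> * norm (f' p) \<le> M + N * norm (f p)" "0 \<le> M" "0 \<le> N"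
  shows "nb (\<lambda>p. 1 / f p) \<le> ennreal (1 / r + (M / r\<^sup>2 + N / r))"
proof (rule nb_leI[OF has_t_derivative_inverse[OF f]])
  fix p assume p: "p \<in> D"
  note lo = lower[OF p]
  show "f p \<noteq> 0" using lo r by auto
  show "norm (1 / f p) \<le> 1 / r" unfolding norm_divide norm_one by (rule frac_le) (use lo r in auto)
  have "\<rho> * norm (blinfun_mult_right (- 1 / (f p)\<^sup>2) o\<^sub>L f' p) \<le> \<rho> * (norm (- 1 / (f p)\<^sup>2) * norm (f' p))"
    using rho_pos by (intro mult_left_mono norm_mult_right_compose) auto
  also have "\<dots> = (\<rho> * norm (f' p)) / (norm (f p))\<^sup>2" by (simp add: norm_divide norm_power)
  also have "\<dots> \<le> (M + N * norm (f p)) / (norm (f p))\<^sup>2" by (intro divide_right_mono M(1) p) simp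
  also have "\<dots> = M / (norm (f p))\<^sup>2 + N / norm (f p)"
    using lo r by (simp add: add_divide_distrib power2_eq_square)
  also have "\<dots> \<le> M / r\<^sup>2 + N / r"
    using lo r M by (intro add_mono divide_left_mono power_mono mult_pos_pos zero_less_power) auto
  finally show "\<rho> * norm (blinfun_mult_right (- 1 / (f p)\<^sup>2) o\<^sub>L f' p) \<le> M / r\<^sup>2 + N / r" .
qed (use r M in auto)

lemma has_t_derivative_theta:
  assumes "continuous_on {0..1} g"
  shows "has_t_derivative (\<lambda>p. g (snd p)) (\<lambda>_. 0)"
  unfolding has_t_derivative_def
proof (intro conjI ballI)
  show "continuous_on D (\<lambda>p. g (snd p))"
    by (rule continuous_on_compose2[OF assms]) (auto simp: D_def intro!: continuous_intros)
qed (auto simp: zero_blinfun.rep_eq)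

end

text \<open>The gradient 2l p^(2l-2) P, expressed through the inner product so that it is polynomial
  in t and regular where P vanishes.\<close>

definition Pgrad :: "nat \<Rightarrow> 'n::finite lattice \<Rightarrow> real ^ 'n \<Rightarrow> real ^ 'n" where
  "Pgrad l m t = (2 * real l * (Pvec m t \<bullet> Pvec m t) ^ (l - 1)) *\<^sub>R Pvec m t"

lemma pnorm_power: "pnorm m t ^ (2 * l) = (Pvec m t \<bullet> Pvec m t) ^ l"
  by (simp add: pnorm_def power_mult power2_norm_eq_inner)

lemma has_gradient_pnorm: "has_gradient U (\<lambda>t. pnorm m t ^ (2 * l)) (Pgrad l m)"
  unfolding has_gradient_def
proof (intro conjI ballI)
  show "continuous_on U (Pgrad l m)"
    unfolding Pgrad_def[abs_def] Pvec_def by (intro continuous_intros)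
  fix t
  show "((\<lambda>t. pnorm m t ^ (2 * l)) has_derivative (\<lambda>h. Pgrad l m t \<bullet> h)) (at t)"
    unfolding pnorm_power Pvec_def Pgrad_def
    by (auto intro!: derivative_eq_intros simp: inner_commute algebra_simps)
qed

lemma norm_Pgrad:
  assumes "l > 0"
  shows "norm (Pgrad l m t) = 2 * real l * pnorm m t ^ (2 * l - 1)"
proof -
  have "2 * l - 1 = Suc (2 * (l - 1))" using assms by simp
  then have "pnorm m t ^ (2 * l - 1) = pnorm m t * (Pvec m t \<bullet> Pvec m t) ^ (l - 1)"
    by (simp only: power_Suc pnorm_power)
  then show ?thesis by (simp add: Pgrad_def pnorm_def abs_mult)
qed

lemma pnorm_nonneg: "0 \<le> pnorm m t"
  by (simp add: pnorm_def)

text \<open>This and the following constants depend on l and on a = |v_q| only. They bound, in turn,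
  the rescaled gradient of p^(2l) for p up to 2k, the entries of the block projections, |z| / k^(2l)
  on the contour, the gradient of p_m^(2l) - z off the block apart from its part linear in |f|, and
  the resolvent.\<close>

definition grad_const :: "nat \<Rightarrow> real" where
  "grad_const l = 2 * real l * 2 ^ (2 * l - 1)"

definition proj_const :: "nat \<Rightarrow> real \<Rightarrow> real" where
  "proj_const l a = 1 + grad_const l / a"

definition size_const :: "nat \<Rightarrow> real \<Rightarrow> real" where
  "size_const l a = 2 * 4 ^ l + 2 * a"

definition off_const :: "nat \<Rightarrow> real \<Rightarrow> real" where
  "off_const l a = 2 * real l * (1 + size_const l a) + 2 * grad_const l"

definition resolvent_const :: "nat \<Rightarrow> real \<Rightarrow> real" where
  "resolvent_const l a = proj_const l a / (a / 10) + proj_const l a * (1 / a + 2 * grad_const l / a\<^sup>2)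
     + 2 * (1 + 2 * off_const l a + 2 * real l)"

section \<open>Uniform bounds on the block\<close>

locale resonance_estimates = c1_norm U \<rho> + resonant_potential l V q
  for U :: "(real ^ 'n::finite) set" and \<rho> :: real and l :: nat and V :: "'n potential" and q +
  fixes j :: "'n lattice" and k :: real
  assumes l_pos: "l > 0" and k1: "k \<ge> 1" and rho_eq: "\<rho> = 1 / k ^ (2 * l - 1)"
    and pj: "\<And>t m. t \<in> U \<Longrightarrow> m \<in> {j, j - q} \<Longrightarrow> pnorm m t \<le> 2 * k"
begin

abbreviation "av \<equiv> norm vq"

abbreviation "cL \<equiv> grad_const l"

lemma av_pos: "av > 0" using Vq by simp

lemma cL_nonneg: "cL \<ge> 0" by (simp add: grad_const_def)

lemma Pgrad_le: "t \<in> U \<Longrightarrow> m \<in> {j, j - q} \<Longrightarrow> \<rho> * norm (Pgrad l m t) \<le> cL"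
proof -
  assume t: "t \<in> U" "m \<in> {j, j - q}"
  have "pnorm m t ^ (2 * l - 1) \<le> (2 * k) ^ (2 * l - 1)"
    by (intro power_mono pj t pnorm_nonneg)
  then have "\<rho> * norm (Pgrad l m t) \<le> \<rho> * (2 * real l * (2 * k) ^ (2 * l - 1))"
    unfolding norm_Pgrad[OF l_pos] using rho_pos by (intro mult_left_mono) auto
  also have "\<dots> = cL" using k1 by (simp add: rho_eq grad_const_def power_mult_distrib)
  finally show ?thesis .
qed

definition gap_grad :: "real ^ 'n \<Rightarrow> real ^ 'n" where
  "gap_grad t = Pgrad l j t - Pgrad l (j - q) t"

definition width_grad :: "real ^ 'n \<Rightarrow> real ^ 'n" where
  "width_grad t = (gap l q j t / width l V q j t) *\<^sub>R gap_grad t"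

lemma has_gradient_gap: "has_gradient U (gap l q j) gap_grad"
  unfolding has_gradient_def
proof (intro conjI ballI)
  show "continuous_on U gap_grad"
    using has_gradient_pnorm[of U j l] has_gradient_pnorm[of U "j - q" l]
    unfolding gap_grad_def[abs_def] has_gradient_def by (intro continuous_on_diff) auto
  fix t assume "t \<in> U"
  have eq: "(\<lambda>h. gap_grad t \<bullet> h) = (\<lambda>h. Pgrad l j t \<bullet> h - Pgrad l (j - q) t \<bullet> h)"
    by (simp add: fun_eq_iff gap_grad_def inner_diff_left)
  show "(gap l q j has_derivative (\<lambda>h. gap_grad t \<bullet> h)) (at t)"
    unfolding gap_def[abs_def] eq
    by (rule has_derivative_diff)
       (use \<open>t \<in> U\<close> has_gradient_pnorm[of U j l] has_gradient_pnorm[of U "j - q" l] in \<open>auto simp: has_gradient_def\<close>)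
qed

lemma width_nz: "width l V q j t \<noteq> 0" using width_pos[of j t] by simp

lemma has_gradient_width: "has_gradient U (width l V q j) width_grad"
  unfolding has_gradient_def
proof (intro conjI ballI)
  have cg: "continuous_on U (gap l q j)" "continuous_on U gap_grad"
    using has_gradient_continuous[OF has_gradient_gap] has_gradient_gap by (auto simp: has_gradient_def)
  have cw: "continuous_on U (width l V q j)"
    unfolding width_def[abs_def] by (intro continuous_intros cg)
  show "continuous_on U width_grad"
    unfolding width_grad_def[abs_def] by (intro continuous_intros cg cw ballI width_nz)
  fix t assume "t \<in> U"
  then have d: "(gap l q j has_derivative (\<lambda>h. gap_grad t \<bullet> h)) (at t)"
    using has_gradient_gap by (simp add: has_gradient_def)
  have pos: "0 < 4 * av\<^sup>2 + (gap l q j t)\<^sup>2" using av_pos by (simp add: add_pos_nonneg)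
  have 1: "((\<lambda>t. 4 * av\<^sup>2 + (gap l q j t)\<^sup>2) has_derivative (\<lambda>h. 2 * (gap_grad t \<bullet> h) * gap l q j t)) (at t)"
    by (rule derivative_eq_intros d refl)+ (simp add: fun_eq_iff)
  have "((\<lambda>t. sqrt (4 * av\<^sup>2 + (gap l q j t)\<^sup>2)) has_derivative
      (\<lambda>h. (2 * (gap_grad t \<bullet> h) * gap l q j t) * (inverse (sqrt (4 * av\<^sup>2 + (gap l q j t)\<^sup>2)) / 2))) (at t)"
    using has_derivative_compose[OF 1 DERIV_real_sqrt[OF pos, unfolded has_field_derivative_def]]
    by (simp add: mult.commute)
  then show "(width l V q j has_derivative (\<lambda>h. width_grad t \<bullet> h)) (at t)"
    unfolding width_def[abs_def] width_grad_def by (simp add: field_simps)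
qed

lemma gap_grad_le: "t \<in> U \<Longrightarrow> \<rho> * norm (gap_grad t) \<le> 2 * cL"
proof -
  assume t: "t \<in> U"
  have "\<rho> * norm (gap_grad t) \<le> \<rho> * (norm (Pgrad l j t) + norm (Pgrad l (j - q) t))"
    unfolding gap_grad_def using rho_pos by (intro mult_left_mono norm_triangle_ineq4) auto
  also have "\<dots> \<le> 2 * cL" using Pgrad_le[OF t, of j] Pgrad_le[OF t, of "j - q"] by (simp add: distrib_left)
  finally show ?thesis .
qed

lemma gap_width_le: "\<bar>gap l q j t / width l V q j t\<bar> \<le> 1"
  using gap_le_width[of j t] width_pos[of j t] by (simp add: divide_simps)

lemma width_grad_le: "t \<in> U \<Longrightarrow> \<rho> * norm (width_grad t) \<le> 2 * cL"
proof -
  assume t: "t \<in> U"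
  have "norm (width_grad t) \<le> 1 * norm (gap_grad t)"
    unfolding width_grad_def norm_scaleR by (intro mult_right_mono gap_width_le) auto
  then have "\<rho> * norm (width_grad t) \<le> \<rho> * norm (gap_grad t)" using rho_pos by simp
  then show ?thesis using gap_grad_le[OF t] by simp
qed

lemma nb_inverse_width: "nb (\<lambda>p. of_real (1 / width l V q j (fst p))) \<le> ennreal (1 / (2 * av) + 2 * cL / (2 * av)\<^sup>2)"
proof -
  have "nb (\<lambda>p. 1 / of_real (width l V q j (fst p))) \<le> ennreal (1 / (2 * av) + (2 * cL / (2 * av)\<^sup>2 + 0 / (2 * av)))"
  proof (rule nb_inverse_leI[OF has_t_derivative_real[OF has_gradient_width]])
    fix p assume p: "p \<in> D"
    then have t: "fst p \<in> U" by (auto simp: D_def)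
    show "2 * av \<le> norm (complex_of_real (width l V q j (fst p)))"
      using width_ge[of j "fst p"] width_pos[of j "fst p"] by simp
    have "\<rho> * norm (cgrad (width_grad (fst p))) \<le> \<rho> * norm (width_grad (fst p))"
      using rho_pos by (intro mult_left_mono norm_cgrad) auto
    then show "\<rho> * norm (cgrad (width_grad (fst p))) \<le> 2 * cL + 0 * norm (complex_of_real (width l V q j (fst p)))"
      using width_grad_le[OF t] by simp
  qed (use av_pos cL_nonneg in auto)
  then show ?thesis by simp
qed

text \<open>Multiplying separate norms would lose, since the gap itself is not bounded uniformly in
  k. The quotient has modulus at most 1, and its gradient is (grad gap - (gap/width) grad
  width)/width, in which only this quotient occurs.\<close>

lemma nb_gap_width: "nb (\<lambda>p. of_real (gap l q j (fst p) / width l V q j (fst p))) \<le> ennreal (1 + 2 * cL / av)"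
proof -
  define G where "G t = (1 / width l V q j t) *\<^sub>R (gap_grad t - (gap l q j t / width l V q j t) *\<^sub>R width_grad t)" for t
  have "nb (\<lambda>p. of_real (gap l q j (fst p) / width l V q j (fst p))) \<le> ennreal (1 + 2 * cL / av)"
  proof (rule nb_real_leI[where G = G])
    show "has_gradient U (\<lambda>t. gap l q j t / width l V q j t) G"
      unfolding has_gradient_def
    proof (intro conjI ballI)
      have c: "continuous_on U (gap l q j)" "continuous_on U gap_grad" "continuous_on U (width l V q j)" "continuous_on U width_grad"
        using has_gradient_continuous[OF has_gradient_gap] has_gradient_gap
          has_gradient_continuous[OF has_gradient_width] has_gradient_width by (auto simp: has_gradient_def)
      show "continuous_on U G" unfolding G_def[abs_def] by (intro continuous_intros c ballI width_nz)
      fix t assume "t \<in> U"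
      then have d: "(gap l q j has_derivative (\<lambda>h. gap_grad t \<bullet> h)) (at t)"
        "(width l V q j has_derivative (\<lambda>h. width_grad t \<bullet> h)) (at t)"
        using has_gradient_gap has_gradient_width by (auto simp: has_gradient_def)
      from has_derivative_divide[OF d width_nz]
      show "((\<lambda>t. gap l q j t / width l V q j t) has_derivative (\<lambda>h. G t \<bullet> h)) (at t)"
        by (rule has_derivative_eq_rhs) (use width_nz in \<open>simp add: fun_eq_iff G_def inner_diff_left field_simps\<close>)
    qed
    show "\<bar>gap l q j t / width l V q j t\<bar> \<le> 1" for t by (rule gap_width_le)
    fix t assume t: "t \<in> U"
    have "norm (G t) = 1 / width l V q j t * norm (gap_grad t - (gap l q j t / width l V q j t) *\<^sub>R width_grad t)"
      using width_pos[of j t] by (simp add: G_def)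
    also have "\<dots> \<le> 1 / (2 * av) * (norm (gap_grad t) + 1 * norm (width_grad t))"
    proof (rule mult_mono)
      show "1 / width l V q j t \<le> 1 / (2 * av)"
        using width_ge[of j t] av_pos by (intro frac_le) auto
      have "norm ((gap l q j t / width l V q j t) *\<^sub>R width_grad t) \<le> 1 * norm (width_grad t)"
        unfolding norm_scaleR by (intro mult_right_mono gap_width_le) auto
      then show "norm (gap_grad t - (gap l q j t / width l V q j t) *\<^sub>R width_grad t) \<le> norm (gap_grad t) + 1 * norm (width_grad t)"
        using norm_triangle_ineq4 order_trans add_left_mono by meson
    qed (use av_pos in auto)
    finally have "norm (G t) \<le> 1 / (2 * av) * (norm (gap_grad t) + norm (width_grad t))" by simp
    then have "\<rho> * norm (G t) \<le> \<rho> * (1 / (2 * av) * (norm (gap_grad t) + norm (width_grad t)))"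
      by (rule mult_left_mono) (use rho_pos in simp)
    also have "\<dots> = 1 / (2 * av) * (\<rho> * norm (gap_grad t) + \<rho> * norm (width_grad t))" by (simp add: algebra_simps)
    also have "\<dots> \<le> 1 / (2 * av) * (2 * cL + 2 * cL)"
      by (intro mult_left_mono add_mono gap_grad_le width_grad_le t) simp
    finally show "\<rho> * norm (G t) \<le> 2 * cL / av" by simp
  qed (use av_pos cL_nonneg in auto)
  then show ?thesis .
qed

abbreviation "cE \<equiv> proj_const l av"

lemma cE_nonneg: "cE \<ge> 0" using cL_nonneg av_pos by (simp add: proj_const_def)

text \<open>The diagonal entries give 1/2 + (1 + 2 cL/|v_q|)/2, which is the constant; the
  off-diagonal ones need only half of it.\<close>

lemma nb_block_proj:
  assumes e: "\<epsilon> \<in> {1, -1}"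
  shows "nb (\<lambda>p. block_proj l V q \<epsilon> j (fst p) s r) \<le> ennreal cE"
proof -
  have ne: "norm (complex_of_real \<epsilon>) = 1" using e by auto
  have diag: "nb (\<lambda>p. of_real ((1 + e * (gap l q j (fst p) / width l V q j (fst p))) / 2)) \<le> ennreal cE"
    if "e \<in> {1, -1}" for e :: real
  proof -
    have "nb (\<lambda>p. of_real ((1 + e * (gap l q j (fst p) / width l V q j (fst p))) / 2))
      = nb (\<lambda>p. of_real (1 / 2) + of_real (e / 2) * of_real (gap l q j (fst p) / width l V q j (fst p)))"
      by (rule nb_cong) (simp add: add_divide_distrib)
    also have "\<dots> \<le> ennreal (1 / 2) + ennreal (1 / 2) * ennreal (1 + 2 * cL / av)"
    proof (intro order_trans[OF nb_add] add_mono order_trans[OF nb_cmult] mult_mono nb_gap_width)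
      show "nb (\<lambda>_. complex_of_real (1 / 2)) \<le> ennreal (1 / 2)" using nb_const[of "of_real (1 / 2)"] by simp
      show "ennreal (norm (complex_of_real (e / 2))) \<le> ennreal (1 / 2)" using that by (intro ennreal_leI) (auto simp: norm_divide)
    qed auto
    also have "\<dots> = ennreal cE"
    proof -
      have "ennreal (1 / 2) * ennreal (1 + 2 * cL / av) = ennreal (1 / 2 * (1 + 2 * cL / av))"
        using cL_nonneg av_pos by (intro ennreal_mult[symmetric]) auto
      moreover have "ennreal (1 / 2) + ennreal (1 / 2 * (1 + 2 * cL / av)) = ennreal (1 / 2 + 1 / 2 * (1 + 2 * cL / av))"
        using cL_nonneg av_pos by (intro ennreal_plus[symmetric]) auto
      moreover have "1 / 2 + 1 / 2 * (1 + 2 * cL / av) = cE" by (simp add: proj_const_def distrib_left)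
      ultimately show ?thesis by simp
    qed
    finally show ?thesis .
  qed
  have off: "nb (\<lambda>p. of_real \<epsilon> * c * of_real (1 / width l V q j (fst p))) \<le> ennreal cE" if "norm c = av" for c
  proof -
    have "nb (\<lambda>p. of_real \<epsilon> * c * of_real (1 / width l V q j (fst p)))
       \<le> ennreal (norm (of_real \<epsilon> * c)) * ennreal (1 / (2 * av) + 2 * cL / (2 * av)\<^sup>2)"
      by (rule order_trans[OF nb_cmult mult_left_mono[OF nb_inverse_width]]) simp
    also have "\<dots> = ennreal (av * (1 / (2 * av) + 2 * cL / (2 * av)\<^sup>2))"
      unfolding norm_mult ne that using cL_nonneg av_pos by (subst ennreal_mult) auto
    also have "\<dots> \<le> ennreal cE"
    proof (rule ennreal_leI)
      have "av * (1 / (2 * av) + 2 * cL / (2 * av)\<^sup>2) = (1 + cL / av) / 2"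
        using av_pos by (simp add: field_simps power2_eq_square)
      then show "av * (1 / (2 * av) + 2 * cL / (2 * av)\<^sup>2) \<le> cE" using cE_nonneg by (simp add: proj_const_def)
    qed
    finally show ?thesis .
  qed
  have e': "- \<epsilon> \<in> {1, -1}" using e by auto
  consider "s = j" "r = j" | "s = j - q" "r = j - q" | "s = j" "r = j - q" | "s = j - q" "r = j"
    | "\<not> (s \<in> {j, j - q} \<and> r \<in> {j, j - q})" by blast
  then show ?thesis
  proof cases
    case 1 then show ?thesis using diag[OF e] by (simp add: block_proj_def)
  next
    case 2
    then show ?thesis using diag[OF e'] jq by (simp add: block_proj_def)
  next
    case 3 then show ?thesis using off[of vq] jq by (simp add: block_proj_def)
  next
    case 4 then show ?thesis using off[of "cnj vq"] jq by (simp add: block_proj_def)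
  next
    case 5
    then have "block_proj l V q \<epsilon> j t s r = 0" for t by (auto simp: block_proj_def)
    then show ?thesis by simp
  qed
qed

end

section \<open>The moving contour and the resolvent\<close>

context resonance_estimates
begin

definition lam_grad :: "real \<Rightarrow> real ^ 'n \<Rightarrow> real ^ 'n" where
  "lam_grad \<epsilon> t = (1 / 2) *\<^sub>R (Pgrad l j t + Pgrad l (j - q) t) + (\<epsilon> / 2) *\<^sub>R width_grad t"

lemma has_gradient_lambda_hat: "has_gradient U (lambda_hat l V q \<epsilon> j) (lam_grad \<epsilon>)"
  unfolding has_gradient_def
proof (intro conjI ballI)
  have c: "continuous_on U width_grad" "continuous_on U (Pgrad l j)" "continuous_on U (Pgrad l (j - q))"
    using has_gradient_width has_gradient_pnorm[of U j l] has_gradient_pnorm[of U "j - q" l]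
    by (auto simp: has_gradient_def)
  show "continuous_on U (lam_grad \<epsilon>)" unfolding lam_grad_def[abs_def] by (intro continuous_intros c)
  fix t assume "t \<in> U"
  then have d: "(width l V q j has_derivative (\<lambda>h. width_grad t \<bullet> h)) (at t)"
    "((\<lambda>t. pnorm j t ^ (2 * l)) has_derivative (\<lambda>h. Pgrad l j t \<bullet> h)) (at t)"
    "((\<lambda>t. pnorm (j - q) t ^ (2 * l)) has_derivative (\<lambda>h. Pgrad l (j - q) t \<bullet> h)) (at t)"
    using has_gradient_width has_gradient_pnorm[of U j l] has_gradient_pnorm[of U "j - q" l]
    by (simp_all add: has_gradient_def)
  have eq: "lambda_hat l V q \<epsilon> j = (\<lambda>t. (1 / 2) * (pnorm j t ^ (2 * l) + pnorm (j - q) t ^ (2 * l)) + (\<epsilon> / 2) * width l V q j t)"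
    by (simp add: fun_eq_iff lambda_hat_eq)
  have eq': "(\<lambda>h. lam_grad \<epsilon> t \<bullet> h) = (\<lambda>h. (1 / 2) * (Pgrad l j t \<bullet> h + Pgrad l (j - q) t \<bullet> h) + (\<epsilon> / 2) * (width_grad t \<bullet> h))"
    by (simp add: fun_eq_iff lam_grad_def inner_add_left)
  show "(lambda_hat l V q \<epsilon> j has_derivative (\<lambda>h. lam_grad \<epsilon> t \<bullet> h)) (at t)"
    unfolding eq eq' by (intro has_derivative_add has_derivative_mult_right d)
qed

lemma lam_grad_le:
  assumes "\<epsilon> \<in> {1, -1}" "t \<in> U"
  shows "\<rho> * norm (lam_grad \<epsilon> t) \<le> 2 * cL"
proof -
  have "norm (lam_grad \<epsilon> t) \<le> norm ((1 / 2) *\<^sub>R (Pgrad l j t + Pgrad l (j - q) t)) + norm ((\<epsilon> / 2) *\<^sub>R width_grad t)"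
    unfolding lam_grad_def by (rule norm_triangle_ineq)
  also have "\<dots> = 1 / 2 * norm (Pgrad l j t + Pgrad l (j - q) t) + 1 / 2 * norm (width_grad t)"
    using assms by auto
  also have "\<dots> \<le> 1 / 2 * (norm (Pgrad l j t) + norm (Pgrad l (j - q) t)) + 1 / 2 * norm (width_grad t)"
    by (intro add_right_mono mult_left_mono norm_triangle_ineq) simp
  finally have "\<rho> * norm (lam_grad \<epsilon> t) \<le> \<rho> * (1 / 2 * (norm (Pgrad l j t) + norm (Pgrad l (j - q) t)) + 1 / 2 * norm (width_grad t))"
    by (rule mult_left_mono) (use rho_pos in simp)
  also have "\<dots> = 1 / 2 * (\<rho> * norm (Pgrad l j t) + \<rho> * norm (Pgrad l (j - q) t)) + 1 / 2 * (\<rho> * norm (width_grad t))"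
    by (simp add: algebra_simps)
  also have "\<dots> \<le> 1 / 2 * (cL + cL) + 1 / 2 * (2 * cL)"
    by (intro add_mono mult_left_mono Pgrad_le width_grad_le assms) auto
  finally show ?thesis by simp
qed

lemma lambda_hat_bound:
  assumes "\<epsilon> \<in> {1, -1}" "t \<in> U"
  shows "\<bar>lambda_hat l V q \<epsilon> j t\<bar> \<le> (2 * 4 ^ l + av) * k ^ (2 * l)"
proof -
  have P: "0 \<le> pnorm m t ^ (2 * l)" "pnorm m t ^ (2 * l) \<le> 4 ^ l * k ^ (2 * l)" if "m \<in> {j, j - q}" for m
  proof -
    show "0 \<le> pnorm m t ^ (2 * l)" by (intro zero_le_power pnorm_nonneg)
    have "pnorm m t ^ (2 * l) \<le> (2 * k) ^ (2 * l)" by (intro power_mono pj assms that pnorm_nonneg)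
    then show "pnorm m t ^ (2 * l) \<le> 4 ^ l * k ^ (2 * l)" by (simp add: power_mult power_mult_distrib)
  qed
  have "width l V q j t \<le> 2 * av + \<bar>gap l q j t\<bar>"
    unfolding width_def using sqrt_sum_squares_le_sum_abs[of "2 * av" "gap l q j t"] by (simp add: power_mult_distrib)
  also have "\<bar>gap l q j t\<bar> \<le> 4 ^ l * k ^ (2 * l)"
    unfolding gap_def using P(1)[OF insertI1] P(2)[OF insertI1]
      P(1)[OF insertI2[OF singletonI]] P(2)[OF insertI2[OF singletonI]] by linarith
  finally have w: "width l V q j t \<le> 2 * av + 4 ^ l * k ^ (2 * l)" by simp
  have "\<bar>lambda_hat l V q \<epsilon> j t\<bar> \<le> (pnorm j t ^ (2 * l) + pnorm (j - q) t ^ (2 * l)) / 2 + width l V q j t / 2"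
    unfolding lambda_hat_eq using assms P[of j] P[of "j - q"] width_pos[of j t] by (auto simp: abs_le_iff)
  also have "\<dots> \<le> 2 * 4 ^ l * k ^ (2 * l) + av"
    using P[of j] P[of "j - q"] w by (simp add: field_simps)
  also have "\<dots> \<le> (2 * 4 ^ l + av) * k ^ (2 * l)"
    using k1 av_pos one_le_power[OF k1, of "2 * l"] by (simp add: distrib_right)
  finally show ?thesis .
qed

definition rd :: real where "rd = circle_radius V q"

lemma rd: "rd = av / 10" "rd > 0" using av_pos by (simp_all add: rd_def circle_radius_def)

abbreviation "cZ \<equiv> size_const l av"

abbreviation "cM \<equiv> off_const l av"

abbreviation "cR \<equiv> resolvent_const l av"

lemma cR_def: "cR = cE / rd + cE * (1 / av + 2 * cL / av\<^sup>2) + 2 * (1 + 2 * cM + 2 * real l)"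
  by (simp add: resolvent_const_def rd(1))

lemma cM_nonneg: "cM \<ge> 0" using cL_nonneg av_pos by (simp add: off_const_def size_const_def)

lemma cR_nonneg: "cR \<ge> 0"
  unfolding cR_def using cE_nonneg cL_nonneg cM_nonneg av_pos rd(2)
  by (intro add_nonneg_nonneg mult_nonneg_nonneg divide_nonneg_pos) auto

text \<open>Far from the block the growth of $p_m^{2l-1}$ is absorbed by the resolvent itself:
  $p^{2l-1} \<le> k^{2l-1} + p^{2l}/k$.\<close>

lemma Pgrad_off:
  shows "\<rho> * norm (Pgrad l m t) \<le> 2 * real l * (1 + pnorm m t ^ (2 * l) / k ^ (2 * l))"
proof -
  define x where "x = pnorm m t"
  have x: "0 \<le> x" by (simp add: x_def pnorm_nonneg)
  have k0: "0 < k" using k1 by simp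
  have kl: "k ^ (2 * l) = k * k ^ (2 * l - 1)" and xl: "x ^ (2 * l) = x * x ^ (2 * l - 1)"
    using l_pos by (simp_all add: power_eq_if)
  have "x ^ (2 * l - 1) \<le> k ^ (2 * l - 1) + x ^ (2 * l) / k"
  proof (cases "x \<le> k")
    case True
    then have "x ^ (2 * l - 1) \<le> k ^ (2 * l - 1)" using x by (rule power_mono)
    then show ?thesis using x k0 by (simp add: add_increasing2)
  next
    case False
    then have "k * x ^ (2 * l - 1) \<le> x ^ (2 * l)" unfolding xl using x by (intro mult_right_mono) auto
    then have "x ^ (2 * l - 1) \<le> x ^ (2 * l) / k" using k0 by (simp add: pos_le_divide_eq mult.commute)
    then show ?thesis using k0 by (simp add: add_increasing)
  qed
  then have "\<rho> * (2 * real l * x ^ (2 * l - 1)) \<le> \<rho> * (2 * real l * (k ^ (2 * l - 1) + x ^ (2 * l) / k))"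
    using rho_pos by (intro mult_left_mono) auto
  also have "\<dots> = 2 * real l * (1 + x ^ (2 * l) / k ^ (2 * l))"
    unfolding rho_eq kl using k0 by (simp add: field_simps)
  finally show ?thesis unfolding norm_Pgrad[OF l_pos] x_def .
qed

text \<open>Since z moves with the eigenvalue of sign \<epsilon>, its distance to z is
  \<open>circ\<close>, independent of t, and the distance of the other eigenvalue to z involves only
  the width. So on the block no large quantity remains. Off the block \<open>off\<close> bounds
  |p_m^(2l) - z| below by \<kappa>^2/2 and the gradient is absorbed as in
  \<open>nb_inverse_leI\<close>.\<close>

lemma perturbation_boundsI:
  assumes e: "\<epsilon> \<in> {1, -1}" and kap: "\<kappa> \<ge> 1" "\<kappa>\<^sup>2 \<ge> 8 * rd"
    and off: "\<And>t m (z :: complex). t \<in> U \<Longrightarrow> m \<notin> {j, j - q} \<Longrightarrow> norm (z - of_real (lambda_hat l V q \<epsilon> j t)) = rd \<Longrightarrow>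
        \<kappa>\<^sup>2 \<le> 2 * norm (of_real (pnorm m t ^ (2 * l)) - z)"
  shows "perturbation_bounds U \<rho> l V q \<epsilon> j \<kappa> cR"
proof -
  interpret perturbation U \<rho> l V q \<epsilon> j \<kappa> cR
    by unfold_locales (use e kap cR_nonneg in auto)
  have rad: "rad = rd" by (simp add: rad_def rd_def)
  have e': "- \<epsilon> \<in> {1, -1}" using e by auto
  have nc: "norm (circ \<theta>) = rd" for \<theta>
    unfolding circ_def rad norm_mult using rd(2) by (simp add: norm_exp_eq_Re)
  have cc: "continuous_on {0..1} (\<lambda>\<theta>. - circ \<theta>)" unfolding circ_def[abs_def] by (intro continuous_intros)
  have lz: "of_real (lambda_hat l V q \<epsilon> j (fst p)) - zf p = - circ (snd p)" for p by (simp add: zf_def)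
  have lz': "of_real (lambda_hat l V q (- \<epsilon>) j (fst p)) - zf p = of_real (- \<epsilon> * width l V q j (fst p)) + - circ (snd p)" for p
    by (simp add: zf_def lambda_hat_eq)
  \<comment> \<open>The eigenvalues are at least 2|v_q| apart and the radius is |v_q|/10, which
    leaves more than |v_q|.\<close>
  have far: "av \<le> norm (complex_of_real (- \<epsilon> * width l V q j (fst p)) + - circ (snd p))" for p
  proof -
    have "norm (complex_of_real (- \<epsilon> * width l V q j (fst p))) = width l V q j (fst p)"
      using e width_pos[of j "fst p"] by (auto simp: norm_mult)
    then show ?thesis
      using norm_diff_ineq[of "complex_of_real (- \<epsilon> * width l V q j (fst p))" "- circ (snd p)"]
        width_ge[of j "fst p"] nc[of "snd p"] rd av_pos by (simp only: norm_minus_cancel)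
  qed
  have gw: "has_gradient U (\<lambda>t. - \<epsilon> * width l V q j t) (\<lambda>t. (- \<epsilon>) *\<^sub>R width_grad t)"
    unfolding has_gradient_def inner_scaleR_left
  proof (intro conjI ballI)
    show "((\<lambda>t. - \<epsilon> * width l V q j t) has_derivative (\<lambda>h. - \<epsilon> * (width_grad t \<bullet> h))) (at t)" if "t \<in> U" for t
      by (rule has_derivative_mult_right) (use has_gradient_width that in \<open>simp add: has_gradient_def\<close>)
    show "continuous_on U (\<lambda>t. - \<epsilon> *\<^sub>R width_grad t)"
      using has_gradient_width by (intro continuous_intros) (simp add: has_gradient_def)
  qed
  have nb1: "nb (\<lambda>p. 1 / - circ (snd p)) \<le> ennreal (1 / rd)"
  proof -
    have "nb (\<lambda>p. 1 / - circ (snd p)) \<le> ennreal (1 / rd + (0 / rd\<^sup>2 + 0 / rd))"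
      by (rule nb_inverse_leI[OF has_t_derivative_theta[OF cc]]) (use rd nc in auto)
    then show ?thesis by simp
  qed
  have nb2: "nb (\<lambda>p. 1 / (of_real (- \<epsilon> * width l V q j (fst p)) + - circ (snd p))) \<le> ennreal (1 / av + 2 * cL / av\<^sup>2)"
  proof -
    have "nb (\<lambda>p. 1 / (of_real (- \<epsilon> * width l V q j (fst p)) + - circ (snd p))) \<le> ennreal (1 / av + (2 * cL / av\<^sup>2 + 0 / av))"
    proof (rule nb_inverse_leI[OF has_t_derivative_add[OF has_t_derivative_real[OF gw] has_t_derivative_theta[OF cc]] far av_pos])
      fix p assume "p \<in> D"
      then have t: "fst p \<in> U" by (auto simp: D_def)
      have "\<rho> * norm (cgrad (- \<epsilon> *\<^sub>R width_grad (fst p))) \<le> \<rho> * norm (- \<epsilon> *\<^sub>R width_grad (fst p))"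
        using rho_pos by (intro mult_left_mono norm_cgrad) auto
      also have "norm (- \<epsilon> *\<^sub>R width_grad (fst p)) = norm (width_grad (fst p))" using e by auto
      finally show "\<rho> * norm (cgrad (- \<epsilon> *\<^sub>R width_grad (fst p)) + 0)
        \<le> 2 * cL + 0 * norm (complex_of_real (- \<epsilon> * width l V q j (fst p)) + - circ (snd p))"
        using width_grad_le[OF t] by simp
    qed (use cL_nonneg in auto)
    then show ?thesis by simp
  qed
  show ?thesis
  proof
    fix s r assume sr: "s \<in> {j, j - q}" "r \<in> {j, j - q}"
    have "nb (\<lambda>p. Rf p s r) = nb (\<lambda>p. block_proj l V q \<epsilon> j (fst p) s r * (1 / - circ (snd p))
       + block_proj l V q (- \<epsilon>) j (fst p) s r * (1 / (of_real (- \<epsilon> * width l V q j (fst p)) + - circ (snd p))))"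
      using sr unfolding Rf_def block_resolvent_def lz lz' by simp
    also have "\<dots> \<le> ennreal cE * ennreal (1 / rd) + ennreal cE * ennreal (1 / av + 2 * cL / av\<^sup>2)"
      by (intro order_trans[OF nb_add] add_mono order_trans[OF nb_mult] mult_mono nb1 nb2 nb_block_proj e e') auto
    also have "\<dots> = ennreal (cE * (1 / rd) + cE * (1 / av + 2 * cL / av\<^sup>2))"
      using cE_nonneg cL_nonneg av_pos rd(2)
      by (subst (1 2) ennreal_mult[symmetric], auto intro!: ennreal_plus[symmetric] mult_nonneg_nonneg add_nonneg_nonneg)
    also have "\<dots> \<le> ennreal cR"
      unfolding cR_def using cM_nonneg by (intro ennreal_leI) simp
    finally show "nb (\<lambda>p. Rf p s r) \<le> ennreal cR" .
  next
    fix s assume s: "s \<notin> {j, j - q}"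
    define f where "f p = (complex_of_real (pnorm s (fst p) ^ (2 * l)) + complex_of_real (- lambda_hat l V q \<epsilon> j (fst p))) + - circ (snd p)" for p :: "(real ^ 'n) \<times> real"
    define f' where "f' p = (cgrad (Pgrad l s (fst p)) + cgrad (- lam_grad \<epsilon> (fst p))) + 0" for p :: "(real ^ 'n) \<times> real"
    have fz: "f p = of_real (pnorm s (fst p) ^ (2 * l)) - zf p" for p by (simp add: f_def zf_def)
    have gl: "has_gradient U (\<lambda>t. - lambda_hat l V q \<epsilon> j t) (\<lambda>t. - lam_grad \<epsilon> t)"
      unfolding has_gradient_def inner_minus_left
    proof (intro conjI ballI)
      show "((\<lambda>t. - lambda_hat l V q \<epsilon> j t) has_derivative (\<lambda>h. - (lam_grad \<epsilon> t \<bullet> h))) (at t)" if "t \<in> U" for t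
        by (rule has_derivative_minus) (use has_gradient_lambda_hat that in \<open>simp add: has_gradient_def\<close>)
      show "continuous_on U (\<lambda>t. - lam_grad \<epsilon> t)"
        using has_gradient_lambda_hat[of \<epsilon>] by (intro continuous_intros) (simp add: has_gradient_def)
    qed
    have ht: "has_t_derivative f f'"
      unfolding f_def[abs_def] f'_def[abs_def]
      by (intro has_t_derivative_add has_t_derivative_real has_gradient_pnorm gl has_t_derivative_theta cc)
    have nk: "0 < \<kappa>\<^sup>2 / 2" using kap by simp
    have "nb (\<lambda>p. 1 / f p) \<le> ennreal (1 / (\<kappa>\<^sup>2 / 2) + (cM / (\<kappa>\<^sup>2 / 2)\<^sup>2 + 2 * real l / (\<kappa>\<^sup>2 / 2)))"
    proof (rule nb_inverse_leI[OF ht _ nk])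
      fix p assume p: "p \<in> D"
      then have t: "fst p \<in> U" by (auto simp: D_def)
      have "norm (zf p - of_real (lambda_hat l V q \<epsilon> j (fst p))) = rd" by (simp add: zf_def nc)
      from off[OF t s this] show "\<kappa>\<^sup>2 / 2 \<le> norm (f p)" unfolding fz by simp
      define x where "x = pnorm s (fst p) ^ (2 * l)"
      have x0: "0 \<le> x" unfolding x_def by (intro zero_le_power pnorm_nonneg)
      have kp: "1 \<le> k ^ (2 * l)" using k1 by (rule one_le_power)
      have "norm (zf p) \<le> \<bar>lambda_hat l V q \<epsilon> j (fst p)\<bar> + rd"
        unfolding zf_def by (rule order_trans[OF norm_triangle_ineq]) (simp add: nc)
      also have "\<dots> \<le> (2 * 4 ^ l + av) * k ^ (2 * l) + av * k ^ (2 * l)"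
      proof (rule add_mono[OF lambda_hat_bound[OF e t]])
        show "rd \<le> av * k ^ (2 * l)" using mult_left_mono[OF kp, of av] rd av_pos by linarith
      qed
      also have "\<dots> = cZ * k ^ (2 * l)" by (simp add: size_const_def algebra_simps)
      finally have zn: "norm (zf p) \<le> cZ * k ^ (2 * l)" .
      have "x = norm (complex_of_real x)" using x0 by simp
      \<comment> \<open>p_m^(2l) is at most |f| + |z|, and |z| is of order k^(2l); after division by
        k^(2l) the gradient bound is affine in |f|, as \<open>nb_inverse_leI\<close>
        requires.\<close>
      also have "\<dots> \<le> norm (f p) + norm (zf p)"
        using norm_triangle_ineq[of "f p" "zf p"] unfolding fz x_def by simp
      finally have "x \<le> norm (f p) + cZ * k ^ (2 * l)" using zn by simp
      then have "x / k ^ (2 * l) \<le> (norm (f p) + cZ * k ^ (2 * l)) / k ^ (2 * l)"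
        using kp by (intro divide_right_mono) auto
      also have "\<dots> = norm (f p) / k ^ (2 * l) + cZ" using k1 by (simp add: add_divide_distrib)
      also have "\<dots> \<le> norm (f p) + cZ"
        using kp divide_left_mono[OF kp, of "norm (f p)"] by (simp add: mult_le_cancel_left1)
      finally have xk: "x / k ^ (2 * l) \<le> norm (f p) + cZ" .
      have "norm (f' p) \<le> norm (Pgrad l s (fst p)) + norm (lam_grad \<epsilon> (fst p))"
        unfolding f'_def using norm_cgrad[of "Pgrad l s (fst p)"] norm_cgrad[of "- lam_grad \<epsilon> (fst p)"]
        by (simp add: norm_triangle_le)
      then have "\<rho> * norm (f' p) \<le> \<rho> * (norm (Pgrad l s (fst p)) + norm (lam_grad \<epsilon> (fst p)))"
        by (rule mult_left_mono) (use rho_pos in simp)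
      also have "\<dots> \<le> 2 * real l * (1 + (norm (f p) + cZ)) + 2 * cL"
      proof -
        have "2 * real l * (1 + x / k ^ (2 * l)) \<le> 2 * real l * (1 + (norm (f p) + cZ))"
          by (intro mult_left_mono add_left_mono xk) simp
        then show ?thesis
          using Pgrad_off[of s "fst p"] lam_grad_le[OF e t] unfolding x_def distrib_left[of \<rho>] by linarith
      qed
      also have "\<dots> = cM + 2 * real l * norm (f p)" by (simp add: off_const_def algebra_simps)
      finally show "\<rho> * norm (f' p) \<le> cM + 2 * real l * norm (f p)" .
    qed (use cM_nonneg in auto)
    also have "\<dots> \<le> ennreal (cR / \<kappa>\<^sup>2)"
    proof (rule ennreal_leI)
      have k2: "1 \<le> \<kappa>\<^sup>2" using kap(1) by (rule one_le_power)
      \<comment> \<open>The quadratic term decays even faster than needed; one factor 1/\<kappa>^2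
        is given away.\<close>
      have "cM / (\<kappa>\<^sup>2 / 2)\<^sup>2 \<le> 4 * cM / \<kappa>\<^sup>2"
      proof -
        have "cM / (\<kappa>\<^sup>2 / 2)\<^sup>2 = 4 * cM / (\<kappa>\<^sup>2 * \<kappa>\<^sup>2)" by (simp add: power2_eq_square)
        also have "\<dots> \<le> 4 * cM / \<kappa>\<^sup>2"
          using cM_nonneg k2 mult_left_mono[OF k2, of "\<kappa>\<^sup>2"] by (intro divide_left_mono) auto
        finally show ?thesis .
      qed
      then have "1 / (\<kappa>\<^sup>2 / 2) + (cM / (\<kappa>\<^sup>2 / 2)\<^sup>2 + 2 * real l / (\<kappa>\<^sup>2 / 2))
        \<le> (2 + 4 * cM + 4 * real l) / \<kappa>\<^sup>2" by (simp add: add_divide_distrib)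
      also have "\<dots> \<le> cR / \<kappa>\<^sup>2"
      proof (rule divide_right_mono)
        have "0 \<le> cE / rd + cE * (1 / av + 2 * cL / av\<^sup>2)"
          using cE_nonneg cL_nonneg av_pos rd(2) by (intro add_nonneg_nonneg mult_nonneg_nonneg divide_nonneg_pos) auto
        then have "2 * (1 + 2 * cM + 2 * real l) \<le> cR"
          unfolding cR_def by (rule add_increasing[OF _ order_refl])
        then show "2 + 4 * cM + 4 * real l \<le> cR" by simp
      qed simp
      finally show "1 / (\<kappa>\<^sup>2 / 2) + (cM / (\<kappa>\<^sup>2 / 2)\<^sup>2 + 2 * real l / (\<kappa>\<^sup>2 / 2)) \<le> cR / \<kappa>\<^sup>2" .
    qed
    finally show "nb (\<lambda>p. Rf p s s) \<le> ennreal (cR / \<kappa>\<^sup>2)"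
      using s unfolding Rf_def block_resolvent_def fz by simp
  next
    fix p assume "p \<in> D"
    show "zf p \<noteq> of_real (lambda_hat l V q (- \<epsilon>) j (fst p))"
      using far[of p] av_pos unfolding lz'[symmetric] by auto
  next
    fix t s and z :: complex
    assume t: "t \<in> U" and s: "s \<notin> {j, j - q}" and z: "norm (z - of_real (lambda_hat l V q \<epsilon> j t)) < 2 * rad"
    define \<mu> where "\<mu> = lambda_hat l V q \<epsilon> j t"
    define P where "P = pnorm s t ^ (2 * l)"
    \<comment> \<open>The hypothesis speaks of the circle only. Its two real points \<mu> + rd and
      \<mu> - rd suffice: the real number P is at distance at least 4 rd from both, hence at least 3
      rd from \<mu>, and so at least rd from the disk of radius 2 rd.\<close>
    have "8 * rd \<le> 2 * norm (complex_of_real P - of_real (\<mu> + rd))" "8 * rd \<le> 2 * norm (complex_of_real P - of_real (\<mu> - rd))"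
      using off[OF t s, of "of_real (\<mu> + rd)"] off[OF t s, of "of_real (\<mu> - rd)"] kap(2) rd(2)
      unfolding P_def \<mu>_def by (auto simp: algebra_simps)
    then have "4 * rd \<le> \<bar>P - (\<mu> + rd)\<bar>" "4 * rd \<le> \<bar>P - (\<mu> - rd)\<bar>"
      unfolding of_real_diff[symmetric] norm_of_real by simp_all
    then have "3 * rd \<le> \<bar>P - \<mu>\<bar>" using rd(2) by linarith
    then have "3 * rd \<le> norm (complex_of_real P - of_real \<mu>)" unfolding of_real_diff[symmetric] norm_of_real .
    then show "rad \<le> norm (of_real (pnorm s t ^ (2 * l)) - z)"
      using z norm_triangle_ineq[of "complex_of_real P - z" "z - of_real \<mu>"] unfolding rad P_def \<mu>_def by simp
  qed
qed

end

section \<open>Choice of the constants and conclusion\<close>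

lemma pnorm_triangle: "pnorm m t \<le> pnorm m t\<^sub>0 + dist t t\<^sub>0"
  using norm_triangle_ineq[of "lat m + t\<^sub>0" "t - t\<^sub>0"] by (simp add: pnorm_def Pvec_def dist_norm)

lemma pnorm_shift: "pnorm (m - m') t \<le> pnorm m t + norm (lat m')"
  using norm_triangle_ineq4[of "lat m + t" "lat m'"] by (simp add: pnorm_def Pvec_def lat_diff algebra_simps)

theorem theorem27:
  fixes V :: "real ^ 'n::finite \<Rightarrow> complex" and q :: "int ^ 'n" and l :: nat and R\<^sub>0 :: real
  assumes "l > 0" and "2 * l > CARD('n)"
    and "real_trig_poly R\<^sub>0 V" and "\<exists>x. V x \<noteq> 0"
    and "q \<noteq> 0" and "fourier_coeff V q \<noteq> 0"
  shows "\<exists>C>0. \<forall>\<gamma>\<^sub>2>0. \<forall>\<delta>>0. 9 * \<delta> < 2 * real l - real CARD('n) \<longrightarrow>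
    (\<exists>k\<^sub>0>0. \<forall>X.
      (\<forall>k>k\<^sub>0. resonant_set l V q \<delta> k (X k)) \<and> asymptotically_full q \<delta> X \<longrightarrow>
      (\<forall>k>k\<^sub>0. \<forall>\<sigma>::real. \<forall>A::complex. \<bar>\<sigma>\<bar> * (norm A)\<^sup>2 < k powr (- \<gamma>\<^sub>2) \<longrightarrow>
        (\<forall>t\<^sub>0\<in>X k. \<forall>j. attached_index q \<delta> k t\<^sub>0 j \<longrightarrow>
          (\<forall>t\<in>Kcell. dist t t\<^sub>0 < k powr (- real CARD('n) + 1 - 7 * \<delta>) \<longrightarrow>
            (\<forall>\<epsilon>\<in>{1, -1}.
              let \<gamma>\<^sub>1 = (2 * real l - real CARD('n) - 8 * \<delta>) / 2;
                  \<gamma> = min \<gamma>\<^sub>1 \<gamma>\<^sub>2;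
                  dE = (\<lambda>s r \<tau>. E_sol l V q \<sigma> A \<epsilon> j \<tau> s r - E_hat l V q \<epsilon> j \<tau> s r);
                  dlam = (\<lambda>\<tau>. lambda_sol l V q \<sigma> A \<epsilon> j \<tau> - of_real (lambda_hat l V q \<epsilon> j \<tau>))
              in (\<forall>s r. dE s r differentiable (at t))
                 \<and> norm0 (\<lambda>s r. grad (dE s r) t) < ennreal (C * k powr (2 * real l - 1 - \<gamma>))
                 \<and> dlam differentiable (at t)
                 \<and> norm (grad dlam t) < C * k powr (2 * real l - 1 - \<gamma>))))))"
proof -
  note V_facts = real_trig_poly_tser[OF assms(3) assms(6)]
  interpret resonant_potential l V q
    by unfold_locales
       (use assms V_facts(3) in \<open>auto simp: real_trig_poly_def intro!: fourier_coeff_uminus_real\<close>)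
  define v0 where "v0 = (\<Sum>\<^sub>\<infinity>m. norm (fourier_coeff V m))"
  define av where "av = norm vq"
  define rd where "rd = av / 10"
  define cR where "cR = resolvent_const l av"
  define cE where "cE = proj_const l av"
  define e0 where "e0 = 2 * cE + 1"
  \<comment> \<open>With T and 1/\<kappa> both at most k^(-\<gamma>), the smallness parameter of the
    series is at most 2 cR G k^(-\<gamma>).\<close>
  define G where "G = 2 * e0\<^sup>2 + v0 + 1"
  define N where "N = real CARD('n)"
  \<comment> \<open>The terms 8 rd and 4 rd cR come from the eigenvalue and the projection; their
    sum dominates both. The added 1 makes the inequalities strict. Neither \<delta> nor
    \<open>\<gamma>\<^sub>2\<close> occurs.\<close>
  define C where "C = N * (8 * rd + 4 * rd * cR) * (2 * cR * G) + 1"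
  \<comment> \<open>Each requirement on k has the form k^(-\<gamma>) a \<le> 1; the summands after 1
    are these numbers a, for \<kappa>^2 \<ge> 8 rd and for the four conditions of
    \<open>fixed_point\<close>, so k^(-\<gamma>) S \<le> 1 gives all of them.\<close>
  define S where "S = 1 + 8 * rd + 2 * e0\<^sup>2 + 4 * cR * G + 8 * rd * cR\<^sup>2 * G + 64 * e0 * rd * cR\<^sup>2"
  have av: "av > 0" using Vq by (simp add: av_def)
  have gc: "grad_const l \<ge> 0" by (simp add: grad_const_def)
  have nn: "0 < rd" "0 \<le> cR" "0 \<le> cE" "1 \<le> e0" "0 \<le> v0" "0 \<le> G" "0 < N"
  proof -
    show "0 < rd" using av by (simp add: rd_def)
    show "0 \<le> cE" using gc av by (simp add: cE_def proj_const_def)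
    then have *: "0 \<le> cE / (av / 10) + cE * (1 / av + 2 * grad_const l / av\<^sup>2)"
      using av gc by (intro add_nonneg_nonneg mult_nonneg_nonneg divide_nonneg_pos) auto
    show "0 \<le> cR" unfolding cR_def resolvent_const_def cE_def[symmetric] off_const_def size_const_def
      by (rule add_nonneg_nonneg[OF *])
         (use av gc in \<open>intro mult_nonneg_nonneg add_nonneg_nonneg; simp\<close>)
    show "1 \<le> e0" using \<open>0 \<le> cE\<close> by (simp add: e0_def)
    show "0 \<le> v0" by (simp add: v0_def infsum_nonneg)
    then show "0 \<le> G" by (simp add: G_def)
    show "0 < N" by (simp add: N_def)
  qed
  have V_norm: "esum (\<lambda>m. ennreal (norm (fourier_coeff V m))) \<le> ennreal v0"
    using infsum_nonneg_is_SUPREMUM_ennreal[OF V_facts(2)]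
    by (simp add: v0_def esum_eq_infsum[symmetric] nonneg_infsum_complete sum_ennreal)
  have C_pos: "C > 0" unfolding C_def using nn by (intro add_nonneg_pos mult_nonneg_nonneg add_nonneg_nonneg) auto
  have S1: "S \<ge> 1" unfolding S_def using nn
    by (simp add: add_nonneg_nonneg)
  show ?thesis
  proof (rule exI[of _ C], intro conjI C_pos allI impI)
    fix \<gamma>\<^sub>2 \<delta> :: real assume g2: "\<gamma>\<^sub>2 > 0" and d: "\<delta> > 0" "9 * \<delta> < 2 * real l - real CARD('n)"
    define \<gamma>\<^sub>1 where "\<gamma>\<^sub>1 = (2 * real l - real CARD('n) - 8 * \<delta>) / 2"
    define \<gamma> where "\<gamma> = min \<gamma>\<^sub>1 \<gamma>\<^sub>2"
    have g: "\<gamma> > 0" "\<gamma> \<le> \<gamma>\<^sub>1" "\<gamma> \<le> \<gamma>\<^sub>2" 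
    proof -
      have "0 < \<gamma>\<^sub>1" using d by (simp add: \<gamma>\<^sub>1_def)
      then show "\<gamma> > 0" using g2 by (simp add: \<gamma>_def)
    qed (simp_all add: \<gamma>_def)
    \<comment> \<open>The first entry ensures k + 2 + |q| \<le> 2k, the bound on p_j and p_(j-q)
      near the resonant point; the second ensures k^(-\<gamma>) S \<le> 1.\<close>
    define k0 where "k0 = max (2 + norm (lat q)) (S powr (1 / \<gamma>))"
    show "\<exists>k\<^sub>0>0. \<forall>X.
      (\<forall>k>k\<^sub>0. resonant_set l V q \<delta> k (X k)) \<and> asymptotically_full q \<delta> X \<longrightarrow>
      (\<forall>k>k\<^sub>0. \<forall>\<sigma>::real. \<forall>A::complex. \<bar>\<sigma>\<bar> * (norm A)\<^sup>2 < k powr (- \<gamma>\<^sub>2) \<longrightarrow>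
        (\<forall>t\<^sub>0\<in>X k. \<forall>j. attached_index q \<delta> k t\<^sub>0 j \<longrightarrow>
          (\<forall>t\<in>Kcell. dist t t\<^sub>0 < k powr (- real CARD('n) + 1 - 7 * \<delta>) \<longrightarrow>
            (\<forall>\<epsilon>\<in>{1, -1}.
              let \<gamma>\<^sub>1 = (2 * real l - real CARD('n) - 8 * \<delta>) / 2;
                  \<gamma> = min \<gamma>\<^sub>1 \<gamma>\<^sub>2;
                  dE = (\<lambda>s r \<tau>. E_sol l V q \<sigma> A \<epsilon> j \<tau> s r - E_hat l V q \<epsilon> j \<tau> s r);
                  dlam = (\<lambda>\<tau>. lambda_sol l V q \<sigma> A \<epsilon> j \<tau> - of_real (lambda_hat l V q \<epsilon> j \<tau>))
              in (\<forall>s r. dE s r differentiable (at t))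
                 \<and> norm0 (\<lambda>s r. grad (dE s r) t) < ennreal (C * k powr (2 * real l - 1 - \<gamma>))
                 \<and> dlam differentiable (at t)
                 \<and> norm (grad dlam t) < C * k powr (2 * real l - 1 - \<gamma>)))))"
    proof (rule exI[of _ k0], intro conjI allI impI ballI)
      show "k0 > 0" by (simp add: k0_def add_pos_nonneg less_max_iff_disj)
      fix X k \<sigma> A t\<^sub>0 j t and \<epsilon> :: real
      assume X: "(\<forall>k>k0. resonant_set l V q \<delta> k (X k)) \<and> asymptotically_full q \<delta> X"
        and k: "k0 < k" and sA: "\<bar>\<sigma>\<bar> * (norm (A :: complex))\<^sup>2 < k powr (- \<gamma>\<^sub>2)"
        and t0: "t\<^sub>0 \<in> X k" and att: "attached_index q \<delta> k t\<^sub>0 j"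
        and t: "dist t t\<^sub>0 < k powr (- real CARD('n) + 1 - 7 * \<delta>)" and e: "\<epsilon> \<in> {1, -1}"
      \<comment> \<open>The resonant set guarantees its estimates on twice the neighborhood of the
        conclusion; this ball is open and convex, and the index j is fixed throughout it.\<close>
      define U where "U = ball t\<^sub>0 (2 * k powr (- real CARD('n) + 1 - 7 * \<delta>))"
      define \<rho> where "\<rho> = 1 / k ^ (2 * l - 1)"
      define \<kappa> where "\<kappa> = k powr ((2 * real l - real CARD('n) - 6 * \<delta>) / 2)"
      define T where "T = k powr (- \<gamma>\<^sub>2)"
      define x where "x = k powr (- \<gamma>)"
      have kq: "2 + norm (lat q) \<le> k" using k by (simp add: k0_def)
      then have k1: "1 \<le> k" using norm_ge_zero[of "lat q"] by linarith
      have xS: "x * S \<le> 1"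
      proof -
        have "S powr (1 / \<gamma>) \<le> k" using k by (simp add: k0_def)
        then have "k powr (- \<gamma>) \<le> (S powr (1 / \<gamma>)) powr (- \<gamma>)"
          using g(1) S1 by (intro powr_mono2') auto
        also have "\<dots> = 1 / S" using g(1) S1 by (simp add: powr_powr powr_minus_divide)
        finally show ?thesis using S1 by (simp add: x_def field_simps)
      qed
      have x0: "0 \<le> x" by (simp add: x_def)
      have term_le: "x * a \<le> 1" if "a \<le> S" for a
        using mult_left_mono[OF that x0] xS by linarith
      have Tx: "T \<le> x" "0 \<le> T" unfolding T_def x_def using g(3) k1 by (auto intro: powr_mono)
      \<comment> \<open>The exponent of \<kappa> is \<open>\<gamma>\<^sub>1\<close> + \<delta>, so
        1/\<kappa> is even smaller than k to the power \<open>- \<gamma>\<^sub>1\<close>.\<close>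
      have kx: "1 / \<kappa> \<le> x"
      proof -
        have "1 / \<kappa> = k powr (- ((2 * real l - real CARD('n) - 6 * \<delta>) / 2))" by (simp add: \<kappa>_def powr_minus_divide)
        also have "\<dots> \<le> k powr (- \<gamma>)" using g(2) d k1 by (intro powr_mono) (auto simp: \<gamma>\<^sub>1_def field_simps)
        finally show ?thesis by (simp add: x_def)
      qed
      have kappa1: "\<kappa> \<ge> 1" unfolding \<kappa>_def using k1 d by (intro ge_one_powr_ge_zero) auto
      have pos: "0 \<le> 8 * rd" "0 \<le> 2 * e0\<^sup>2" "0 \<le> 4 * cR * G" "0 \<le> 8 * rd * cR\<^sup>2 * G" "0 \<le> 64 * e0 * rd * cR\<^sup>2"
        using nn by auto
      have kappa2: "8 * rd \<le> \<kappa>\<^sup>2"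
      proof -
        have "8 * rd * (1 / \<kappa>) \<le> 8 * rd * x" by (rule mult_left_mono[OF kx pos(1)])
        also have "\<dots> \<le> 1" using term_le[of "8 * rd"] pos by (simp add: S_def mult.commute)
        finally have "8 * rd \<le> \<kappa>" using kappa1 by (simp add: field_simps)
        also have "\<dots> \<le> \<kappa>\<^sup>2" using kappa1 by (simp add: power2_eq_square)
        finally show ?thesis .
      qed
      have ksq: "\<kappa>\<^sup>2 = k powr (2 * real l - real CARD('n) - 6 * \<delta>)"
        unfolding \<kappa>_def power2_eq_square by (simp add: powr_add[symmetric])
      have rad: "circle_radius V q = rd" by (simp add: circle_radius_def rd_def av_def)
      have r2: "k powr (- real CARD('n) + 1 - 7 * \<delta>) \<le> 1"
      proof -
        have "1 \<le> real CARD('n)" by (simp add: Suc_leI)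
        then have "- real CARD('n) + 1 - 7 * \<delta> \<le> 0" using d by linarith
        then have "k powr (- real CARD('n) + 1 - 7 * \<delta>) \<le> k powr 0" using k1 by (rule powr_mono)
        then show ?thesis using k1 by simp
      qed
      have tU: "t \<in> U" unfolding U_def mem_ball dist_commute[of t\<^sub>0 t] using t zero_le_dist[of t t\<^sub>0] by linarith
      have pj0: "pnorm j t\<^sub>0 = k" using att by (simp add: attached_index_def Sq_def pnorm_def)
      have res: "\<kappa>\<^sup>2 \<le> 2 * norm (of_real (pnorm m \<tau> ^ (2 * l)) - z)"
        if "\<tau> \<in> U" "m \<notin> {j, j - q}" "norm (z - complex_of_real (lambda_hat l V q \<epsilon> j \<tau>)) = rd" for \<tau> m z
      proof -
        have dd: "dist \<tau> t\<^sub>0 < 2 * k powr (- real CARD('n) + 1 - 7 * \<delta>)"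
          using that(1) by (simp add: U_def dist_commute)
        have "resonant_set l V q \<delta> k (X k)" using X k by blast
        then have "\<forall>\<epsilon>\<in>{1, -1}. \<forall>z::complex. norm (z - of_real (lambda_hat l V q \<epsilon> j \<tau>)) = circle_radius V q \<longrightarrow>
          (\<forall>m. m \<noteq> j \<and> m \<noteq> j - q \<longrightarrow>
            2 * norm (of_real (pnorm m \<tau> ^ (2 * l)) - z) \<ge> k powr (2 * real l - real CARD('n) - 6 * \<delta>))"
          unfolding resonant_set_def using t0 att dd by blast
        then have "2 * norm (of_real (pnorm m \<tau> ^ (2 * l)) - z) \<ge> k powr (2 * real l - real CARD('n) - 6 * \<delta>)"
          using e that(2,3) rad by auto
        then show ?thesis unfolding ksq .
      qed
      interpret E: resonance_estimates U \<rho> l V q j k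
      proof unfold_locales
        show "open U" "convex U" by (simp_all add: U_def)
        show "\<rho> > 0" using k1 by (simp add: \<rho>_def)
        show "\<rho> = 1 / k ^ (2 * l - 1)" by (rule \<rho>_def)
        fix \<tau> m assume tau: "\<tau> \<in> U" and m: "m \<in> {j, j - q}"
        have "dist \<tau> t\<^sub>0 \<le> 2" using tau r2 by (simp add: U_def dist_commute)
        then have "pnorm j \<tau> \<le> k + 2" using pnorm_triangle[of j \<tau> t\<^sub>0] pj0 by simp
        moreover have "pnorm (j - q) \<tau> \<le> pnorm j \<tau> + norm (lat q)" by (rule pnorm_shift)
        ultimately show "pnorm m \<tau> \<le> 2 * k" using m kq norm_ge_zero[of "lat q"] by (auto simp del: norm_ge_zero)
      qed (use assms k1 in auto)
      have pb: "perturbation_bounds U \<rho> l V q \<epsilon> j \<kappa> cR"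
        unfolding cR_def av_def
        by (rule E.perturbation_boundsI[OF e kappa1])
           (use kappa2 res in \<open>simp_all only: E.rd_def rad\<close>)
      have cc: "2 * cR * (2 * T * e0\<^sup>2 + (v0 + 1) / \<kappa>) \<le> 2 * cR * G * x"
      proof -
        have "2 * T * e0\<^sup>2 \<le> 2 * x * e0\<^sup>2" using Tx by (intro mult_right_mono) auto
        moreover have "(v0 + 1) * (1 / \<kappa>) \<le> (v0 + 1) * x" using nn kx by (intro mult_left_mono) auto
        ultimately have "2 * T * e0\<^sup>2 + (v0 + 1) / \<kappa> \<le> G * x" by (simp add: G_def algebra_simps)
        then have "2 * cR * (2 * T * e0\<^sup>2 + (v0 + 1) / \<kappa>) \<le> 2 * cR * (G * x)" using nn by (intro mult_left_mono) auto
        then show ?thesis by (simp add: mult.assoc)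
      qed
      have sm2: "2 * cR * (2 * T * e0\<^sup>2 + (v0 + 1) / \<kappa>) \<le> 1 / 2"
      proof -
        have "x * (4 * cR * G) \<le> 1" using pos by (intro term_le) (simp add: S_def)
        then have "2 * cR * G * x \<le> 1 / 2" by (simp add: mult_ac)
        with cc show ?thesis by (rule order_trans)
      qed
      have sm3: "4 * rd * cR * (2 * cR * (2 * T * e0\<^sup>2 + (v0 + 1) / \<kappa>)) \<le> 1"
      proof -
        have "4 * rd * cR * (2 * cR * (2 * T * e0\<^sup>2 + (v0 + 1) / \<kappa>)) \<le> 4 * rd * cR * (2 * cR * G * x)"
          using nn by (intro mult_left_mono cc) auto
        also have "\<dots> = x * (8 * rd * cR\<^sup>2 * G)" by (simp add: power2_eq_square)
        also have "\<dots> \<le> 1" using pos by (intro term_le) (simp add: S_def)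
        finally show ?thesis .
      qed
      have sm1: "2 * T * e0\<^sup>2 \<le> 1"
      proof -
        have "2 * T * e0\<^sup>2 \<le> x * (2 * e0\<^sup>2)" using Tx mult_right_mono[OF Tx(1), of "2 * e0\<^sup>2"] by simp
        also have "\<dots> \<le> 1" using pos by (intro term_le) (simp add: S_def)
        finally show ?thesis .
      qed
      have sm4: "T * (32 * e0 * rd * cR\<^sup>2) \<le> 1 / 2"
      proof -
        have "x * (64 * e0 * rd * cR\<^sup>2) \<le> 1" using pos by (intro term_le) (simp add: S_def)
        moreover have "T * (32 * e0 * rd * cR\<^sup>2) \<le> x * (32 * e0 * rd * cR\<^sup>2)"
          using Tx nn by (intro mult_right_mono) auto
        ultimately show ?thesis by simp
      qed
      have radp: "perturbation.rad V q = rd"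
        using perturbation.rad_def[OF perturbation_bounds.axioms(1)[OF pb]] rad by simp
      have "fixed_point U \<rho> l V q \<epsilon> j \<kappa> cR cE v0 T \<sigma> A"
      proof (intro fixed_point.intro fixed_point_axioms.intro)
        show "perturbation_bounds U \<rho> l V q \<epsilon> j \<kappa> cR" by (rule pb)
        show "0 \<le> cE" "0 \<le> v0" using nn by auto
        show "V = tser (fourier_coeff V)" by (rule V_facts(1))
        show "esum (\<lambda>m. ennreal (norm (fourier_coeff V m))) \<le> ennreal v0" by (rule V_norm)
        show "\<bar>\<sigma>\<bar> * (norm A)\<^sup>2 \<le> T" using sA by (simp add: T_def)
        show "E.nb (\<lambda>p. block_proj l V q \<epsilon> j (fst p) s r) \<le> ennreal cE" for s r
          unfolding cE_def av_def by (rule E.nb_block_proj[OF e])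
      qed (use sm1 sm2 sm3 sm4 in \<open>simp_all only: e0_def[symmetric] radp\<close>)
      then interpret F: fixed_point U \<rho> l V q \<epsilon> j \<kappa> cR cE v0 T \<sigma> A .
      have Fcc: "F.cc \<le> 2 * cR * G * x" using cc unfolding F.cc_def F.e0_def e0_def[symmetric] .
      \<comment> \<open>Dividing by \<rho> restores the factor k^(2l-1), which combines with
        k^(-\<gamma>) to the asserted power.\<close>
      have pw: "N / \<rho> * (a * (2 * cR * G * x)) = (N * a * (2 * cR * G)) * k powr (2 * real l - 1 - \<gamma>)" for a
      proof -
        have "1 / \<rho> = k powr (2 * real l - 1)"
          using powr_realpow[of k "2 * l - 1"] k1 assms(1) by (simp add: \<rho>_def of_nat_diff)
        then have "1 / \<rho> * x = k powr (2 * real l - 1 - \<gamma>)" by (simp add: x_def powr_add[symmetric])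
        then show ?thesis by (metis (no_types, opaque_lifting) mult.assoc mult.commute times_divide_eq_left mult_1)
      qed
      have kp: "0 < k powr (2 * real l - 1 - \<gamma>)" using k1 by simp
      have CE: "N * a * (2 * cR * G) < C" if "0 \<le> a" "a \<le> 8 * rd + 4 * rd * cR" for a
      proof -
        have "N * a * (2 * cR * G) \<le> N * (8 * rd + 4 * rd * cR) * (2 * cR * G)"
          using that nn by (intro mult_right_mono mult_left_mono) auto
        also have "\<dots> < C" unfolding C_def by (rule less_add_one)
        finally show ?thesis .
      qed
      have key: "N / \<rho> * (a * F.cc) < C * k powr (2 * real l - 1 - \<gamma>)" if "0 \<le> a" "a \<le> 8 * rd + 4 * rd * cR" for a
      proof -
        have "N / \<rho> * (a * F.cc) \<le> N / \<rho> * (a * (2 * cR * G * x))"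
          using that nn E.rho_pos by (intro mult_left_mono Fcc) auto
        also have "\<dots> = (N * a * (2 * cR * G)) * k powr (2 * real l - 1 - \<gamma>)" by (rule pw)
        also have "\<dots> < C * k powr (2 * real l - 1 - \<gamma>)" by (rule mult_strict_right_mono[OF CE[OF that] kp])
        finally show ?thesis .
      qed
      have gE: "norm0 (\<lambda>s r. grad (\<lambda>\<tau>. E_sol l V q \<sigma> A \<epsilon> j \<tau> s r - E_hat l V q \<epsilon> j \<tau> s r) t)
          < ennreal (C * k powr (2 * real l - 1 - \<gamma>))"
      proof (rule le_less_trans[OF F.gradient_bounds(2)[OF tU]])
        have "N / \<rho> * (4 * rd * cR * F.cc) < C * k powr (2 * real l - 1 - \<gamma>)" by (rule key) (use nn in auto)
        then show "ennreal (real CARD('n) / \<rho> * (4 * F.rad * cR * F.cc)) < ennreal (C * k powr (2 * real l - 1 - \<gamma>))"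
          unfolding radp N_def using C_pos kp by (intro ennreal_lessI) auto
      qed
      have gL: "norm (grad (\<lambda>\<tau>. lambda_sol l V q \<sigma> A \<epsilon> j \<tau> - of_real (lambda_hat l V q \<epsilon> j \<tau>)) t)
          < C * k powr (2 * real l - 1 - \<gamma>)"
      proof (rule le_less_trans[OF F.gradient_bounds(4)[OF tU]])
        have "N / \<rho> * (8 * rd * F.cc) < C * k powr (2 * real l - 1 - \<gamma>)" by (rule key) (use nn in auto)
        then show "real CARD('n) / \<rho> * (8 * F.rad * F.cc) < C * k powr (2 * real l - 1 - \<gamma>)"
          unfolding radp N_def .
      qed
      show "let \<gamma>\<^sub>1 = (2 * real l - real CARD('n) - 8 * \<delta>) / 2;
                  \<gamma> = min \<gamma>\<^sub>1 \<gamma>\<^sub>2;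
                  dE = (\<lambda>s r \<tau>. E_sol l V q \<sigma> A \<epsilon> j \<tau> s r - E_hat l V q \<epsilon> j \<tau> s r);
                  dlam = (\<lambda>\<tau>. lambda_sol l V q \<sigma> A \<epsilon> j \<tau> - of_real (lambda_hat l V q \<epsilon> j \<tau>))
              in (\<forall>s r. dE s r differentiable (at t))
                 \<and> norm0 (\<lambda>s r. grad (dE s r) t) < ennreal (C * k powr (2 * real l - 1 - \<gamma>))
                 \<and> dlam differentiable (at t)
                 \<and> norm (grad dlam t) < C * k powr (2 * real l - 1 - \<gamma>)"
        unfolding Let_def \<gamma>\<^sub>1_def[symmetric] \<gamma>_def[symmetric]
        using F.gradient_bounds(1)[OF tU] F.gradient_bounds(3)[OF tU] gE gL by blast
    qed
  qed
qed

end
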